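(* Let $X=X_\Sigma$ be a complete toric variety with torus $\mathbb T$, let $D$ be a globally generated $\mathbb T$-invariant Cartier divisor on $X$ with associated (not necessarily full-dimensional) lattice polytope $P_D\subset M_{\mathbb R}$, and let $Z\subset X$ be a closed $\mathbb T$-invariant subset. Then $$\chi_y^{\mathbb T}(Z,\mathcal O_X(D)|_Z)=\sum_{E\preceq P_D}\Big(\sum_{\ell\ge0}(-1)^\ell\cdot d_\ell(Z/E)\cdot(1+y)^{\ell+\dim(E)}\Big)\cdot\sum_{m\in\mathrm{Relint}(E)\cap M}e^{s(m)}.$$
   Context: $M\simeq\mathbb Z^n$ is a lattice with dual $N$, $\mathbb T=N\otimes\mathbb C^*$ with characters $\chi^m$. For $D=\sum_{\rho\in\Sigma(1)}a_\rho D_\rho$, $P_D=\{m\in M_{\mathbb R}\mid\langle m,u_\rho\rangle\ge-a_\rho\ \forall\rho\in\Sigma(1)\}$, a lattice polytope. $E\preceq P_D$ runs over the nonempty faces. Generalized fan and multiplicities: for a face $E\preceq P_D$ let $\sigma_E=\{u\in N_{\mathbb R}\mid\langle m,u\rangle\le\langle m',u\rangle\ \forall m\in E,\ m'\in P_D\}$. These cones form the (generalized) inner normal fan of $P_D$; its minimal cone $\sigma_{P_D}$ is a linear subspace, $N_D=N/(\sigma_{P_D}\cap N)$, and the images $\sigma'_E$ of the $\sigma_E$ in $(N_D)_{\mathbb R}$ form a fan $\Sigma'$ with toric variety $X_D$, whose cones correspond bijectively to the faces $E$ of $P_D$. The projection $N\to N_D$ induces a proper toric morphism $f:X\to X_D$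 (a toric fibration), which maps each $\mathbb T$-orbit $O_\sigma$, $\sigma\in\Sigma$, onto an orbit of $X_D$. For a face $E$ set $$d_\ell(Z/E):=\big|\{\sigma\in\Sigma\mid O_\sigma\subset Z,\ f(O_\sigma)=O_{\sigma'_E},\ \ell=\dim(O_\sigma)-\dim(O_{\sigma'_E})\}\big|.$$ The equivariant Hirzebruch polynomial is $\chi_y^{\mathbb T}(Z,\mathcal O_X(D)|_Z):=\sum_{p=0}^{\dim Z}\chi^{\mathbb T}(Z,\widetilde\Omega_Z^p\otimes\mathcal O_X(D)|_Z)\,y^p$. Here $\widetilde\Omega_Z^p$ is the sheaf of Ishida $p$-forms with canonical $\mathbb T$-action (equal to the Zariski $p$-forms if $Z$ is a toric variety). Explicitly, let $\Sigma_Z=\{\tau\in\Sigma\mid O_\tau\subset Z\}$; on the affine chart $U_\sigma$, $\sigma\in\Sigma$, for $m\in\sigma^\vee\cap M$ let $\tau_m\preceq\sigma$ be the face with $m\in\mathrm{Relint}(\sigma^\vee\cap\tau_m^\perp)$; then $H^0(U_\sigma\cap Z;\widetilde\Omega_Z^p)=\bigoplus_{m\in\sigma^\vee\cap M,\ \tau_m\in\Sigma_Z}\mathbb C\chi^m\otimes\Lambda^p(\tau_m^\perp\cap M)$, where $\chi^{m'}\cdot(\chi^m\otimes\omega)=\chi^{m+m'}\otimes\omega$ if $\tau_{m+m'}\in\Sigma_Z$ and $0$ otherwise, and $\mathbb T$ acts trivially on the $\Lambda^p$ factor and by $t\cdot\chi^m=\chi^m(t^{-1})\chi^m$ on functions.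 For a $\mathbb T$-representation $W$, $W_{\chi^m}=\{w\mid t\cdot w=\chi^m(t)w\ \forall t\}$. With $\mathbb C_{\chi^m}$ the equivariant line with character $\chi^m$, $c(m)=c_1^{\mathbb T}(\mathbb C_{\chi^m})\in H^2_{\mathbb T}(pt;\mathbb Z)$ and $s(m)=-c(m)$. For a $\mathbb T$-equivariant coherent sheaf $\mathcal G$ on $Z$, $\chi^{\mathbb T}(Z,\mathcal G)=\sum_{m\in M}\sum_i(-1)^i\dim_{\mathbb C}H^i(Z;\mathcal G)_{\chi^m}\,e^{c(m)}\in\widehat H^*_{\mathbb T}(pt;\mathbb Q)$. *)

theory Defs
  imports
    "HOL-Analysis.Analysis"
    "HOL-Combinatorics.Permutations"
    "HOL-Computational_Algebra.Polynomial"
    "HOL-Computational_Algebra.Formal_Power_Series"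
    "HOL-Library.Function_Algebras"
    "HOL-Library.Groups_Big_Fun"
begin

section \<open>Lattices and cones\<close>

text \<open>
  The lattice \<open>M\<close> and its dual \<open>N\<close> are both \<open>int ^ 'n\<close>, and
  \<open>M\<^sub>\<real>\<close>, \<open>N\<^sub>\<real>\<close> are both \<open>real ^ 'n\<close>; the pairing is the standard one
  (\<open>pairing\<close> over the integers, the inner product over the reals).
\<close>

definition pairing :: "int ^ 'n::finite \<Rightarrow> int ^ 'n \<Rightarrow> int" where
  "pairing m u = (\<Sum>i\<in>UNIV. m $ i * u $ i)"

definition rvec :: "int ^ 'n::finite \<Rightarrow> real ^ 'n" where
  "rvec m = (\<chi> i. real_of_int (m $ i))"

definition dual_cone :: "(real ^ 'n::finite) set \<Rightarrow> (real ^ 'n) set" where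
  "dual_cone \<sigma> = {m. \<forall>u\<in>\<sigma>. 0 \<le> m \<bullet> u}"

definition perp :: "(real ^ 'n::finite) set \<Rightarrow> (real ^ 'n) set" where
  "perp \<sigma> = {m. \<forall>u\<in>\<sigma>. m \<bullet> u = 0}"

definition perp_lattice :: "(real ^ 'n::finite) set \<Rightarrow> (int ^ 'n) set" where
  "perp_lattice \<sigma> = {m. rvec m \<in> perp \<sigma>}"

definition rational_polyhedral_cone :: "(real ^ 'n::finite) set \<Rightarrow> bool" where
  "rational_polyhedral_cone \<sigma> \<longleftrightarrow>
     (\<exists>S :: (int ^ 'n) set. finite S \<and> \<sigma> = convex_cone hull (rvec ` S))"

definition strongly_convex :: "(real ^ 'n::finite) set \<Rightarrow> bool" where
  "strongly_convex \<sigma> \<longleftrightarrow> \<sigma> \<inter> uminus ` \<sigma> = {0}"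

definition fan :: "(real ^ 'n::finite) set set \<Rightarrow> bool" where
  "fan \<Sigma> \<longleftrightarrow> finite \<Sigma> \<and>
     (\<forall>\<sigma>\<in>\<Sigma>. rational_polyhedral_cone \<sigma> \<and> strongly_convex \<sigma>) \<and>
     (\<forall>\<sigma>\<in>\<Sigma>. \<forall>\<tau>. \<tau> face_of \<sigma> \<and> \<tau> \<noteq> {} \<longrightarrow> \<tau> \<in> \<Sigma>) \<and>
     (\<forall>\<sigma>\<in>\<Sigma>. \<forall>\<tau>\<in>\<Sigma>. (\<sigma> \<inter> \<tau>) face_of \<sigma> \<and> (\<sigma> \<inter> \<tau>) face_of \<tau>)"

definition complete_fan :: "(real ^ 'n::finite) set set \<Rightarrow> bool" where
  "complete_fan \<Sigma> \<longleftrightarrow> fan \<Sigma> \<and> \<Union>\<Sigma> = UNIV"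

text \<open>The rays of a cone, and the generator \<open>u\<^sub>\<rho>\<close> of the monoid \<open>\<rho> \<inter> N\<close>.\<close>

definition rays :: "(real ^ 'n::finite) set \<Rightarrow> (real ^ 'n) set set" where
  "rays \<sigma> = {\<rho>. \<rho> face_of \<sigma> \<and> dim \<rho> = 1}"

definition fan_rays :: "(real ^ 'n::finite) set set \<Rightarrow> (real ^ 'n) set set" where
  "fan_rays \<Sigma> = {\<rho>\<in>\<Sigma>. dim \<rho> = 1}"

definition ray_gen :: "(real ^ 'n::finite) set \<Rightarrow> int ^ 'n" where
  "ray_gen \<rho> = (THE u. u \<noteq> 0 \<and> rvec u \<in> \<rho> \<and>
     (\<forall>v. rvec v \<in> \<rho> \<longrightarrow> (\<exists>k::nat. v = (\<chi> i. int k * u $ i))))"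


section \<open>The torus and toric varieties\<close>

text \<open>\<open>\<T> = N \<otimes> \<complex>\<^sup>*\<close> in coordinates.\<close>

definition torus :: "(complex ^ 'n::finite) set" where
  "torus = {t. \<forall>i. t $ i \<noteq> 0}"

definition character :: "int ^ 'n::finite \<Rightarrow> complex ^ 'n \<Rightarrow> complex" where
  "character m t = (\<Prod>i\<in>UNIV. (t $ i) powi (m $ i))"

definition torus_inv :: "complex ^ 'n::finite \<Rightarrow> complex ^ 'n" where
  "torus_inv t = (\<chi> i. inverse (t $ i))"

text \<open>
  A closed point of \<open>X\<^sub>\<Sigma>\<close> is a pair \<open>(\<sigma>, \<gamma>)\<close>: \<open>\<sigma> \<in> \<Sigma>\<close> names the orbit, and
  \<open>\<gamma>\<close> is the group homomorphism \<open>\<sigma>\<^sup>\<bottom> \<inter> M \<rightarrow> \<complex>\<^sup>*\<close> given by the point of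
  \<open>O\<^sub>\<sigma> = Hom(\<sigma>\<^sup>\<bottom> \<inter> M, \<complex>\<^sup>*)\<close>, extended by \<open>0\<close> to \<open>M\<close>.  With this extension, if
  \<open>\<sigma>\<close> is a face of \<open>\<sigma>'\<close> then \<open>\<gamma>\<close> restricted to \<open>\<sigma>'\<^sup>\<or> \<inter> M\<close> is the semigroup
  homomorphism to \<open>(\<complex>, \<cdot>)\<close> that the point defines in the chart \<open>U\<^sub>\<sigma>\<^sub>'\<close>; thus \<open>\<gamma> m\<close> is
  the value of \<open>\<chi>\<^sup>m\<close> at the point for every \<open>m \<in> \<sigma>'\<^sup>\<or> \<inter> M\<close>.

  The same construction applies to a generalized fan, all of whose cones contain the
  minimal cone \<open>\<sigma>\<^sub>0\<close>, a linear subspace.  For the quotient \<open>N' = N / (\<sigma>\<^sub>0 \<inter> N)\<close>, whose dual is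
  \<open>M' = \<sigma>\<^sub>0\<^sup>\<bottom> \<inter> M\<close>, and the image \<open>\<sigma>'\<close> of \<open>\<sigma>\<close> in \<open>N'\<^sub>\<real>\<close>, one has
  \<open>\<sigma>'\<^sup>\<bottom> \<inter> M' = \<sigma>\<^sup>\<bottom> \<inter> M\<close> and \<open>\<sigma>'\<^sup>\<or> \<inter> M' = \<sigma>\<^sup>\<or> \<inter> M\<close>, so
  the pairs below are the points of the toric variety of the quotient fan; the
  orbit of \<open>\<sigma>'\<close> is the one labelled by \<open>\<sigma>\<close>.
\<close>

type_synonym 'n point = "(real ^ 'n) set \<times> (int ^ 'n \<Rightarrow> complex)"

definition orbit :: "(real ^ 'n::finite) set \<Rightarrow> 'n point set" where
  "orbit \<sigma> = {\<sigma>} \<times> {\<gamma>. \<gamma> 0 = 1 \<and>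
     (\<forall>m\<in>perp_lattice \<sigma>. \<forall>m'\<in>perp_lattice \<sigma>. \<gamma> (m + m') = \<gamma> m * \<gamma> m') \<and>
     (\<forall>m. m \<notin> perp_lattice \<sigma> \<longrightarrow> \<gamma> m = 0)}"

text \<open>\<open>O\<^sub>\<sigma>\<close> is a torus with character lattice \<open>\<sigma>\<^sup>\<bottom> \<inter> M\<close>.\<close>

definition orbit_dim :: "(real ^ 'n::finite) set \<Rightarrow> nat" where
  "orbit_dim \<sigma> = dim (perp \<sigma>)"

definition toric_variety :: "(real ^ 'n::finite) set set \<Rightarrow> 'n point set" where
  "toric_variety \<Sigma> = (\<Union>\<sigma>\<in>\<Sigma>. orbit \<sigma>)"

definition chart :: "(real ^ 'n::finite) set set \<Rightarrow> (real ^ 'n) set \<Rightarrow> 'n point set" where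
  "chart \<Sigma> \<sigma> = (\<Union>\<tau>\<in>{\<tau>\<in>\<Sigma>. \<tau> face_of \<sigma>}. orbit \<tau>)"

definition torus_act :: "complex ^ 'n::finite \<Rightarrow> 'n point \<Rightarrow> 'n point" where
  "torus_act t x = (fst x, \<lambda>m. character m t * snd x m)"

text \<open>The coordinate ring \<open>\<complex>[\<sigma>\<^sup>\<or> \<inter> M]\<close> of \<open>U\<^sub>\<sigma>\<close>, by coefficients, and evaluation.\<close>

definition regular_functions :: "(real ^ 'n::finite) set \<Rightarrow> (int ^ 'n \<Rightarrow> complex) set" where
  "regular_functions \<sigma> = {g. finite {m. g m \<noteq> 0} \<and> (\<forall>m. g m \<noteq> 0 \<longrightarrow> rvec m \<in> dual_cone \<sigma>)}"

definition eval_at :: "(int ^ 'n::finite \<Rightarrow> complex) \<Rightarrow> 'n point \<Rightarrow> complex" where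
  "eval_at g x = (\<Sum>m | g m \<noteq> 0. g m * snd x m)"

definition zariski_closed :: "(real ^ 'n::finite) set set \<Rightarrow> 'n point set \<Rightarrow> bool" where
  "zariski_closed \<Sigma> Z \<longleftrightarrow> Z \<subseteq> toric_variety \<Sigma> \<and>
     (\<forall>\<sigma>\<in>\<Sigma>. \<exists>G \<subseteq> regular_functions \<sigma>.
        Z \<inter> chart \<Sigma> \<sigma> = {x \<in> chart \<Sigma> \<sigma>. \<forall>g\<in>G. eval_at g x = 0})"

definition torus_invariant :: "'n::finite point set \<Rightarrow> bool" where
  "torus_invariant Z \<longleftrightarrow> (\<forall>t\<in>torus. \<forall>x\<in>Z. torus_act t x \<in> Z)"

text \<open>\<open>\<Sigma>\<^sub>Z\<close>, and the dimension of \<open>Z\<close> (the largest dimension of an orbit in \<open>Z\<close>; \<open>0\<close> if \<open>Z\<close> is empty).\<close>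

definition cones_in ::
    "(real ^ 'n::finite) set set \<Rightarrow> 'n point set \<Rightarrow> (real ^ 'n) set set" where
  "cones_in \<Sigma> Z = {\<tau>\<in>\<Sigma>. orbit \<tau> \<subseteq> Z}"

definition dim_of :: "(real ^ 'n::finite) set set \<Rightarrow> 'n point set \<Rightarrow> nat" where
  "dim_of \<Sigma> Z = Sup (orbit_dim ` cones_in \<Sigma> Z)"

text \<open>
  The toric morphism induced by a lattice projection to the toric variety of a (generalized) fan
  \<open>\<Sigma>'\<close> refined by \<open>\<Sigma>\<close>.  If \<open>\<sigma>'\<close> is the smallest cone of \<open>\<Sigma>'\<close> containing
  \<open>\<sigma>\<close>, a point of \<open>U\<^sub>\<sigma>\<close> goes to the point of \<open>U\<^sub>\<sigma>\<^sub>'\<close> given by restricting its semigroup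
  homomorphism to \<open>\<sigma>'\<^sup>\<or> \<inter> M\<close>.  For a point of \<open>O\<^sub>\<sigma>\<close> this restriction is
  supported on \<open>\<sigma>'\<^sup>\<bottom> \<inter> M\<close>, because the relative interior of \<open>\<sigma>\<close> lies in that of \<open>\<sigma>'\<close>.
\<close>

definition toric_morphism :: "(real ^ 'n::finite) set set \<Rightarrow> 'n point \<Rightarrow> 'n point" where
  "toric_morphism \<Sigma>' x =
     (let \<sigma>' = \<Inter>{\<sigma>'\<in>\<Sigma>'. fst x \<subseteq> \<sigma>'}
      in (\<sigma>', \<lambda>m. if m \<in> perp_lattice \<sigma>' then snd x m else 0))"


section \<open>Divisors\<close>

text \<open>A torus-invariant Weil divisor \<open>D = \<Sum>\<^sub>\<rho> a\<^sub>\<rho> D\<^sub>\<rho>\<close> is given by its coefficients \<open>a\<close> on the rays.\<close>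

definition cartier ::
    "(real ^ 'n::finite) set set \<Rightarrow> ((real ^ 'n) set \<Rightarrow> int) \<Rightarrow> bool" where
  "cartier \<Sigma> a \<longleftrightarrow>
     (\<forall>\<sigma>\<in>\<Sigma>. \<exists>m. \<forall>\<rho>\<in>rays \<sigma>. pairing m (ray_gen \<rho>) = - a \<rho>)"

text \<open>
  \<open>m\<^sub>\<sigma>\<close>, such that \<open>\<O>\<^sub>X(D)\<close> restricted to \<open>U\<^sub>\<sigma>\<close> is freely generated by \<open>\<chi>\<close> to the power \<open>m\<^sub>\<sigma>\<close>.
  It is unique up to \<open>\<sigma>\<^sup>\<bottom> \<inter> M\<close>, and the constructions below do not depend on the choice.
\<close>

definition cartier_datum ::
    "((real ^ 'n::finite) set \<Rightarrow> int) \<Rightarrow> (real ^ 'n) set \<Rightarrow> int ^ 'n" where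
  "cartier_datum a \<sigma> = (SOME m. \<forall>\<rho>\<in>rays \<sigma>. pairing m (ray_gen \<rho>) = - a \<rho>)"

definition divisor_sections ::
    "((real ^ 'n::finite) set \<Rightarrow> int) \<Rightarrow> (real ^ 'n) set \<Rightarrow> (int ^ 'n \<Rightarrow> complex) set" where
  "divisor_sections a \<sigma> = {s. (\<lambda>m. s (m + cartier_datum a \<sigma>)) \<in> regular_functions \<sigma>}"

text \<open>
  Since \<open>D\<close> does not meet the open torus, global sections of \<open>\<O>\<^sub>X(D)\<close> are the Laurent
  polynomials that are sections on every chart.  The sheaf is globally generated iff at every
  point some global section is nonzero in the fibre, i.e. after division by the local generator.
\<close>

definition globally_generated ::
    "(real ^ 'n::finite) set set \<Rightarrow> ((real ^ 'n) set \<Rightarrow> int) \<Rightarrow> bool" where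
  "globally_generated \<Sigma> a \<longleftrightarrow>
     (\<forall>x\<in>toric_variety \<Sigma>. \<exists>s\<in>(\<Inter>\<sigma>\<in>\<Sigma>. divisor_sections a \<sigma>).
        eval_at (\<lambda>m. s (m + cartier_datum a (fst x))) x \<noteq> 0)"

definition divisor_polytope ::
    "(real ^ 'n::finite) set set \<Rightarrow> ((real ^ 'n) set \<Rightarrow> int) \<Rightarrow> (real ^ 'n) set" where
  "divisor_polytope \<Sigma> a =
     {m. \<forall>\<rho>\<in>fan_rays \<Sigma>. m \<bullet> rvec (ray_gen \<rho>) \<ge> - real_of_int (a \<rho>)}"

definition normal_cone :: "(real ^ 'n::finite) set \<Rightarrow> (real ^ 'n) set \<Rightarrow> (real ^ 'n) set" where
  "normal_cone P E = {u. \<forall>m\<in>E. \<forall>m'\<in>P. m \<bullet> u \<le> m' \<bullet> u}"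

definition normal_fan :: "(real ^ 'n::finite) set \<Rightarrow> (real ^ 'n) set set" where
  "normal_fan P = {normal_cone P E | E. E face_of P \<and> E \<noteq> {}}"

text \<open>
  \<open>d\<^sub>\<ell>(Z/E)\<close>, with \<open>f : X \<rightarrow> X\<^sub>D\<close> the morphism to the toric variety of the generalized normal
  fan of \<open>P\<^sub>D\<close>.
\<close>

definition fibre_mult ::
    "(real ^ 'n::finite) set set \<Rightarrow> ((real ^ 'n) set \<Rightarrow> int) \<Rightarrow> 'n point set \<Rightarrow>
     (real ^ 'n) set \<Rightarrow> nat \<Rightarrow> nat" where
  "fibre_mult \<Sigma> a Z E l =
     (let P = divisor_polytope \<Sigma> a; \<sigma>E = normal_cone P E
      in card {\<sigma>\<in>\<Sigma>. orbit \<sigma> \<subseteq> Z \<and> toric_morphism (normal_fan P) ` orbit \<sigma> = orbit \<sigma>E \<and>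
                int l = int (orbit_dim \<sigma>) - int (orbit_dim \<sigma>E)})"


section \<open>Equivariant \<open>H\<^sup>*\<^sub>\<T>(pt)\<close>\<close>

text \<open>
  The completed ring \<open>\<Prod>\<^sub>k Sym\<^sup>k(M\<^sub>\<rat>)\<close> is identified with a subring of the ring of functions
  \<open>N \<rightarrow> \<rat>[[t]]\<close> (pointwise operations): a class of degree \<open>2k\<close> is the function
  \<open>u \<mapsto> q(u) t\<^sup>k\<close> for a homogeneous polynomial function \<open>q\<close> of degree \<open>k\<close> on \<open>N\<close>, and \<open>c(m)\<close>
  corresponds to the linear form \<open>m\<close>.  The identification is injective as polynomials over
  \<open>\<rat>\<close> are determined by their values on \<open>N\<close>.
\<close>

type_synonym 'n eq_class = "int ^ 'n \<Rightarrow> rat fps"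

definition c_class :: "int ^ 'n::finite \<Rightarrow> 'n eq_class" where
  "c_class m = (\<lambda>u. fps_const (of_int (pairing m u)) * fps_X)"

definition s_class :: "int ^ 'n::finite \<Rightarrow> 'n eq_class" where
  "s_class m = - c_class m"

definition exp_class :: "'n::finite eq_class \<Rightarrow> 'n eq_class" where
  "exp_class b = (\<lambda>u. fps_exp 1 oo b u)"


section \<open>Cohomology of equivariant sheaves\<close>

definition fscale :: "complex \<Rightarrow> ('b \<Rightarrow> complex) \<Rightarrow> 'b \<Rightarrow> complex" where
  "fscale c f = (\<lambda>x. c * f x)"

global_interpretation fun_vs: vector_space fscale
  by unfold_locales (auto simp: fscale_def fun_eq_iff algebra_simps)

text \<open>\<open>dim (W / U)\<close> for subspaces \<open>U \<subseteq> W\<close>, as the dimension of a complement (\<open>0\<close> if infinite).\<close>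

definition quot_dim :: "('b \<Rightarrow> complex) set \<Rightarrow> ('b \<Rightarrow> complex) set \<Rightarrow> nat" where
  "quot_dim W U = fun_vs.dim (SOME C. fun_vs.subspace C \<and> C \<inter> U = {0} \<and>
     {x + y | x y. x \<in> C \<and> y \<in> U} = W)"

text \<open>
  A section over a chart is \<open>\<Sum>\<^sub>m \<chi>\<^sup>m \<otimes> w\<^sub>m\<close> with \<open>w\<^sub>m\<close> in a fixed vector space of functions
  \<open>'b \<Rightarrow> complex\<close>; it is encoded as the function \<open>(m, b) \<mapsto> w\<^sub>m(b)\<close>.  A sheaf is given by its
  sections \<open>S \<sigma>\<close> over the members \<open>U\<^sub>\<sigma>\<close> (\<open>\<sigma> \<in> \<Sigma>\<close>) of the affine invariant cover, and the restriction
  maps \<open>R \<tau>\<close> to \<open>U\<^sub>\<tau>\<close> from a larger chart.  Its cohomology is that of the alternating Cech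
  complex of this cover, where \<open>U\<^sub>\<sigma> \<inter> U\<^sub>\<tau>\<close> is the chart of \<open>\<sigma> \<inter> \<tau>\<close>.
  Cochains of degree \<open>q\<close> are extended by \<open>0\<close> to lists that are not \<open>(q+1)\<close>-tuples of cones of \<open>\<Sigma>\<close>.
\<close>

type_synonym ('n, 'b) chart_section = "(int ^ 'n) \<times> 'b \<Rightarrow> complex"
type_synonym ('n, 'b) cochain = "(real ^ 'n) set list \<times> (int ^ 'n) \<times> 'b \<Rightarrow> complex"

definition component ::
    "('n::finite, 'b) cochain \<Rightarrow> (real ^ 'n) set list \<Rightarrow> ('n, 'b) chart_section" where
  "component c ss = (\<lambda>(m, b). c (ss, m, b))"

definition cech_cochains ::
    "(real ^ 'n::finite) set set \<Rightarrow> ((real ^ 'n) set \<Rightarrow> ('n, 'b) chart_section set) \<Rightarrow>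
     nat \<Rightarrow> ('n, 'b) cochain set" where
  "cech_cochains \<Sigma> S q = {c.
     (\<forall>ss. if length ss = Suc q \<and> set ss \<subseteq> \<Sigma> then component c ss \<in> S (\<Inter>(set ss))
           else component c ss = 0) \<and>
     (\<forall>ss i j. i < j \<and> j < length ss \<longrightarrow>
        component c (ss[i := ss ! j, j := ss ! i]) = - component c ss)}"

definition cech_diff ::
    "(real ^ 'n::finite) set set \<Rightarrow>
     ((real ^ 'n) set \<Rightarrow> ('n, 'b) chart_section \<Rightarrow> ('n, 'b) chart_section) \<Rightarrow>
     nat \<Rightarrow> ('n, 'b) cochain \<Rightarrow> ('n, 'b) cochain" where
  "cech_diff \<Sigma> R q c = (\<lambda>(ss, x).
     if length ss = Suc (Suc q) \<and> set ss \<subseteq> \<Sigma>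
     then \<Sum>j<length ss. (-1) ^ j *
            R (\<Inter>(set ss)) (component c (take j ss @ drop (Suc j) ss)) x
     else 0)"

definition cech_cocycles where
  "cech_cocycles \<Sigma> S R q = {c \<in> cech_cochains \<Sigma> S q. cech_diff \<Sigma> R q c = 0}"

definition cech_coboundaries where
  "cech_coboundaries \<Sigma> S R q =
     (if q = 0 then {0} else cech_diff \<Sigma> R (q - 1) ` cech_cochains \<Sigma> S (q - 1))"

text \<open>The torus acts by \<open>t \<cdot> \<chi>\<^sup>m = \<chi>\<^sup>m(t\<^sup>-\<^sup>1) \<chi>\<^sup>m\<close>, and trivially on the vector space factor.\<close>

definition cochain_act ::
    "complex ^ 'n::finite \<Rightarrow> ('n, 'b) cochain \<Rightarrow> ('n, 'b) cochain" where
  "cochain_act t c = (\<lambda>(ss, m, b). character m (torus_inv t) * c (ss, m, b))"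

text \<open>
  The dimension of the weight space of \<open>H\<^sup>q\<close> (cocycles modulo coboundaries) for \<open>\<chi>\<^sup>m\<close>: a class lies in it iff
  \<open>t \<cdot> w = \<chi>\<^sup>m(t) w\<close> modulo coboundaries.
\<close>

definition weight_dim ::
    "(real ^ 'n::finite) set set \<Rightarrow> ((real ^ 'n) set \<Rightarrow> ('n, 'b) chart_section set) \<Rightarrow>
     ((real ^ 'n) set \<Rightarrow> ('n, 'b) chart_section \<Rightarrow> ('n, 'b) chart_section) \<Rightarrow>
     nat \<Rightarrow> int ^ 'n \<Rightarrow> nat" where
  "weight_dim \<Sigma> S R q m = quot_dim
     {w \<in> cech_cocycles \<Sigma> S R q. \<forall>t\<in>torus.
        cochain_act t w - fscale (character m t) w \<in> cech_coboundaries \<Sigma> S R q}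
     (cech_coboundaries \<Sigma> S R q)"

text \<open>Alternating cochains vanish in degrees \<open>\<ge> card \<Sigma>\<close>.\<close>

definition eq_euler_char ::
    "(real ^ 'n::finite) set set \<Rightarrow> ((real ^ 'n) set \<Rightarrow> ('n, 'b) chart_section set) \<Rightarrow>
     ((real ^ 'n) set \<Rightarrow> ('n, 'b) chart_section \<Rightarrow> ('n, 'b) chart_section) \<Rightarrow> 'n eq_class" where
  "eq_euler_char \<Sigma> S R = Sum_any (\<lambda>m.
     of_int (\<Sum>i<card \<Sigma>. (-1) ^ i * int (weight_dim \<Sigma> S R i m)) * exp_class (c_class m))"


section \<open>Ishida forms and the equivariant Hirzebruch polynomial\<close>

text \<open>
  \<open>\<Lambda>\<^sup>p(M) \<otimes> \<complex>\<close> is realised as the space of alternating \<open>p\<close>-forms on \<open>N\<close>: \<open>m\<^sub>1 \<and> \<dots> \<and> m\<^sub>p\<close> is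
  the form \<open>(u\<^sub>1, \<dots>, u\<^sub>p) \<mapsto> det (\<langle>m\<^sub>i, u\<^sub>j\<rangle>)\<close>, extended by \<open>0\<close> to lists of other lengths.
\<close>

definition wedge :: "(int ^ 'n::finite) list \<Rightarrow> (int ^ 'n) list \<Rightarrow> complex" where
  "wedge ms us = (if length us = length ms
     then \<Sum>\<pi> | \<pi> permutes {..<length ms}.
            of_int (sign \<pi>) * (\<Prod>i<length ms. of_int (pairing (ms ! i) (us ! \<pi> i)))
     else 0)"

definition ext_power ::
    "nat \<Rightarrow> (int ^ 'n::finite) set \<Rightarrow> ((int ^ 'n) list \<Rightarrow> complex) set" where
  "ext_power p L = fun_vs.span {wedge ms | ms. length ms = p \<and> set ms \<subseteq> L}"

text \<open>\<open>\<tau>\<^sub>m\<close> for \<open>m \<in> \<sigma>\<^sup>\<or> \<inter> M\<close>.\<close>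

definition face_at :: "(real ^ 'n::finite) set \<Rightarrow> int ^ 'n \<Rightarrow> (real ^ 'n) set" where
  "face_at \<sigma> m = (THE \<tau>. \<tau> face_of \<sigma> \<and> \<tau> \<noteq> {} \<and> rvec m \<in> rel_interior (dual_cone \<sigma> \<inter> perp \<tau>))"

type_synonym 'n form_section = "('n, (int ^ 'n) list) chart_section"

definition ishida_forms ::
    "(real ^ 'n::finite) set set \<Rightarrow> nat \<Rightarrow> (real ^ 'n) set \<Rightarrow> 'n form_section set" where
  "ishida_forms \<Sigma>Z p \<sigma> = {s. finite {m. \<exists>us. s (m, us) \<noteq> 0} \<and>
     (\<forall>m. if rvec m \<in> dual_cone \<sigma> \<and> face_at \<sigma> m \<in> \<Sigma>Z
          then (\<lambda>us. s (m, us)) \<in> ext_power p (perp_lattice (face_at \<sigma> m))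
          else (\<lambda>us. s (m, us)) = 0)}"

text \<open>
  Sections of the twist by \<open>\<O>\<^sub>X(D)\<close>: on \<open>U\<^sub>\<sigma>\<close> multiply by the generator \<open>\<chi>\<close> to the power \<open>m\<^sub>\<sigma>\<close>.
\<close>

definition twisted_forms ::
    "((real ^ 'n::finite) set \<Rightarrow> int) \<Rightarrow> (real ^ 'n) set set \<Rightarrow> nat \<Rightarrow>
     (real ^ 'n) set \<Rightarrow> 'n form_section set" where
  "twisted_forms a \<Sigma>Z p \<sigma> =
     {s. (\<lambda>(m, us). s (m + cartier_datum a \<sigma>, us)) \<in> ishida_forms \<Sigma>Z p \<sigma>}"

text \<open>
  Restriction is localization.  If \<open>\<tau> = \<sigma> \<inter> \<mu>\<^sup>\<bottom>\<close> with \<open>\<mu> \<in> \<sigma>\<^sup>\<or> \<inter> M\<close>, an untwisted section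
  \<open>\<chi>\<^sup>m \<otimes> \<omega>\<close> on \<open>U\<^sub>\<sigma>\<close> goes to \<open>\<chi>\<^sup>-\<^sup>\<mu> (\<chi>\<^sup>\<mu> \<cdot> (\<chi>\<^sup>m \<otimes> \<omega>))\<close> on \<open>U\<^sub>\<tau>\<close>.  By the
  module structure this is \<open>\<chi>\<^sup>m \<otimes> \<omega>\<close> if the face of \<open>\<sigma>\<close> attached to \<open>m + \<mu>\<close>, which is the
  face of \<open>\<tau>\<close> attached to \<open>m\<close>, belongs to \<open>\<Sigma>\<^sub>Z\<close>, and \<open>0\<close> otherwise.
\<close>

definition twisted_restrict ::
    "((real ^ 'n::finite) set \<Rightarrow> int) \<Rightarrow> (real ^ 'n) set set \<Rightarrow>
     (real ^ 'n) set \<Rightarrow> 'n form_section \<Rightarrow> 'n form_section" where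
  "twisted_restrict a \<Sigma>Z \<tau> s =
     (\<lambda>(m, us). if face_at \<tau> (m - cartier_datum a \<tau>) \<in> \<Sigma>Z then s (m, us) else 0)"

definition hirzebruch_poly ::
    "(real ^ 'n::finite) set set \<Rightarrow> ((real ^ 'n) set \<Rightarrow> int) \<Rightarrow> 'n point set \<Rightarrow>
     'n eq_class poly" where
  "hirzebruch_poly \<Sigma> a Z = (\<Sum>p\<le>dim_of \<Sigma> Z.
     monom (eq_euler_char \<Sigma> (twisted_forms a (cones_in \<Sigma> Z) p)
              (twisted_restrict a (cones_in \<Sigma> Z))) p)"

end

theory Submission
  imports Defs
begin

text \<open>
  The cohomology groups never have to be computed.  In a fixed weight \<open>m\<close> the Cech complex is finite
  dimensional, so the equivariant Euler characteristic is an alternating sum of dimensions of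
  cochain spaces, indexed by the nonempty sets of cones.  As the cones containing a given cone
  \<open>\<tau>\<close> of a complete fan satisfy \<open>\<Sum> (-1)\<^bsup>codim \<sigma>\<^esup> = 1\<close>, Moebius inversion turns it into
  \<open>\<Sum>\<^sub>\<sigma> (-1)\<^bsup>codim \<sigma>\<^esup> dim F\<^sub>\<sigma>(m)\<close>, where \<open>F\<^sub>\<sigma>(m)\<close> is the weight space of the sections on \<open>U\<^sub>\<sigma>\<close>, an
  exterior power that depends only on the face \<open>\<sigma> \<inter> {h = 0}\<close> of \<open>\<sigma>\<close>; here \<open>h = m - \<psi>\<close>
  with \<open>\<psi>\<close> the support function of \<open>D\<close>, and \<open>F\<^sub>\<sigma>(m) \<noteq> 0\<close> forces \<open>h \<ge> 0\<close> on \<open>\<sigma>\<close>.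

  The sums over all \<open>\<sigma>\<close> with a given face \<open>\<sigma> \<inter> {h = 0}\<close> are found by a second Moebius inversion,
  whose input is the following local Euler relation: if \<open>K\<close> is convex and relatively open with a
  relative interior point of \<open>\<tau>\<close> in its closure, then summing \<open>(-1)\<^bsup>dim\<^esup>\<close> over the nonempty cells
  \<open>Relint \<sigma> \<inter> K\<close> with \<open>\<sigma> \<supseteq> \<tau>\<close> gives \<open>(-1)\<^bsup>dim K\<^esup>\<close>.  For \<open>m\<close> outside \<open>P\<^sub>D\<close> it is applied to
  \<open>K = {h < 0}\<close>, and everything cancels; for \<open>m\<close> in the relative interior of a face \<open>E\<close> it is applied to
  the relative interior of the normal cone of \<open>E\<close>, which leaves the cones whose orbit is
  mapped onto the orbit of \<open>E\<close>.
\<close>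

subsection \<open>Complements and dimensions\<close>

text \<open>Global generation enters as convexity: \<open>psi\<close> becomes the minimum of
  finitely many linear forms, so {h < 0} is an open convex set, and the relative interior of a
  normal cone is a linear subspace cut by open half-spaces. Closedness of Z enters as upward closure
  of its set of cones, which makes the restriction maps compose.

  The shape of the formula comes from the exterior powers: a face \<tau> contributes the binomial
  coefficient of dim O_\<tau> over p, with generating function (1 + y)^(dim O_\<tau>) in y. If
  O_\<tau> lies over the orbit of E, then dim O_\<tau> = l + dim E, and the sign left by the second
  inversion, (-1)^(dim O_\<tau> + dim E), is (-1)^l. The exponent is s(m) because the torus acts on
  the function \<chi>^m through the character of -m.

  Cohomological weight spaces are defined modulo coboundaries, inside spaces that may be
  infinite-dimensional over all weights together, and their dimension is that of an unspecified
  complement. Hence the linear algebra that comes before any geometry: it allows a reduction to one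
  weight at a time.\<close>

context vector_space
begin

text \<open>The coordinates of x in the basis B are supported both in A and in its
  complement.\<close>

lemma span_Int_span_Diff:
  assumes "independent B" "A \<subseteq> B" "x \<in> span A" "x \<in> span (B - A)"
  shows "x = 0"
proof -
  have i: "independent A" "independent (B - A)"
    using assms(1,2) independent_mono by blast+
  have e: "representation B x = representation A x" "representation B x = representation (B - A) x"
    using assms i by (auto intro!: representation_extend)
  have "representation B x b = 0" for b
    using representation_ne_zero[of A x b] representation_ne_zero[of "B - A" x b] e by (metis DiffD2)
  moreover have "x \<in> span B" using assms span_mono by blast
  ultimately show ?thesis using sum_nonzero_representation_eq[OF assms(1), of x] by simp
qed

text \<open>Families instead of sets keep repeated vectors visible: injectivity becomes a
  conclusion, and bases can be counted by their index sets.\<close>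

lemma independent_family:
  assumes "finite I" and "\<forall>c. (\<Sum>i\<in>I. scale (c i) (f i)) = 0 \<longrightarrow> (\<forall>i\<in>I. c i = 0)"
  shows "inj_on f I" "independent (f ` I)"
proof -
  show inj: "inj_on f I"
  proof (rule inj_onI, rule ccontr)
    fix i j assume ij: "i \<in> I" "j \<in> I" "f i = f j" "i \<noteq> j"
    define c :: "_ \<Rightarrow> 'a" where "c k = (if k = i then 1 else if k = j then -1 else 0)" for k
    have "(\<Sum>k\<in>I. scale (c k) (f k)) = (\<Sum>k\<in>{i, j}. scale (c k) (f k))"
      using assms(1) ij by (intro sum.mono_neutral_right) (auto simp: c_def)
    also have "\<dots> = 0" using ij by (simp add: c_def)
    finally show False using assms(2)[rule_format, of c i] ij by (simp add: c_def)
  qed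
  show "independent (f ` I)"
  proof (rule independent_if_scalars_zero)
    show "finite (f ` I)" using assms by simp
    fix g x assume g: "(\<Sum>x\<in>f ` I. scale (g x) x) = 0" "x \<in> f ` I"
    then obtain i where i: "x = f i" "i \<in> I" by blast
    have "(\<Sum>i\<in>I. scale (g (f i)) (f i)) = 0" using g(1) inj by (simp add: sum.reindex)
    thus "g x = 0" using assms(2)[rule_format, of "\<lambda>i. g (f i)" i] i by simp
  qed
qed

lemma dim_family:
  assumes "finite I" and "\<forall>c. (\<Sum>i\<in>I. scale (c i) (f i)) = 0 \<longrightarrow> (\<forall>i\<in>I. c i = 0)"
    and "f ` I \<subseteq> V" "V \<subseteq> span (f ` I)"
  shows "dim V = card I"
  using independent_family[OF assms(1,2)] dim_unique[OF assms(3,4)] card_image by blast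

lemma finite_independent_in_span:
  assumes "V \<subseteq> span T" "finite T" "independent B" "B \<subseteq> V"
  shows "finite B"
  using independent_span_bound[OF assms(2,3)] assms by blast

lemma span_split:
  assumes "A \<subseteq> B" "x \<in> span B"
  shows "\<exists>y z. x = y + z \<and> y \<in> span A \<and> z \<in> span (B - A)"
proof -
  have "B = A \<union> (B - A)" using assms by blast
  hence "x \<in> {y + z |y z. y \<in> span A \<and> z \<in> span (B - A)}" using assms(2) span_Un by metis
  thus ?thesis by blast
qed

text \<open>Modulo U every vector of C is congruent to one of \<open>span D\<close>. A linear
  relation among the replacements of B gives an element of C \<inter> U, hence a relation of B.
  Applied in both directions, this compares two complements of U even when U is
  infinite-dimensional.\<close>

lemma complement_bound:
  assumes "subspace U" "subspace C" "C \<inter> U = {0}" and "finite D"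
    and "\<And>c. c \<in> C \<Longrightarrow> \<exists>d\<in>span D. c - d \<in> U"
    and "finite B" "independent B" "B \<subseteq> C"
  shows "card B \<le> card D"
proof -
  obtain f where f: "\<And>b. b \<in> B \<Longrightarrow> f b \<in> span D" "\<And>b. b \<in> B \<Longrightarrow> b - f b \<in> U"
    using assms(5,8) by (metis subsetD)
  have fam: "\<forall>i\<in>B. c i = 0" if "(\<Sum>b\<in>B. scale (c b) (f b)) = 0" for c
  proof -
    have "(\<Sum>b\<in>B. scale (c b) b) = (\<Sum>b\<in>B. scale (c b) (b - f b))"
      using that by (simp add: scale_right_diff_distrib sum_subtractf)
    also have "\<dots> \<in> U" using assms(1) f(2) by (intro subspace_sum subspace_scale) auto
    finally have "(\<Sum>b\<in>B. scale (c b) b) \<in> U" .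
    moreover have "(\<Sum>b\<in>B. scale (c b) b) \<in> C" using assms(2,8) by (intro subspace_sum subspace_scale) auto
    ultimately have "(\<Sum>b\<in>B. scale (c b) b) = 0" using assms(3) by blast
    thus ?thesis using independentD[OF assms(7,6) subset_refl, of c] by blast
  qed
  have "inj_on f B" "independent (f ` B)" using independent_family[OF assms(6), of f] fam by blast+
  moreover have "f ` B \<subseteq> span D" using f by blast
  ultimately show ?thesis using independent_span_bound[OF assms(4), of "f ` B"] card_image by metis
qed

end

text \<open>The isomorphism of (F + U)/U with F/(F \<inter> U), for F finite-dimensional and U
  arbitrary. As \<open>quot_dim\<close> selects an unspecified complement, the proof builds an
  explicit one, \<open>?C0\<close>, by extending a basis of F \<inter> U to F, and shows that the
  selected one has the same dimension. In the application F is one weight space of cocycles and U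
  the space of all coboundaries.\<close>

lemma quot_dim_sum:
  assumes F: "fun_vs.subspace F" "F \<subseteq> fun_vs.span T" "finite T" and U: "fun_vs.subspace U"
  shows "quot_dim {x + y | x y. x \<in> F \<and> y \<in> U} U + fun_vs.dim (F \<inter> U) = fun_vs.dim F"
proof -
  let ?W = "{x + y | x y. x \<in> F \<and> y \<in> U}"
  obtain A where A: "A \<subseteq> F \<inter> U" "fun_vs.independent A" "F \<inter> U \<subseteq> fun_vs.span A" "card A = fun_vs.dim (F \<inter> U)"
    using fun_vs.basis_exists by blast
  have "A \<subseteq> F" using A by blast
  then obtain B where B: "A \<subseteq> B" "B \<subseteq> F" "fun_vs.independent B" "F \<subseteq> fun_vs.span B"
    using fun_vs.maximal_independent_subset_extend[OF _ A(2)] by blast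
  have fB: "finite B" using fun_vs.finite_independent_in_span F B by blast
  have dF: "fun_vs.dim F = card B" using B fun_vs.basis_card_eq_dim[of B F] by simp
  have sB: "fun_vs.span B = F" using B F(1) by (simp add: fun_vs.span_minimal subset_antisym)
  let ?C0 = "fun_vs.span (B - A)"
  have C0F: "?C0 \<subseteq> F" using sB fun_vs.span_mono[of "B - A" B] by blast
  have C0: "fun_vs.subspace ?C0" "?C0 \<inter> U = {0}" "{x + y | x y. x \<in> ?C0 \<and> y \<in> U} = ?W"
  proof -
    show "fun_vs.subspace ?C0" by simp
    have "x = 0" if "x \<in> ?C0" "x \<in> U" for x
      using fun_vs.span_Int_span_Diff[OF B(3,1), of x] that A(3) C0F by blast
    thus "?C0 \<inter> U = {0}" using fun_vs.span_zero fun_vs.subspace_0[OF U] by blast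
    show "{x + y | x y. x \<in> ?C0 \<and> y \<in> U} = ?W"
    proof
      show "{x + y | x y. x \<in> ?C0 \<and> y \<in> U} \<subseteq> ?W" using C0F by blast
      show "?W \<subseteq> {x + y | x y. x \<in> ?C0 \<and> y \<in> U}"
      proof
        fix w assume "w \<in> ?W"
        then obtain x u where w: "w = x + u" "x \<in> F" "u \<in> U" by blast
        obtain y z where yz: "x = y + z" "y \<in> fun_vs.span A" "z \<in> ?C0"
          using fun_vs.span_split[OF B(1), of x] w(2) sB by blast
        have "fun_vs.span A \<subseteq> U" using A(1) U by (intro fun_vs.span_minimal) auto
        hence "y + u \<in> U" using yz w U fun_vs.subspace_add by blast
        moreover have "w = z + (y + u)" using w yz by (simp add: add_ac)
        ultimately show "w \<in> {x + y | x y. x \<in> ?C0 \<and> y \<in> U}" using yz by blast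
      qed
    qed
  qed
  define C where "C = (SOME C. fun_vs.subspace C \<and> C \<inter> U = {0} \<and> {x + y | x y. x \<in> C \<and> y \<in> U} = ?W)"
  have Cex: "fun_vs.subspace C \<and> C \<inter> U = {0} \<and> {x + y | x y. x \<in> C \<and> y \<in> U} = ?W"
    unfolding C_def by (rule someI[of _ ?C0]) (use C0 in blast)
  have C: "fun_vs.subspace C" "C \<inter> U = {0}" "{x + y | x y. x \<in> C \<and> y \<in> U} = ?W"
    by (rule Cex[THEN conjunct1], rule Cex[THEN conjunct2, THEN conjunct1], rule Cex[THEN conjunct2, THEN conjunct2])
  \<comment> \<open>Both complements have the sum F + U with U, so each vector of one is congruent
    modulo U to a vector of the other.\<close>
  have tr: "\<exists>d\<in>Y. c - d \<in> U" if cX: "c \<in> X" and eq: "{x + y | x y. x \<in> X \<and> y \<in> U} = {x + y | x y. x \<in> Y \<and> y \<in> U}" for X Y c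
  proof -
    have "c + 0 \<in> {x + y | x y. x \<in> X \<and> y \<in> U}" using cX fun_vs.subspace_0[OF U] by blast
    then obtain d u where "c = d + u" "d \<in> Y" "u \<in> U" using eq by auto
    thus ?thesis by (intro bexI[of _ d]) auto
  qed
  have fin_D: "finite (B - A)" using fB by simp
  have bnd: "card Q \<le> card (B - A)" if "finite Q" "fun_vs.independent Q" "Q \<subseteq> C" for Q
    using fun_vs.complement_bound[OF U C(1,2) fin_D _ that] tr[of _ C ?C0] C(3) C0(3) by simp
  obtain E where E: "E \<subseteq> C" "fun_vs.independent E" "C \<subseteq> fun_vs.span E" "card E = fun_vs.dim C"
    using fun_vs.basis_exists by blast
  \<comment> \<open>The cardinality of an infinite basis would count as 0, so finiteness has to
    precede the comparison of cardinalities.\<close>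
  have fE: "finite E"
  proof (rule ccontr)
    assume "infinite E"
    then obtain Q where Q: "Q \<subseteq> E" "finite Q" "card Q = Suc (card (B - A))"
      using infinite_arbitrarily_large by blast
    hence "fun_vs.independent Q" using E(2) fun_vs.independent_mono by blast
    thus False using bnd[of Q] Q E(1) by auto
  qed
  have sE: "fun_vs.span E = C" using E C(1) by (simp add: fun_vs.span_minimal subset_antisym)
  have "card E \<le> card (B - A)" using bnd fE E by blast
  moreover have "card (B - A) \<le> card E"
    using fun_vs.complement_bound[OF U C0(1,2) fE _ fin_D] tr[of _ ?C0 C] C(3) C0(3) sE
      fun_vs.independent_mono[OF B(3)] fun_vs.span_superset[of "B - A"] by simp
  ultimately have "fun_vs.dim C = card (B - A)" using E by simp
  moreover have "quot_dim ?W U = fun_vs.dim C" unfolding quot_dim_def C_def by simp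
  moreover have "card (B - A) = card B - card A" "card A \<le> card B"
    using card_Diff_subset[OF finite_subset[OF B(1) fB] B(1)] card_mono[OF fB B(1)] by auto
  ultimately show ?thesis using dF A(4) by simp
qed

lemma rank_nullity:
  fixes T :: "('b \<Rightarrow> complex) \<Rightarrow> ('c \<Rightarrow> complex)"
  assumes add: "\<And>x y. T (x + y) = T x + T y" and scale: "\<And>c x. T (fscale c x) = fscale c (T x)"
    and F: "fun_vs.subspace F" "F \<subseteq> fun_vs.span S" "finite S"
  shows "fun_vs.dim F = fun_vs.dim {x \<in> F. T x = 0} + fun_vs.dim (T ` F)"
proof -
  let ?K = "{x \<in> F. T x = 0}"
  have T0: "T 0 = 0" using add[of 0 0] by simp
  have Tsum: "T (\<Sum>b\<in>B. fscale (c b) (g b)) = (\<Sum>b\<in>B. fscale (c b) (T (g b)))" if "finite B" for B c and g :: "'z \<Rightarrow> _"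
    using that by (induction rule: finite_induct) (simp_all only: sum.empty sum.insert add scale T0 not_False_eq_True)
  have K: "fun_vs.subspace ?K"
    using F(1) add scale T0 unfolding fun_vs.subspace_def by (auto simp: fscale_def)
  obtain A where A: "A \<subseteq> ?K" "fun_vs.independent A" "?K \<subseteq> fun_vs.span A" "card A = fun_vs.dim ?K"
    using fun_vs.basis_exists by blast
  have "A \<subseteq> F" using A by blast
  then obtain B where B: "A \<subseteq> B" "B \<subseteq> F" "fun_vs.independent B" "F \<subseteq> fun_vs.span B"
    using fun_vs.maximal_independent_subset_extend[OF _ A(2)] by blast
  have fB: "finite B" using fun_vs.finite_independent_in_span F B by blast
  have dF: "fun_vs.dim F = card B" using B fun_vs.basis_card_eq_dim[of B F] by simp
  have sB: "fun_vs.span B = F" using B F(1) by (simp add: fun_vs.span_minimal subset_antisym)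
  have sA: "fun_vs.span A = ?K" using A K by (simp add: fun_vs.span_minimal subset_antisym)
  have "fun_vs.dim (T ` F) = card (B - A)"
  proof (rule fun_vs.dim_family[of _ T])
    show "finite (B - A)" using fB by simp
    show "T ` (B - A) \<subseteq> T ` F" using B by blast
    have "\<forall>i\<in>B - A. c i = 0" if "(\<Sum>i\<in>B - A. fscale (c i) (T i)) = 0" for c
    proof -
      let ?x = "\<Sum>i\<in>B - A. fscale (c i) i"
      have "T ?x = 0" using that Tsum[of "B - A" c "\<lambda>x. x"] fB by simp
      moreover have s: "?x \<in> fun_vs.span (B - A)"
        by (intro fun_vs.span_sum fun_vs.span_scale fun_vs.span_base) auto
      ultimately have "?x \<in> fun_vs.span A" using sA sB fun_vs.span_mono[of "B - A" B] by blast
      hence "?x = 0" using fun_vs.span_Int_span_Diff[OF B(3,1)] s by blast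
      thus ?thesis
        using fun_vs.independentD[OF fun_vs.independent_mono[OF B(3)], of "B - A" "B - A" c] fB by auto
    qed
    thus "\<forall>c. (\<Sum>i\<in>B - A. fscale (c i) (T i)) = 0 \<longrightarrow> (\<forall>i\<in>B - A. c i = 0)" by blast
    show "T ` F \<subseteq> fun_vs.span (T ` (B - A))"
    proof
      fix v assume "v \<in> T ` F"
      then obtain x where x: "v = T x" "x \<in> F" by blast
      obtain y z where yz: "x = y + z" "y \<in> fun_vs.span A" "z \<in> fun_vs.span (B - A)"
        using fun_vs.span_split[OF B(1), of x] x(2) sB by blast
      have "T y = 0" using yz sA by blast
      hence v: "v = T z" using x yz add by simp
      obtain c where "z = (\<Sum>b\<in>B - A. fscale (c b) b)"
        using yz(3) fun_vs.span_finite[of "B - A"] fB by auto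
      hence "v = (\<Sum>b\<in>B - A. fscale (c b) (T b))" using v Tsum[of "B - A" c "\<lambda>x. x"] fB by simp
      thus "v \<in> fun_vs.span (T ` (B - A))"
        by (simp only:) (intro fun_vs.span_sum fun_vs.span_scale fun_vs.span_base imageI)
    qed
  qed
  moreover have "card (B - A) = card B - card A" "card A \<le> card B"
    using card_Diff_subset[OF finite_subset[OF B(1) fB] B(1)] card_mono[OF fB B(1)] by auto
  ultimately show ?thesis using dF A(4) by simp
qed

subsection \<open>Euler characteristics of relatively open cells\<close>

text \<open>The empty set is included, so that the class is closed under intersection.\<close>

definition relatively_open :: "'a::euclidean_space set \<Rightarrow> bool" where
  "relatively_open C \<longleftrightarrow> (\<exists>T. affine T \<and> openin (top_of_set T) C)"

text \<open>On relatively open convex sets this is the Euler characteristic with compact supports.\<close>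

definition cell_sign :: "'a::euclidean_space set \<Rightarrow> int" where
  "cell_sign C = (if C = {} then 0 else (-1) ^ nat (aff_dim C))"

lemma aff_dim_nonneg: "x \<in> S \<Longrightarrow> 0 \<le> aff_dim S"
  using aff_dim_geq[of S] aff_dim_empty[of S] by (metis empty_iff linorder_le_less_linear not_le zle_diff1_eq diff_0 order_antisym_conv)

lemma openin_Int_Int:
  assumes "openin (top_of_set T) C" "openin (top_of_set U) D"
  shows "openin (top_of_set (T \<inter> U)) (C \<inter> D)"
proof -
  obtain A B where "open A" "C = T \<inter> A" "open B" "D = U \<inter> B" using assms unfolding openin_open by blast
  hence "open (A \<inter> B)" "C \<inter> D = T \<inter> U \<inter> (A \<inter> B)" by auto
  thus ?thesis unfolding openin_open by blast
qed

lemma relatively_open_Int: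
  assumes "relatively_open C" "relatively_open D" shows "relatively_open (C \<inter> D)"
  using assms openin_Int_Int affine_Int unfolding relatively_open_def by metis

lemma relatively_open_open: "open U \<Longrightarrow> relatively_open U"
  unfolding relatively_open_def by (metis affine_UNIV open_openin subtopology_UNIV)

lemma relatively_open_affine: "affine T \<Longrightarrow> relatively_open T"
  unfolding relatively_open_def by (metis openin_subtopology_self)

lemma relatively_open_rel_interior: "relatively_open (rel_interior C)"
  unfolding relatively_open_def using openin_rel_interior affine_affine_hull by blast

lemma relatively_open_imp_rel_interior: "relatively_open C \<Longrightarrow> rel_interior C = C"
  unfolding relatively_open_def by (metis affine_hull_openin empty_iff rel_interior_empty rel_interior_openin affine_hull_eq hull_same)

lemma aff_dim_Int_open:
  assumes "relatively_open C" "open U" "C \<inter> U \<noteq> {}" shows "aff_dim (C \<inter> U) = aff_dim C"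
proof -
  obtain T where T: "affine T" "openin (top_of_set T) C"
    using assms unfolding relatively_open_def by blast
  have "openin (top_of_set T) (C \<inter> U)"
    using T(2) assms(2) unfolding openin_open by (metis Int_assoc open_Int)
  thus ?thesis using T assms aff_dim_openin[of T] by (metis Int_empty_left)
qed

lemma cell_sign_Int_open:
  assumes "relatively_open C" "open U" "C \<inter> U \<noteq> {}" shows "cell_sign (C \<inter> U) = cell_sign C"
  using aff_dim_Int_open[OF assms] assms by (auto simp: cell_sign_def)

lemma cell_sign_empty [simp]: "cell_sign {} = 0" by (simp add: cell_sign_def)

text \<open>Since x is a relative interior point, the segment from y to x can be prolonged beyond x,
  to the other side of the hyperplane.\<close>

lemma cell_sign_split_aux:
  assumes "convex C" "relatively_open C" "x \<in> C" "a \<bullet> x = b" "y \<in> C" "a \<bullet> y \<noteq> b"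
  shows "\<exists>z\<in>C. (a \<bullet> y < b \<longrightarrow> a \<bullet> z > b) \<and> (a \<bullet> y > b \<longrightarrow> a \<bullet> z < b)"
proof -
  have "x \<in> rel_interior C" using assms relatively_open_imp_rel_interior by blast
  then obtain e where e: "e > 1" "(1 - e) *\<^sub>R y + e *\<^sub>R x \<in> C"
    using convex_rel_interior_iff[of C x] assms by blast
  define z where "z = (1 - e) *\<^sub>R y + e *\<^sub>R x"
  have "a \<bullet> z - b = (1 - e) * (a \<bullet> y - b)"
    using assms by (simp add: z_def inner_add_right algebra_simps)
  moreover have "a \<bullet> y < b \<Longrightarrow> (1 - e) * (a \<bullet> y - b) > 0"
    using e by (simp add: mult_neg_neg)
  moreover have "a \<bullet> y > b \<Longrightarrow> (1 - e) * (a \<bullet> y - b) < 0"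
    using e by (simp add: mult_neg_pos)
  ultimately have "(a \<bullet> y < b \<longrightarrow> a \<bullet> z > b) \<and> (a \<bullet> y > b \<longrightarrow> a \<bullet> z < b)" by linarith
  thus ?thesis using e(2) z_def by blast
qed

text \<open>If the hyperplane misses or contains C, only one summand survives. Otherwise both open
  halves are nonempty of full dimension and the slice has one dimension less, so the three signs are
  s, -s and s.\<close>

lemma cell_sign_split:
  assumes "convex C" "relatively_open C"
  shows "cell_sign C = cell_sign (C \<inter> {x. a \<bullet> x < b}) + cell_sign (C \<inter> {x. a \<bullet> x = b})
           + cell_sign (C \<inter> {x. a \<bullet> x > b})"
proof -
  let ?L = "C \<inter> {x. a \<bullet> x < b}" and ?E = "C \<inter> {x. a \<bullet> x = b}" and ?G = "C \<inter> {x. a \<bullet> x > b}"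
  have L: "?L \<noteq> {} \<Longrightarrow> cell_sign ?L = cell_sign C"
    by (rule cell_sign_Int_open[OF assms(2) open_halfspace_lt])
  have G: "?G \<noteq> {} \<Longrightarrow> cell_sign ?G = cell_sign C"
    by (rule cell_sign_Int_open[OF assms(2) open_halfspace_gt])
  show ?thesis
  proof (cases "?E = {}")
    case True
    have "?L = {} \<or> ?G = {}"
    proof (rule ccontr)
      assume "\<not> ?thesis"
      then obtain x y where xy: "x \<in> C" "a \<bullet> x < b" "y \<in> C" "a \<bullet> y > b" by blast
      obtain z where "z \<in> C" "a \<bullet> z = b"
        using connected_ivt_hyperplane[OF convex_connected[OF assms(1)] xy(1,3), of a b] xy by auto
      thus False using True by blast
    qed
    moreover have "C = ?L \<union> ?G" using True by force
    ultimately show ?thesis using True L G by (metis Un_empty_left Un_empty_right add.right_neutral add_0 cell_sign_empty)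
  next
    case False
    then obtain x where x: "x \<in> C" "a \<bullet> x = b" by blast
    show ?thesis
    proof (cases "C \<subseteq> {x. a \<bullet> x = b}")
      case True
      hence "?E = C" "?L = {}" "?G = {}" by auto
      thus ?thesis by simp
    next
      case nsub: False
      then obtain y where y: "y \<in> C" "a \<bullet> y \<noteq> b" by blast
      obtain z where z: "z \<in> C" "a \<bullet> y < b \<longrightarrow> a \<bullet> z > b" "a \<bullet> y > b \<longrightarrow> a \<bullet> z < b"
        using cell_sign_split_aux[OF assms x y] by blast
      have ne: "?L \<noteq> {}" "?G \<noteq> {}" using y z by (cases "a \<bullet> y < b"; force)+
      obtain T where T: "affine T" "openin (top_of_set T) C"
        using assms unfolding relatively_open_def by blast
      have CT: "C \<subseteq> T" using T(2) openin_imp_subset by blast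
      have o: "openin (top_of_set (T \<inter> {x. a \<bullet> x = b})) ?E"
        using T(2) unfolding openin_open by auto
      have "aff_dim ?E = aff_dim (T \<inter> {x. a \<bullet> x = b})"
        using aff_dim_openin[OF o] False T(1) by (simp add: affine_Int affine_hyperplane)
      also have "\<dots> = aff_dim T - 1"
        using aff_dim_affine_Int_hyperplane[OF T(1), of a b] False nsub CT by auto
      also have "aff_dim T = aff_dim C"
        using aff_dim_openin[OF T(2) T(1)] x(1) by (metis empty_iff)
      finally have d: "aff_dim ?E = aff_dim C - 1" .
      have "aff_dim ?E \<ge> 0" using aff_dim_nonneg[of x ?E] x by simp
      hence "nat (aff_dim C) = Suc (nat (aff_dim ?E))" using d by linarith
      hence "cell_sign ?E = - cell_sign C" using False x by (auto simp: cell_sign_def)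
      thus ?thesis using L[OF ne(1)] G[OF ne(2)] by simp
    qed
  qed
qed

text \<open>
  The last assumption says that the pieces are unions of cells of the hyperplane arrangement \<open>A\<close>;
  cutting everything along one hyperplane at a time reduces to the case of a single hyperplane.
\<close>

lemma cell_sign_partition:
  fixes K :: "'a::euclidean_space set" and A :: "('a \<times> real) set"
  assumes "finite A" "finite I" "convex K" "relatively_open K"
    and "\<And>i. i \<in> I \<Longrightarrow> convex (C i) \<and> relatively_open (C i) \<and> C i \<subseteq> K"
    and "K \<subseteq> (\<Union>i\<in>I. C i)"
    and "\<And>i j. i \<in> I \<Longrightarrow> j \<in> I \<Longrightarrow> i \<noteq> j \<Longrightarrow> C i \<inter> C j = {}"
    and "\<And>i x y. i \<in> I \<Longrightarrow> x \<in> C i \<Longrightarrow> y \<in> K \<Longrightarrow>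
           (\<forall>(a, b)\<in>A. sgn (a \<bullet> x - b) = sgn (a \<bullet> y - b)) \<Longrightarrow> y \<in> C i"
  shows "(\<Sum>i\<in>I. cell_sign (C i)) = cell_sign K"
  using assms
proof (induction A arbitrary: K C rule: finite_induct)
  case empty
  show ?case
  proof (cases "K = {}")
    case True
    hence "\<And>i. i \<in> I \<Longrightarrow> C i = {}" using empty by blast
    thus ?thesis using True by simp
  next
    case False
    then obtain x j where j: "x \<in> K" "j \<in> I" "x \<in> C j" using empty by blast
    \<comment> \<open>With no hyperplane left, the last assumption makes a piece that contains a
      point equal to K.\<close>
    have Cj: "C j = K" using empty.prems(7)[OF j(2) j(3)] empty.prems(4)[OF j(2)] by auto
    have "cell_sign (C i) = 0" if "i \<in> I - {j}" for i
      using empty.prems(6)[of i j] empty.prems(4)[of i] that j Cj by (metis DiffD1 DiffD2 Int_absorb2 cell_sign_empty insertI1)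
    hence "(\<Sum>i\<in>I. cell_sign (C i)) = cell_sign (C j)"
      using empty.prems(1) j(2) by (simp add: sum.remove)
    thus ?thesis using Cj by simp
  qed
next
  case (insert p A)
  obtain a b where p: "p = (a, b)" by (cases p)
  \<comment> \<open>H stands for one of the three sign regions of the new hyperplane; its sign is
    constant there, so the remaining hyperplanes suffice.\<close>
  have step: "(\<Sum>i\<in>I. cell_sign (C i \<inter> H)) = cell_sign (K \<inter> H)"
    if H: "convex H" "relatively_open H" "\<And>x y. x \<in> H \<Longrightarrow> y \<in> H \<Longrightarrow> sgn (a \<bullet> x - b) = sgn (a \<bullet> y - b)" for H
  proof (rule insert.IH)
    show "finite I" by (rule insert.prems)
    show "convex (K \<inter> H)" "relatively_open (K \<inter> H)" using insert.prems(2,3) H by (auto intro: convex_Int relatively_open_Int)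
    show "convex (C i \<inter> H) \<and> relatively_open (C i \<inter> H) \<and> C i \<inter> H \<subseteq> K \<inter> H" if "i \<in> I" for i
      using insert.prems(4)[OF that] H by (auto intro: convex_Int relatively_open_Int)
    show "K \<inter> H \<subseteq> (\<Union>i\<in>I. C i \<inter> H)" using insert.prems(5) by blast
    show "C i \<inter> H \<inter> (C j \<inter> H) = {}" if "i \<in> I" "j \<in> I" "i \<noteq> j" for i j
      using insert.prems(6)[OF that] by blast
    show "y \<in> C i \<inter> H" if "i \<in> I" "x \<in> C i \<inter> H" "y \<in> K \<inter> H"
      "\<forall>(a, b)\<in>A. sgn (a \<bullet> x - b) = sgn (a \<bullet> y - b)" for i x y
      using insert.prems(7)[of i x y] that H(3)[of x y] p by auto
  qed
  have "(\<Sum>i\<in>I. cell_sign (C i)) = (\<Sum>i\<in>I. cell_sign (C i \<inter> {x. a \<bullet> x < b}) +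
      cell_sign (C i \<inter> {x. a \<bullet> x = b}) + cell_sign (C i \<inter> {x. a \<bullet> x > b}))"
    using insert.prems(4) by (intro sum.cong refl cell_sign_split) auto
  also have "\<dots> = cell_sign (K \<inter> {x. a \<bullet> x < b}) + cell_sign (K \<inter> {x. a \<bullet> x = b}) + cell_sign (K \<inter> {x. a \<bullet> x > b})"
    unfolding sum.distrib
    by (intro arg_cong2[where f = "(+)"] step convex_halfspace_lt convex_halfspace_gt convex_hyperplane
        relatively_open_open open_halfspace_lt open_halfspace_gt relatively_open_affine affine_hyperplane) auto
  also have "\<dots> = cell_sign K"
    using cell_sign_split[OF insert.prems(2,3), of a b] by simp
  finally show ?case .
qed

section \<open>Faces, relative interiors and the local Euler relation of a fan\<close>

lemma polyhedron_rel_interior_face: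
  fixes P :: "'a::euclidean_space set"
  assumes "polyhedron P" "x \<in> P"
  shows "\<exists>F. F face_of P \<and> x \<in> rel_interior F"
  using assms
proof (induction "nat (aff_dim P)" arbitrary: P rule: less_induct)
  case less
  show ?case
  proof (cases "x \<in> rel_interior P")
    case True
    thus ?thesis using face_of_refl[OF polyhedron_imp_convex[OF less.prems(1)]] by blast
  next
    case False
    then obtain F where F: "F facet_of P" "x \<in> F"
      using rel_boundary_of_polyhedron[OF less.prems(1)] less.prems(2) by blast
    have "aff_dim F = aff_dim P - 1" using F by (simp add: facet_of_def)
    moreover have "aff_dim F \<ge> 0" using F(2) by (meson aff_dim_nonneg)
    ultimately have "nat (aff_dim F) < nat (aff_dim P)" by linarith
    moreover have f: "F face_of P" using F by (simp add: facet_of_imp_face_of)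
    moreover have "polyhedron F" using f less.prems(1) by (rule face_of_polyhedron_polyhedron[rotated])
    ultimately obtain G where "G face_of F" "x \<in> rel_interior G"
      using less.hyps[of F] F by blast
    thus ?thesis using f face_of_trans by blast
  qed
qed

lemma rational_polyhedral_cone_facts:
  assumes "rational_polyhedral_cone \<sigma>"
  shows "polyhedron \<sigma>" "closed \<sigma>" "convex \<sigma>" "convex_cone \<sigma>" "0 \<in> \<sigma>"
proof -
  obtain S :: "(int^'a) set" where S: "finite S" "\<sigma> = convex_cone hull (rvec ` S)"
    using assms unfolding rational_polyhedral_cone_def by blast
  show "polyhedron \<sigma>" using S by (simp add: polyhedron_convex_cone_hull)
  thus "closed \<sigma>" "convex \<sigma>" by (auto simp: polyhedron_imp_closed polyhedron_imp_convex)
  show "convex_cone \<sigma>" using S by (simp add: convex_cone_convex_cone_hull)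
  show "0 \<in> \<sigma>" using S by (simp add: convex_cone_hull_contains_0)
qed

lemma fan_cone:
  assumes "fan \<Sigma>" "\<sigma> \<in> \<Sigma>"
  shows "rational_polyhedral_cone \<sigma>" "strongly_convex \<sigma>" "polyhedron \<sigma>" "closed \<sigma>" "convex \<sigma>"
    "convex_cone \<sigma>" "0 \<in> \<sigma>"
proof -
  show r: "rational_polyhedral_cone \<sigma>" and "strongly_convex \<sigma>"
    using assms unfolding fan_def by auto
  show "polyhedron \<sigma>" "closed \<sigma>" "convex \<sigma>" "convex_cone \<sigma>" "0 \<in> \<sigma>"
    by (fact rational_polyhedral_cone_facts[OF r])+
qed

lemma fan_finite: "fan \<Sigma> \<Longrightarrow> finite \<Sigma>" by (simp add: fan_def)

lemma fan_face: "fan \<Sigma> \<Longrightarrow> \<sigma> \<in> \<Sigma> \<Longrightarrow> \<tau> face_of \<sigma> \<Longrightarrow> \<tau> \<noteq> {} \<Longrightarrow> \<tau> \<in> \<Sigma>"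
  by (auto simp: fan_def)

lemma fan_Int_face: "fan \<Sigma> \<Longrightarrow> \<sigma> \<in> \<Sigma> \<Longrightarrow> \<tau> \<in> \<Sigma> \<Longrightarrow> \<sigma> \<inter> \<tau> face_of \<sigma>"
  by (auto simp: fan_def)

lemma fan_subset_face: "fan \<Sigma> \<Longrightarrow> \<sigma> \<in> \<Sigma> \<Longrightarrow> \<tau> \<in> \<Sigma> \<Longrightarrow> \<tau> \<subseteq> \<sigma> \<Longrightarrow> \<tau> face_of \<sigma>"
  by (metis fan_Int_face Int_absorb1)

text \<open>\<sigma> \<inter> \<tau> is a face of \<sigma> that meets the relative interior of
  \<sigma>, hence all of \<sigma>.\<close>

lemma fan_rel_interior_subset:
  assumes "fan \<Sigma>" "\<sigma> \<in> \<Sigma>" "\<tau> \<in> \<Sigma>" "x \<in> rel_interior \<sigma>" "x \<in> \<tau>"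
  shows "\<sigma> \<subseteq> \<tau>"
proof -
  have "\<sigma> \<inter> \<tau> face_of \<sigma>" using assms fan_Int_face by blast
  moreover have "x \<in> \<sigma>" using assms rel_interior_subset by blast
  ultimately have "\<sigma> \<subseteq> \<sigma> \<inter> \<tau>" using subset_of_face_of[of "\<sigma> \<inter> \<tau>" \<sigma> \<sigma>] assms by blast
  thus ?thesis by blast
qed

lemma fan_rel_interior_nonempty:
  assumes "fan \<Sigma>" "\<sigma> \<in> \<Sigma>" shows "rel_interior \<sigma> \<noteq> {}"
  using fan_cone(5,7)[OF assms] rel_interior_eq_empty by blast

lemma complete_fan_rel_interior:
  assumes "complete_fan \<Sigma>" shows "\<exists>\<sigma>\<in>\<Sigma>. x \<in> rel_interior \<sigma>"
proof -
  have f: "fan \<Sigma>" using assms by (simp add: complete_fan_def)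
  obtain \<sigma> where s: "\<sigma> \<in> \<Sigma>" "x \<in> \<sigma>" using assms unfolding complete_fan_def by blast
  obtain F where F: "F face_of \<sigma>" "x \<in> rel_interior F"
    using polyhedron_rel_interior_face[OF fan_cone(3)[OF f s(1)] s(2)] by blast
  have "F \<noteq> {}" using F by auto
  thus ?thesis using fan_face[OF f s(1) F(1)] F by blast
qed

lemma polyhedron_functionals:
  fixes P :: "'a::euclidean_space set"
  assumes "polyhedron P"
  shows "\<exists>A::('a \<times> real) set. finite A \<and> (\<forall>x. x \<in> P \<longleftrightarrow> (\<forall>(a, b)\<in>A. a \<bullet> x \<le> b))"
proof -
  obtain F where F: "finite F" "P = \<Inter>F" "\<forall>h\<in>F. \<exists>a b. a \<noteq> 0 \<and> h = {x. a \<bullet> x \<le> b}"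
    using assms unfolding polyhedron_def by blast
  then obtain a b where ab: "\<And>h. h \<in> F \<Longrightarrow> h = {x. a h \<bullet> x \<le> b h}" by metis
  have "x \<in> P \<longleftrightarrow> (\<forall>h\<in>F. a h \<bullet> x \<le> b h)" for x using F(2) ab by blast
  hence "finite ((\<lambda>h. (a h, b h)) ` F) \<and> (\<forall>x. x \<in> P \<longleftrightarrow> (\<forall>(a, b)\<in>(\<lambda>h. (a h, b h)) ` F. a \<bullet> x \<le> b))"
    using F(1) by auto
  thus ?thesis by blast
qed

text \<open>Everything is localized to a small ball around x. There the relative interiors of the
  cones containing \<tau> partition K, and \<open>cell_sign_partition\<close> applies with the
  defining hyperplanes of all cones. Removing the ball changes no sign, because x lies in the
  closure of every nonempty cell that occurs.\<close>

proposition fan_star_euler: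
  fixes \<Sigma> :: "(real ^ 'n::finite) set set"
  assumes "complete_fan \<Sigma>" "\<tau> \<in> \<Sigma>" "convex K" "relatively_open K" "x \<in> rel_interior \<tau>" "x \<in> closure K"
  shows "(\<Sum>\<sigma>\<in>{\<sigma>\<in>\<Sigma>. \<tau> \<subseteq> \<sigma>}. cell_sign (rel_interior \<sigma> \<inter> K)) = cell_sign K"
proof -
  have f: "fan \<Sigma>" using assms by (simp add: complete_fan_def)
  have fin: "finite \<Sigma>" using f by (rule fan_finite)
  let ?U = "\<Union>{\<sigma>\<in>\<Sigma>. x \<notin> \<sigma>}"
  have "closed ?U" using fin fan_cone(4)[OF f] by (intro closed_Union) auto
  hence "open (- ?U)" "x \<in> - ?U" by auto
  then obtain r where "r > 0" "ball x r \<subseteq> - ?U"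
    using open_contains_ball by blast
  hence r: "r > 0" "ball x r \<inter> ?U = {}" by auto
  let ?B = "ball x r"
  have xt: "x \<in> \<tau>" using assms rel_interior_subset by blast
  \<comment> \<open>Inside the small ball \<open>?B\<close> around \<open>x\<close> only the cones containing \<open>\<tau>\<close> are visible.\<close>
  have near: "C \<inter> ?B \<noteq> {}" if "convex C" "relatively_open C" "C \<noteq> {}" "x \<in> closure C" for C
    using that(4) r(1) by (metis centre_in_ball disjoint_iff open_Int_closure_eq_empty open_ball Int_commute)
  have cov: "\<tau> \<subseteq> \<sigma>" if "\<sigma> \<in> \<Sigma>" "y \<in> \<sigma>" "y \<in> ?B" for \<sigma> y
  proof -
    have "x \<in> \<sigma>" using r(2) that by blast
    thus ?thesis using fan_rel_interior_subset[OF f assms(2) that(1) assms(5)] by blast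
  qed
  have ex: "\<forall>\<sigma>\<in>\<Sigma>. \<exists>A. finite A \<and> (\<forall>x. x \<in> \<sigma> \<longleftrightarrow> (\<forall>(a, b)\<in>A. a \<bullet> x \<le> (b::real)))"
    by (intro ballI polyhedron_functionals fan_cone(3)[OF f])
  from bchoice[OF ex] obtain A where A': "\<forall>\<sigma>\<in>\<Sigma>. finite (A \<sigma>) \<and> (\<forall>x. x \<in> \<sigma> \<longleftrightarrow> (\<forall>(a, b)\<in>A \<sigma>. a \<bullet> x \<le> (b::real)))" ..
  hence A: "\<And>\<sigma>. \<sigma> \<in> \<Sigma> \<Longrightarrow> finite (A \<sigma>)"
    "\<And>\<sigma> x. \<sigma> \<in> \<Sigma> \<Longrightarrow> x \<in> \<sigma> \<longleftrightarrow> (\<forall>(a, b)\<in>A \<sigma>. a \<bullet> x \<le> (b::real))" by simp_all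
  \<comment> \<open>Points with equal signs against all defining inequalities lie in the same cones,
    and so in the relative interior of the same cone.\<close>
  have same: "y \<in> rel_interior \<sigma> \<inter> K \<inter> ?B"
    if s: "\<sigma> \<in> {\<sigma>\<in>\<Sigma>. \<tau> \<subseteq> \<sigma>}" "z \<in> rel_interior \<sigma> \<inter> K \<inter> ?B" "y \<in> K \<inter> ?B"
      "\<forall>(a, b)\<in>(\<Union>\<sigma>\<in>\<Sigma>. A \<sigma>). sgn (a \<bullet> z - b) = sgn (a \<bullet> y - b)" for \<sigma> z y
  proof -
    have mem: "z \<in> \<rho> \<longleftrightarrow> y \<in> \<rho>" if "\<rho> \<in> \<Sigma>" for \<rho>
    proof -
      have "a \<bullet> z \<le> b \<longleftrightarrow> a \<bullet> y \<le> b" if "(a, b) \<in> A \<rho>" for a b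
        using s(4) that \<open>\<rho> \<in> \<Sigma>\<close> by (fastforce simp: sgn_if split: if_splits)
      thus ?thesis using A(2)[OF that] by blast
    qed
    obtain \<rho> where \<rho>: "\<rho> \<in> \<Sigma>" "y \<in> rel_interior \<rho>"
      using complete_fan_rel_interior[OF assms(1)] by blast
    have "y \<in> \<rho>" using \<rho> rel_interior_subset by blast
    hence "\<sigma> \<subseteq> \<rho>" using mem[OF \<rho>(1)] s \<rho> by (intro fan_rel_interior_subset[OF f, of \<sigma> \<rho> z]) auto
    moreover have "z \<in> \<sigma>" using s rel_interior_subset by blast
    hence "\<rho> \<subseteq> \<sigma>" using mem[of \<sigma>] s \<rho> by (intro fan_rel_interior_subset[OF f, of \<rho> \<sigma> y]) auto
    ultimately show ?thesis using \<rho> s by auto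
  qed
  have "(\<Sum>\<sigma>\<in>{\<sigma>\<in>\<Sigma>. \<tau> \<subseteq> \<sigma>}. cell_sign (rel_interior \<sigma> \<inter> K \<inter> ?B)) = cell_sign (K \<inter> ?B)"
  proof (rule cell_sign_partition[where A = "\<Union>\<sigma>\<in>\<Sigma>. A \<sigma>"])
    show "finite (\<Union>\<sigma>\<in>\<Sigma>. A \<sigma>)" using fin A(1) by blast
    show "finite {\<sigma>\<in>\<Sigma>. \<tau> \<subseteq> \<sigma>}" using fin by simp
    show "convex (K \<inter> ?B)" "relatively_open (K \<inter> ?B)"
      using assms by (auto intro: convex_Int relatively_open_Int relatively_open_open)
    show "convex (rel_interior \<sigma> \<inter> K \<inter> ?B) \<and> relatively_open (rel_interior \<sigma> \<inter> K \<inter> ?B) \<and>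
        rel_interior \<sigma> \<inter> K \<inter> ?B \<subseteq> K \<inter> ?B" if "\<sigma> \<in> {\<sigma>\<in>\<Sigma>. \<tau> \<subseteq> \<sigma>}" for \<sigma>
      using that assms fan_cone(5)[OF f, of \<sigma>]
      by (intro conjI convex_Int relatively_open_Int convex_rel_interior relatively_open_rel_interior relatively_open_open[OF open_ball]) auto
    show "K \<inter> ?B \<subseteq> (\<Union>\<sigma>\<in>{\<sigma>\<in>\<Sigma>. \<tau> \<subseteq> \<sigma>}. rel_interior \<sigma> \<inter> K \<inter> ?B)"
    proof
      fix y assume y: "y \<in> K \<inter> ?B"
      obtain \<rho> where \<rho>: "\<rho> \<in> \<Sigma>" "y \<in> rel_interior \<rho>"
        using complete_fan_rel_interior[OF assms(1)] by blast
      have "y \<in> \<rho>" using \<rho> rel_interior_subset by blast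
      hence "\<tau> \<subseteq> \<rho>" using cov \<rho> y by blast
      thus "y \<in> (\<Union>\<sigma>\<in>{\<sigma>\<in>\<Sigma>. \<tau> \<subseteq> \<sigma>}. rel_interior \<sigma> \<inter> K \<inter> ?B)" using y \<rho> by blast
    qed
    show "rel_interior \<sigma> \<inter> K \<inter> ?B \<inter> (rel_interior \<rho> \<inter> K \<inter> ?B) = {}"
      if "\<sigma> \<in> {\<sigma>\<in>\<Sigma>. \<tau> \<subseteq> \<sigma>}" "\<rho> \<in> {\<sigma>\<in>\<Sigma>. \<tau> \<subseteq> \<sigma>}" "\<sigma> \<noteq> \<rho>" for \<sigma> \<rho>
      using that fan_rel_interior_subset[OF f] rel_interior_subset by blast
    show "y \<in> rel_interior \<sigma> \<inter> K \<inter> ?B"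
      if "\<sigma> \<in> {\<sigma>\<in>\<Sigma>. \<tau> \<subseteq> \<sigma>}" "z \<in> rel_interior \<sigma> \<inter> K \<inter> ?B" "y \<in> K \<inter> ?B"
        "\<forall>(a, b)\<in>(\<Union>\<sigma>\<in>\<Sigma>. A \<sigma>). sgn (a \<bullet> z - b) = sgn (a \<bullet> y - b)" for \<sigma> z y
      by (rule same[OF that])
  qed
  moreover have "cell_sign (K \<inter> ?B) = cell_sign K"
    using near[OF assms(3,4) _ assms(6)] assms(6) by (intro cell_sign_Int_open[OF assms(4) open_ball]) (metis closure_empty empty_iff)
  \<comment> \<open>The open segment from a point y of the cell to x stays in the cell, so the cell
    accumulates at x and meets the ball.\<close>
  moreover have "cell_sign (rel_interior \<sigma> \<inter> K \<inter> ?B) = cell_sign (rel_interior \<sigma> \<inter> K)"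
    if "\<sigma> \<in> {\<sigma>\<in>\<Sigma>. \<tau> \<subseteq> \<sigma>}" for \<sigma>
  proof (cases "rel_interior \<sigma> \<inter> K = {}")
    case False
    then obtain y where y: "y \<in> rel_interior \<sigma>" "y \<in> K" by blast
    have cs: "convex \<sigma>" using that fan_cone(5)[OF f] by blast
    have "x \<in> closure \<sigma>" using that xt closure_subset by blast
    hence o1: "open_segment y x \<subseteq> rel_interior \<sigma>"
      using rel_interior_closure_convex_segment[OF cs y(1)] by blast
    have o2: "open_segment y x \<subseteq> K"
      using rel_interior_closure_convex_segment[OF assms(3) _ assms(6), of y] y(2)
        relatively_open_imp_rel_interior[OF assms(4)] by auto
    have "x \<in> closure (rel_interior \<sigma> \<inter> K)"
    proof (cases "x = y")
      case True thus ?thesis using y closure_subset[of "rel_interior \<sigma> \<inter> K"] by auto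
    next
      case False
      hence "x \<in> closure (open_segment y x)" by (simp add: closure_open_segment)
      thus ?thesis using o1 o2 closure_mono[of "open_segment y x" "rel_interior \<sigma> \<inter> K"] by blast
    qed
    moreover have "relatively_open (rel_interior \<sigma> \<inter> K)" using assms by (intro relatively_open_Int relatively_open_rel_interior) auto
    moreover have "convex (rel_interior \<sigma> \<inter> K)" using assms cs by (simp add: convex_Int convex_rel_interior)
    ultimately show ?thesis using near[of "rel_interior \<sigma> \<inter> K"] False cell_sign_Int_open[of "rel_interior \<sigma> \<inter> K" ?B] by auto
  qed simp
  ultimately show ?thesis by simp
qed

subsection \<open>Rational cones and their rays\<close>

lemma convex_cone_hull_insert_finite:
  assumes "x \<in> convex_cone hull (insert s T)"
  shows "\<exists>c y. c \<ge> 0 \<and> y \<in> convex_cone hull T \<and> x = c *\<^sub>R s + y"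
proof -
  let ?A = "{c *\<^sub>R s + y | c y. c \<ge> 0 \<and> y \<in> convex_cone hull T}"
  have T: "0 \<in> convex_cone hull T" "\<And>x y. x \<in> convex_cone hull T \<Longrightarrow> y \<in> convex_cone hull T \<Longrightarrow> x + y \<in> convex_cone hull T"
    "\<And>x c. x \<in> convex_cone hull T \<Longrightarrow> c \<ge> 0 \<Longrightarrow> c *\<^sub>R x \<in> convex_cone hull T"
    by (simp_all add: convex_cone_hull_contains_0 convex_cone_hull_add convex_cone_hull_mul)
  have "0 *\<^sub>R s + 0 \<in> ?A" using T(1) by blast
  hence A0: "0 \<in> ?A" by simp
  have A1: "x + y \<in> ?A" if xA: "x \<in> ?A" "y \<in> ?A" for x y
  proof -
    obtain c v d w where "c \<ge> 0" "v \<in> convex_cone hull T" "x = c *\<^sub>R s + v"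
      "d \<ge> 0" "w \<in> convex_cone hull T" "y = d *\<^sub>R s + w" using xA by blast
    hence "x + y = (c + d) *\<^sub>R s + (v + w)" "c + d \<ge> 0" "v + w \<in> convex_cone hull T"
      using T(2) by (auto simp: algebra_simps)
    thus "x + y \<in> ?A" by blast
  qed
  have A2: "r *\<^sub>R x \<in> ?A" if xA: "x \<in> ?A" "r \<ge> 0" for x r
  proof -
    obtain c v where "c \<ge> 0" "v \<in> convex_cone hull T" "x = c *\<^sub>R s + v" using xA(1) by blast
    hence "r *\<^sub>R x = (r * c) *\<^sub>R s + r *\<^sub>R v" "r * c \<ge> 0" "r *\<^sub>R v \<in> convex_cone hull T"
      using T(3) \<open>r \<ge> 0\<close> by (auto simp: algebra_simps)
    thus "r *\<^sub>R x \<in> ?A" by blast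
  qed
  have "convex_cone ?A"
    by (rule convex_cone_iff[THEN iffD2]) (intro conjI ballI allI impI A0 A1 A2)
  moreover have "insert s T \<subseteq> ?A"
  proof
    fix x assume "x \<in> insert s T"
    then consider "x = 1 *\<^sub>R s + 0" | "x = 0 *\<^sub>R s + x" "x \<in> convex_cone hull T"
      using hull_subset[of T convex_cone] by auto
    thus "x \<in> ?A"
    proof cases
      case 1 thus ?thesis using T(1) zero_le_one by blast
    next
      case 2 thus ?thesis using order_refl by blast
    qed
  qed
  ultimately have "convex_cone hull (insert s T) \<subseteq> ?A" by (rule hull_minimal[rotated])
  thus ?thesis using assms by blast
qed

lemma convex_cone_hull_singleton: "convex_cone hull {v} = {c *\<^sub>R v | c. c \<ge> 0}"
proof
  show "convex_cone hull {v} \<subseteq> {c *\<^sub>R v | c. c \<ge> 0}"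
    using convex_cone_hull_insert_finite[of _ v "{}"] by auto
  show "{c *\<^sub>R v | c. c \<ge> 0} \<subseteq> convex_cone hull {v}"
  proof
    fix x assume "x \<in> {c *\<^sub>R v | c. c \<ge> 0}"
    then obtain c where "x = c *\<^sub>R v" "c \<ge> 0" by blast
    thus "x \<in> convex_cone hull {v}" using convex_cone_hull_mul[OF hull_inc, of v "{v}" c] \<open>c \<ge> 0\<close> \<open>x = _\<close> by simp
  qed
qed

lemma inner_ge_convex_cone_hull:
  assumes "\<And>s. s \<in> S \<Longrightarrow> m \<bullet> s \<ge> 0" "u \<in> convex_cone hull S"
  shows "m \<bullet> u \<ge> 0"
proof -
  have "convex_cone hull S \<subseteq> {x. m \<bullet> x \<ge> 0}"
    by (rule hull_minimal) (use assms convex_cone_halfspace_ge in auto)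
  thus ?thesis using assms by blast
qed

text \<open>Split the endpoints of a segment through a point of the ray into multiples of s and
  elements of the cone over T. The combined T-part w is a multiple \<delta> of s: \<delta> > 0 would
  make s redundant, and \<delta> \<le> 0 puts both w and -w into \<sigma>, so w = 0. Pointedness
  then kills the two T-parts separately.\<close>

lemma irredundant_generator_face:
  fixes \<sigma> :: "'a::euclidean_space set"
  assumes "\<sigma> = convex_cone hull (insert s T)" "s \<notin> convex_cone hull T" "\<And>x. x \<in> \<sigma> \<Longrightarrow> - x \<in> \<sigma> \<Longrightarrow> x = 0"
  shows "(convex_cone hull {s}) face_of \<sigma>"
proof -
  have T: "0 \<in> convex_cone hull T" "\<And>x y. x \<in> convex_cone hull T \<Longrightarrow> y \<in> convex_cone hull T \<Longrightarrow> x + y \<in> convex_cone hull T"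
    "\<And>x c. x \<in> convex_cone hull T \<Longrightarrow> c \<ge> 0 \<Longrightarrow> c *\<^sub>R x \<in> convex_cone hull T"
    by (simp_all add: convex_cone_hull_contains_0 convex_cone_hull_add convex_cone_hull_mul)
  have sub: "convex_cone hull T \<subseteq> \<sigma>" "convex_cone hull {s} \<subseteq> \<sigma>"
    unfolding assms(1) by (auto intro!: hull_mono)
  show ?thesis
    unfolding face_of_def
  proof (intro conjI ballI impI)
    show "convex_cone hull {s} \<subseteq> \<sigma>" by (rule sub)
    show "convex (convex_cone hull {s})" by (rule convex_convex_cone_hull)
    fix x y z assume xy: "x \<in> \<sigma>" "y \<in> \<sigma>" and z: "z \<in> convex_cone hull {s}" "z \<in> open_segment x y"
    obtain t where t: "0 < t" "t < 1" "z = (1 - t) *\<^sub>R x + t *\<^sub>R y"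
      using z(2) by (auto simp: in_segment)
    obtain \<gamma> where \<gamma>: "z = \<gamma> *\<^sub>R s" using z(1) convex_cone_hull_singleton by blast
    obtain \<alpha> x' where x': "\<alpha> \<ge> 0" "x' \<in> convex_cone hull T" "x = \<alpha> *\<^sub>R s + x'"
      using convex_cone_hull_insert_finite[of x s T] xy assms(1) by blast
    obtain \<beta> y' where y': "\<beta> \<ge> 0" "y' \<in> convex_cone hull T" "y = \<beta> *\<^sub>R s + y'"
      using convex_cone_hull_insert_finite[of y s T] xy assms(1) by blast
    define w where "w = (1 - t) *\<^sub>R x' + t *\<^sub>R y'"
    define \<delta> where "\<delta> = \<gamma> - (1 - t) * \<alpha> - t * \<beta>"
    have w: "w = \<delta> *\<^sub>R s"
      using t(3) \<gamma> x' y' unfolding w_def \<delta>_def by (simp add: algebra_simps)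
    have a1: "(1 - t) *\<^sub>R x' \<in> convex_cone hull T" and a2: "t *\<^sub>R y' \<in> convex_cone hull T"
      using T(3) t x' y' by auto
    hence wT: "w \<in> convex_cone hull T" unfolding w_def using T(2) by blast
    have "\<delta> \<le> 0"
    proof (rule ccontr)
      assume "\<not> \<delta> \<le> 0"
      hence "s = (1 / \<delta>) *\<^sub>R w" "1 / \<delta> \<ge> 0" using w by auto
      thus False using T(3)[OF wT] assms(2) by metis
    qed
    hence "- w \<in> convex_cone hull {s}" unfolding convex_cone_hull_singleton w
      by (intro CollectI exI[of _ "- \<delta>"]) auto
    hence "w = 0" using assms(3)[of w] wT sub by blast
    hence "- ((1 - t) *\<^sub>R x') = t *\<^sub>R y'" unfolding w_def by (simp add: add_eq_0_iff)
    hence "(1 - t) *\<^sub>R x' = 0" using assms(3)[of "(1 - t) *\<^sub>R x'"] a1 a2 sub by auto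
    hence "x' = 0" "y' = 0" using t \<open>w = 0\<close> unfolding w_def by auto
    thus "x \<in> convex_cone hull {s}" "y \<in> convex_cone hull {s}"
      using x' y' unfolding convex_cone_hull_singleton by auto
  qed
qed

section \<open>Lattice vectors, rays and primitive generators\<close>

lemma rvec_add: "rvec (x + y) = rvec x + rvec y"
  and rvec_diff: "rvec (x - y) = rvec x - rvec y"
  and rvec_uminus: "rvec (- x) = - rvec x"
  and rvec_0: "rvec 0 = 0"
  by (simp_all add: rvec_def vec_eq_iff)

lemma rvec_eq_0_iff: "rvec x = 0 \<longleftrightarrow> x = 0" by (simp add: rvec_def vec_eq_iff)

lemma rvec_smult: "rvec (\<chi> i. k * x $ i) = real_of_int k *\<^sub>R rvec x" by (simp add: rvec_def vec_eq_iff)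

lemma rvec_inner: "rvec x \<bullet> rvec y = real_of_int (pairing x y)"
  by (simp add: rvec_def pairing_def inner_vec_def)

lemma strongly_convexD: "strongly_convex \<sigma> \<Longrightarrow> x \<in> \<sigma> \<Longrightarrow> - x \<in> \<sigma> \<Longrightarrow> x = 0"
  unfolding strongly_convex_def by (metis IntI empty_iff imageI insert_iff minus_minus)

lemma dim_convex_cone_hull_singleton: "v \<noteq> 0 \<Longrightarrow> dim (convex_cone hull {v::real^'n::finite}) = 1"
proof -
  assume v: "v \<noteq> 0"
  have "convex_cone hull {v} \<subseteq> span {v}" unfolding convex_cone_hull_singleton by (auto intro: span_scale span_base)
  moreover have "{v} \<subseteq> convex_cone hull {v}" by (rule hull_subset)
  ultimately have "span (convex_cone hull {v}) = span {v}" by (metis span_mono span_span subset_antisym)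
  hence "dim (convex_cone hull {v}) = dim {v}" using dim_span by metis
  thus ?thesis using v by (simp add: dim_singleton)
qed

text \<open>A generating set of least cardinality is irredundant, so each of its members spans a
  face.\<close>

lemma cone_generated_by_rays:
  fixes \<sigma> :: "(real^'n::finite) set"
  assumes "rational_polyhedral_cone \<sigma>" "strongly_convex \<sigma>"
  shows "\<exists>S::(int^'n) set. finite S \<and> \<sigma> = convex_cone hull (rvec ` S) \<and>
           (\<forall>s\<in>S. s \<noteq> 0 \<and> convex_cone hull {rvec s} \<in> rays \<sigma>)"
proof -
  let ?P = "\<lambda>S. finite S \<and> \<sigma> = convex_cone hull (rvec ` S)"
  obtain S0 where S0: "?P S0" using assms(1) unfolding rational_polyhedral_cone_def by blast
  obtain S where S: "?P S" and min: "\<And>S'. ?P S' \<Longrightarrow> card S \<le> card S'"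
    using ex_has_least_nat[of ?P S0 card] S0 by blast
  have "s \<noteq> 0 \<and> convex_cone hull {rvec s} \<in> rays \<sigma>" if s: "s \<in> S" for s
  proof -
    have e: "rvec ` S = insert (rvec s) (rvec ` (S - {s}))" using s by blast
    have n: "rvec s \<notin> convex_cone hull (rvec ` (S - {s}))"
    proof
      assume "rvec s \<in> convex_cone hull (rvec ` (S - {s}))"
      hence "convex_cone hull (rvec ` S) = convex_cone hull (rvec ` (S - {s}))"
        unfolding e by (rule hull_redundant)
      hence "?P (S - {s})" using S by simp
      thus False using min[of "S - {s}"] S s card_Diff1_less[of S s] by simp
    qed
    have s0: "s \<noteq> 0" using n convex_cone_hull_contains_0[of "rvec ` (S - {s})"] rvec_0 by metis
    have "(convex_cone hull {rvec s}) face_of \<sigma>"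
      using irredundant_generator_face[OF _ n, of \<sigma>] S e strongly_convexD[OF assms(2)] by metis
    thus ?thesis using s0 dim_convex_cone_hull_singleton[of "rvec s"] by (simp add: rays_def rvec_eq_0_iff)
  qed
  thus ?thesis using S by blast
qed

lemma one_dim_cone:
  fixes \<rho> :: "(real^'n::finite) set"
  assumes "rational_polyhedral_cone \<rho>" "strongly_convex \<rho>" "dim \<rho> = 1"
  shows "\<exists>s. s \<noteq> 0 \<and> \<rho> = {c *\<^sub>R rvec s | c. c \<ge> 0}"
proof -
  obtain S where S: "finite S" "\<rho> = convex_cone hull (rvec ` S)" "\<forall>s\<in>S. s \<noteq> 0 \<and> convex_cone hull {rvec s} \<in> rays \<rho>"
    using cone_generated_by_rays[OF assms(1,2)] by blast
  have "S \<noteq> {}"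
  proof
    assume "S = {}"
    hence "\<rho> = {0}" using S by simp
    thus False using assms(3) by simp
  qed
  then obtain s where s: "s \<in> S" "s \<noteq> 0" using S by blast
  have sr: "rvec s \<in> \<rho>" using s S by (simp add: hull_inc)
  have "span {rvec s} = span \<rho>"
    using sr assms(3) s(2) by (intro dim_eq_span) (auto simp: dim_singleton rvec_eq_0_iff)
  have "x \<in> \<rho> \<longleftrightarrow> x \<in> {c *\<^sub>R rvec s | c. c \<ge> 0}" for x
  proof
    assume x: "x \<in> \<rho>"
    hence "x \<in> span {rvec s}" using \<open>span {rvec s} = span \<rho>\<close> span_base by blast
    then obtain c where c: "x = c *\<^sub>R rvec s" unfolding span_singleton by blast
    show "x \<in> {c *\<^sub>R rvec s | c. c \<ge> 0}"
    proof (cases "c \<ge> 0")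
      case False
      hence "- x = (- c) *\<^sub>R rvec s" "- c \<ge> 0" using c by auto
      hence "- x \<in> \<rho>" using convex_cone_scaleR[OF rational_polyhedral_cone_facts(4)[OF assms(1)] _ sr, of "- c"] by simp
      hence "x = 0" using strongly_convexD[OF assms(2) x] by blast
      thus ?thesis by (intro CollectI exI[of _ 0]) auto
    qed (use c in blast)
  next
    assume "x \<in> {c *\<^sub>R rvec s | c. c \<ge> 0}"
    thus "x \<in> \<rho>" using convex_cone_scaleR[OF rational_polyhedral_cone_facts(4)[OF assms(1)] _ sr] by blast
  qed
  thus ?thesis using s by blast
qed

text \<open>A norm with natural values, so that a ray has a shortest nonzero lattice point.\<close>

definition l1 :: "int ^ 'n::finite \<Rightarrow> nat" where "l1 u = (\<Sum>i\<in>UNIV. nat \<bar>u $ i\<bar>)"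

text \<open>Evaluates the definite description in \<open>ray_gen\<close>. For uniqueness, two
  generators are natural multiples of each other, and the product of the two factors is 1.\<close>

lemma ray_gen_cone:
  fixes \<rho> :: "(real^'n::finite) set"
  assumes "rational_polyhedral_cone \<rho>" "strongly_convex \<rho>" "dim \<rho> = 1"
  shows "ray_gen \<rho> \<noteq> 0" "\<rho> = {c *\<^sub>R rvec (ray_gen \<rho>) | c. c \<ge> 0}"
proof -
  obtain s where s: "s \<noteq> 0" "\<rho> = {c *\<^sub>R rvec s | c. c \<ge> 0}"
    using one_dim_cone[OF assms] by blast
  let ?P = "\<lambda>u. u \<noteq> 0 \<and> rvec u \<in> \<rho>"
  have "rvec s = 1 *\<^sub>R rvec s" by simp
  hence "?P s" using s zero_le_one by blast
  \<comment> \<open>A nonzero lattice point of least norm generates, by division with remainder.\<close>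
  then obtain u where u: "?P u" and min: "\<And>v. ?P v \<Longrightarrow> l1 u \<le> l1 v"
    using ex_has_least_nat[of ?P s l1] by blast
  obtain d where d: "rvec u = d *\<^sub>R rvec s" "d \<ge> 0" using u s by blast
  have d0: "d > 0" using d u rvec_eq_0_iff by (metis less_eq_real_def scaleR_zero_left)
  have \<rho>u: "\<rho> = {c *\<^sub>R rvec u | c. c \<ge> 0}"
  proof -
    have a: "c *\<^sub>R rvec s = (c / d) *\<^sub>R rvec u" for c using d d0 by simp
    have b: "c *\<^sub>R rvec u = (c * d) *\<^sub>R rvec s" for c using d by simp
    show ?thesis
    proof (intro set_eqI iffI)
      fix x assume "x \<in> \<rho>"
      then obtain c where "x = c *\<^sub>R rvec s" "c \<ge> 0" unfolding s(2) by blast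
      hence "x = (c / d) *\<^sub>R rvec u" "c / d \<ge> 0" using a d0 by auto
      thus "x \<in> {c *\<^sub>R rvec u | c. c \<ge> 0}" by blast
    next
      fix x assume "x \<in> {c *\<^sub>R rvec u | c. c \<ge> 0}"
      then obtain c where "x = c *\<^sub>R rvec u" "c \<ge> 0" by blast
      hence "x = (c * d) *\<^sub>R rvec s" "c * d \<ge> 0" using b d0 by auto
      thus "x \<in> \<rho>" unfolding s(2) by blast
    qed
  qed
  have gen: "\<exists>k::nat. v = (\<chi> i. int k * u $ i)" if vr: "rvec v \<in> \<rho>" for v
  proof -
    obtain c where c: "rvec v = c *\<^sub>R rvec u" "c \<ge> 0" using vr \<rho>u by blast
    define k where "k = nat \<lfloor>c\<rfloor>"
    define w where "w = v - (\<chi> i. int k * u $ i)"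
    have k: "real k \<le> c" "c < real k + 1" using c(2) unfolding k_def by linarith+
    have rw: "rvec w = (c - real k) *\<^sub>R rvec u"
      unfolding w_def rvec_diff rvec_smult c(1) by (simp add: algebra_simps)
    have "w = 0"
    proof (rule ccontr)
      assume "w \<noteq> 0"
      moreover have "rvec w \<in> \<rho>" using rw k unfolding \<rho>u by auto
      ultimately have le: "l1 u \<le> l1 w" using min by blast
      have "real_of_int (w $ i) = (c - real k) * real_of_int (u $ i)" for i
        using rw by (simp add: rvec_def vec_eq_iff)
      hence "real (nat \<bar>w $ i\<bar>) = (c - real k) * real (nat \<bar>u $ i\<bar>)" for i
        using k by (simp add: abs_mult)
      hence "real (l1 w) = (c - real k) * real (l1 u)"
        unfolding l1_def by (simp add: sum_distrib_left)
      moreover have "l1 u > 0"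
      proof -
        obtain i where "u $ i \<noteq> 0" using u by (auto simp: vec_eq_iff)
        hence "0 < nat \<bar>u $ i\<bar>" by simp
        also have "\<dots> \<le> l1 u" unfolding l1_def by (rule member_le_sum) auto
        finally show ?thesis .
      qed
      hence "(c - real k) * real (l1 u) < 1 * real (l1 u)" using k by (intro mult_strict_right_mono) auto
      ultimately show False using le by linarith
    qed
    thus ?thesis unfolding w_def by auto
  qed
  let ?Q = "\<lambda>u. u \<noteq> 0 \<and> rvec u \<in> \<rho> \<and> (\<forall>v. rvec v \<in> \<rho> \<longrightarrow> (\<exists>k::nat. v = (\<chi> i. int k * u $ i)))"
  have Qu: "?Q u" using u gen by blast
  have uniq: "u' = u" if Q': "?Q u'" for u'
  proof -
    obtain k where k: "u = (\<chi> i. int k * u' $ i)" using Q' u by blast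
    obtain k' where k': "u' = (\<chi> i. int k' * u $ i)" using Q' gen by blast
    obtain i where i: "u $ i \<noteq> 0" using u by (auto simp: vec_eq_iff)
    have "u $ i = int k * (int k' * u $ i)" by (subst k, subst k') simp
    hence "int k * int k' = 1" using i by (simp add: mult.assoc[symmetric])
    hence "k' = 1" by (metis mult.commute nat_1_eq_mult_iff of_nat_1_eq_iff of_nat_mult)
    thus ?thesis using k' by (simp add: vec_eq_iff)
  qed
  have "ray_gen \<rho> = u" unfolding ray_gen_def using Qu uniq by (rule the_equality)
  thus "ray_gen \<rho> \<noteq> 0" "\<rho> = {c *\<^sub>R rvec (ray_gen \<rho>) | c. c \<ge> 0}" using u \<rho>u by auto
qed

lemma fan_rays_of_cone:
  assumes "fan \<Sigma>" "\<sigma> \<in> \<Sigma>" "\<rho> \<in> rays \<sigma>" shows "\<rho> \<in> fan_rays \<Sigma>"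
proof -
  have "\<rho> \<noteq> {}" using assms(3) unfolding rays_def by (metis (mono_tags, lifting) dim_empty mem_Collect_eq zero_neq_one)
  thus ?thesis using assms fan_face unfolding rays_def fan_rays_def by blast
qed

lemma fan_ray_gen:
  assumes "fan \<Sigma>" "\<rho> \<in> fan_rays \<Sigma>"
  shows "ray_gen \<rho> \<noteq> 0" "\<rho> = {c *\<^sub>R rvec (ray_gen \<rho>) | c. c \<ge> 0}" "rvec (ray_gen \<rho>) \<in> \<rho>"
proof -
  have r: "\<rho> \<in> \<Sigma>" "dim \<rho> = 1" using assms(2) by (auto simp: fan_rays_def)
  show "ray_gen \<rho> \<noteq> 0" and e: "\<rho> = {c *\<^sub>R rvec (ray_gen \<rho>) | c. c \<ge> 0}"
    using ray_gen_cone[OF fan_cone(1,2)[OF assms(1) r(1)] r(2)] by blast+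
  have "rvec (ray_gen \<rho>) = 1 *\<^sub>R rvec (ray_gen \<rho>)" by simp
  hence "rvec (ray_gen \<rho>) \<in> {c *\<^sub>R rvec (ray_gen \<rho>) | c. c \<ge> 0}" using zero_le_one by blast
  thus "rvec (ray_gen \<rho>) \<in> \<rho>" using e by simp
qed

lemma dual_cone_via_rays:
  assumes "fan \<Sigma>" "\<sigma> \<in> \<Sigma>" "\<And>\<rho>. \<rho> \<in> rays \<sigma> \<Longrightarrow> m \<bullet> rvec (ray_gen \<rho>) \<ge> 0" "u \<in> \<sigma>"
  shows "m \<bullet> u \<ge> 0"
proof -
  obtain S where S: "finite S" "\<sigma> = convex_cone hull (rvec ` S)" "\<forall>s\<in>S. s \<noteq> 0 \<and> convex_cone hull {rvec s} \<in> rays \<sigma>"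
    using cone_generated_by_rays[OF fan_cone(1,2)[OF assms(1,2)]] by blast
  have "m \<bullet> v \<ge> 0" if v: "v \<in> rvec ` S" for v
  proof -
    let ?\<rho> = "convex_cone hull {v}"
    have r: "?\<rho> \<in> rays \<sigma>" using S v by blast
    have "v \<in> ?\<rho>" by (simp add: hull_inc)
    then obtain c where c: "v = c *\<^sub>R rvec (ray_gen ?\<rho>)" "c \<ge> 0"
      using fan_ray_gen(2)[OF assms(1) fan_rays_of_cone[OF assms(1,2) r]] by blast
    hence "m \<bullet> v = c * (m \<bullet> rvec (ray_gen ?\<rho>))" by (metis inner_scaleR_right)
    thus ?thesis using assms(3)[OF r] c(2) by simp
  qed
  thus ?thesis using inner_ge_convex_cone_hull[of "rvec ` S" m u] S assms(4) by blast
qed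

lemma orthogonal_via_rays:
  assumes "fan \<Sigma>" "\<sigma> \<in> \<Sigma>" "\<And>\<rho>. \<rho> \<in> rays \<sigma> \<Longrightarrow> m \<bullet> rvec (ray_gen \<rho>) = 0" "u \<in> \<sigma>"
  shows "m \<bullet> u = 0"
  using dual_cone_via_rays[OF assms(1,2) _ assms(4), of m] dual_cone_via_rays[OF assms(1,2) _ assms(4), of "- m"] assms(3)
  by (simp add: antisym)

lemma dim_perp: "dim S + dim (perp S) = CARD('n)" for S :: "(real ^ 'n::finite) set"
proof -
  have "perp S = {y \<in> UNIV. \<forall>x\<in>span S. orthogonal x y}"
  proof (intro set_eqI iffI)
    fix y assume "y \<in> perp S"
    hence "\<And>x. x \<in> S \<Longrightarrow> orthogonal y x" by (auto simp: perp_def orthogonal_def)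
    thus "y \<in> {y \<in> UNIV. \<forall>x\<in>span S. orthogonal x y}"
      using orthogonal_to_span[of _ S y] by (simp add: orthogonal_commute)
  qed (auto simp: perp_def orthogonal_def inner_commute span_base)
  moreover have "dim {y \<in> UNIV. \<forall>x\<in>span S. orthogonal x y} + dim (span S) = dim (UNIV :: (real ^ 'n) set)"
    by (rule dim_subspace_orthogonal_to_vectors) auto
  ultimately show ?thesis by simp
qed

text \<open>Serves to verify the closure hypothesis of the local Euler relation.\<close>

lemma closure_ray:
  fixes x w :: "'a::real_normed_vector"
  assumes near: "\<And>t. t > 0 \<Longrightarrow> x + t *\<^sub>R w \<in> N"
  shows "x \<in> closure N"
proof (cases "w = 0")
  case True
  thus ?thesis using near[of 1] closure_subset[of N] by auto
next
  case False
  show ?thesis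
    unfolding closure_approachable
  proof (intro allI impI)
    fix e :: real assume e: "e > 0"
    let ?t = "e / (2 * norm w)"
    have "?t > 0" using e False by simp
    moreover have "dist (x + ?t *\<^sub>R w) x < e" using e False by (simp add: dist_norm)
    ultimately show "\<exists>y\<in>N. dist y x < e" using near by blast
  qed
qed

lemma ex_small_scale:
  fixes f g :: "'a \<Rightarrow> real"
  assumes "finite S"
  shows "\<exists>d>0. \<forall>s\<in>S. g s > 0 \<longrightarrow> d * f s \<le> g s"
  using assms
proof (induction S)
  case empty show ?case by (intro exI[of _ 1]) auto
next
  case (insert s S)
  then obtain d where d: "d > 0" "\<forall>s\<in>S. g s > 0 \<longrightarrow> d * f s \<le> g s" by blast
  \<comment> \<open>The summand 1 keeps the quotient meaningful when f vanishes at s.\<close>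
  define e where "e = (if g s > 0 then min d (g s / (1 + \<bar>f s\<bar>)) else d)"
  have e: "e > 0" "e \<le> d" using d by (auto simp: e_def)
  have "e * f t \<le> g t" if t: "t \<in> insert s S" "g t > 0" for t
  proof (cases "t = s")
    case True
    have "e * f s \<le> e * \<bar>f s\<bar>" using e by (intro mult_left_mono) auto
    also have "\<dots> \<le> e * (1 + \<bar>f s\<bar>)" using e by (intro mult_left_mono) auto
    also have "\<dots> \<le> g s / (1 + \<bar>f s\<bar>) * (1 + \<bar>f s\<bar>)" using t True by (intro mult_right_mono) (auto simp: e_def)
    also have "\<dots> = g s" by (simp add: add_nonneg_eq_0_iff)
    finally show ?thesis using True by simp
  next
    case False
    have "e * f t \<le> max 0 (d * f t)"
    proof (cases "f t \<ge> 0")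
      case True thus ?thesis using mult_right_mono[OF e(2) True] by simp
    next
      case False thus ?thesis using e(1) by (simp add: mult_nonneg_nonpos le_max_iff_disj)
    qed
    thus ?thesis using d(2) t False by (auto simp: max_def split: if_splits)
  qed
  thus ?case using e by blast
qed

text \<open>The definite description in \<open>face_at\<close> selects the face of \<sigma> on which
  m vanishes. m is relatively interior for that face: a segment ending at m can be prolonged a
  little, since on finitely many generators either m is positive or the other endpoint vanishes as
  well. Conversely, let \<rho> be a face with m relatively interior. A functional exposing \<rho>
  lies in the same dual face, and prolonging the segment from it beyond m forces it to vanish
  wherever m does.\<close>

lemma face_at_eq:
  fixes \<sigma> :: "(real^'n::finite) set"
  assumes "rational_polyhedral_cone \<sigma>" "rvec m \<in> dual_cone \<sigma>"
  shows "face_at \<sigma> m = \<sigma> \<inter> {u. rvec m \<bullet> u = 0}" "face_at \<sigma> m face_of \<sigma>" "face_at \<sigma> m \<noteq> {}"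
proof -
  obtain S :: "(int^'n) set" where S: "finite S" "\<sigma> = convex_cone hull (rvec ` S)"
    using assms(1) unfolding rational_polyhedral_cone_def by blast
  note c = rational_polyhedral_cone_facts[OF assms(1)]
  define \<tau> where "\<tau> = \<sigma> \<inter> {u. rvec m \<bullet> u = 0}"
  have conv: "convex (dual_cone \<sigma> \<inter> perp \<rho>)" for \<rho>
    unfolding convex_def dual_cone_def perp_def by (auto simp: inner_add_left)
  have ne: "dual_cone \<sigma> \<inter> perp \<rho> \<noteq> {}" for \<rho>
  proof -
    have "0 \<in> dual_cone \<sigma> \<inter> perp \<rho>" by (auto simp: dual_cone_def perp_def)
    thus ?thesis by blast
  qed
  have face: "\<tau> face_of \<sigma>"
    unfolding \<tau>_def using assms(2) by (intro face_of_Int_supporting_hyperplane_ge c) (auto simp: dual_cone_def)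
  have "0 \<in> \<tau>" using c by (simp add: \<tau>_def)
  have "rvec m \<in> rel_interior (dual_cone \<sigma> \<inter> perp \<tau>)"
    unfolding convex_rel_interior_iff[OF conv ne]
  proof
    fix x assume x: "x \<in> dual_cone \<sigma> \<inter> perp \<tau>"
    obtain d where d: "d > 0" "\<forall>s\<in>S. rvec m \<bullet> rvec s > 0 \<longrightarrow> d * (x \<bullet> rvec s) \<le> rvec m \<bullet> rvec s"
      using ex_small_scale[OF S(1), of "\<lambda>s. rvec m \<bullet> rvec s" "\<lambda>s. x \<bullet> rvec s"] by blast
    let ?y = "(1 - (1 + d)) *\<^sub>R x + (1 + d) *\<^sub>R rvec m"
    have "?y \<bullet> u \<ge> 0" if "u \<in> \<sigma>" for u
    proof (rule inner_ge_convex_cone_hull)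
      show "u \<in> convex_cone hull (rvec ` S)" using that S by simp
      fix v assume "v \<in> rvec ` S"
      then obtain s where s: "s \<in> S" "v = rvec s" by blast
      have vs: "v \<in> \<sigma>" using s S by (simp add: hull_inc)
      have m0: "rvec m \<bullet> v \<ge> 0" using assms(2) vs by (simp add: dual_cone_def)
      have e: "?y \<bullet> v = rvec m \<bullet> v - d * (x \<bullet> v) + d * (rvec m \<bullet> v)"
        by (simp add: inner_add_left algebra_simps inner_diff_left)
      show "?y \<bullet> v \<ge> 0"
      proof (cases "rvec m \<bullet> v = 0")
        case True
        hence "v \<in> \<tau>" using vs by (simp add: \<tau>_def)
        hence "x \<bullet> v = 0" using x by (simp add: perp_def)
        thus ?thesis using e True by simp
      next
        case False
        hence "d * (x \<bullet> v) \<le> rvec m \<bullet> v" using d s m0 by auto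
        thus ?thesis using e m0 d by simp
      qed
    qed
    moreover have "?y \<bullet> u = 0" if "u \<in> \<tau>" for u
      using x that by (simp add: perp_def \<tau>_def inner_add_left inner_diff_left)
    ultimately show "\<exists>e>1. (1 - e) *\<^sub>R x + e *\<^sub>R rvec m \<in> dual_cone \<sigma> \<inter> perp \<tau>"
      using d(1) by (intro exI[of _ "1 + d"]) (auto simp: dual_cone_def perp_def)
  qed
  moreover have "\<rho> = \<tau>"
    if \<rho>: "\<rho> face_of \<sigma> \<and> \<rho> \<noteq> {} \<and> rvec m \<in> rel_interior (dual_cone \<sigma> \<inter> perp \<rho>)" for \<rho>
  proof
    have "rvec m \<in> perp \<rho>" using \<rho> rel_interior_subset by blast
    thus "\<rho> \<subseteq> \<tau>" using \<rho> face_of_imp_subset unfolding \<tau>_def perp_def by blast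
    show "\<tau> \<subseteq> \<rho>"
    proof
      fix u assume u: "u \<in> \<tau>"
      have "\<rho> exposed_face_of \<sigma>" using \<rho> exposed_face_of_polyhedron[OF c(1)] by blast
      then obtain a b where ab: "\<sigma> \<subseteq> {x. a \<bullet> x \<le> b}" "\<rho> = \<sigma> \<inter> {x. a \<bullet> x = b}"
        unfolding exposed_face_of_def by blast
      \<comment> \<open>Dilating a point of the face shows that its supporting hyperplane passes
        through the origin.\<close>
      obtain t where t: "t \<in> \<rho>" using \<rho> by blast
      have "2 *\<^sub>R t \<in> \<sigma>" using t ab convex_cone_scaleR[OF c(4)] by simp
      hence "a \<bullet> (2 *\<^sub>R t) \<le> b" using ab by blast
      hence "b \<le> 0" using t ab by simp
      moreover have "b \<ge> 0" using ab(1) c(5) by auto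
      ultimately have b: "b = 0" by simp
      have "- a \<in> dual_cone \<sigma> \<inter> perp \<rho>" using ab b by (auto simp: dual_cone_def perp_def)
      then obtain e where e: "e > 1" "(1 - e) *\<^sub>R (- a) + e *\<^sub>R rvec m \<in> dual_cone \<sigma> \<inter> perp \<rho>"
        using \<rho> convex_rel_interior_iff[OF conv ne] by blast
      have us: "u \<in> \<sigma>" "rvec m \<bullet> u = 0" using u by (auto simp: \<tau>_def)
      have "0 \<le> ((1 - e) *\<^sub>R (- a) + e *\<^sub>R rvec m) \<bullet> u" using e us by (simp add: dual_cone_def)
      hence "0 \<le> (e - 1) * (a \<bullet> u)" using us by (simp add: inner_add_left algebra_simps)
      hence "a \<bullet> u \<ge> 0" using e by (simp add: zero_le_mult_iff)
      moreover have "a \<bullet> u \<le> 0" using ab us b by blast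
      ultimately show "u \<in> \<rho>" using ab us b by auto
    qed
  qed
  ultimately have "face_at \<sigma> m = \<tau>"
    unfolding face_at_def using face \<open>0 \<in> \<tau>\<close> by (intro the_equality) blast+
  thus "face_at \<sigma> m = \<sigma> \<inter> {u. rvec m \<bullet> u = 0}" "face_at \<sigma> m face_of \<sigma>" "face_at \<sigma> m \<noteq> {}"
    using face \<open>0 \<in> \<tau>\<close> \<tau>_def by auto
qed

subsection \<open>Exterior powers\<close>

lemma pairing_diff_left: "pairing (x - y) z = pairing x z - pairing y z"
  and pairing_smult_left: "pairing (\<chi> i. k * x $ i) z = k * pairing x z"
  by (simp_all add: pairing_def algebra_simps sum.distrib sum_subtractf sum_distrib_left)

lemma pairing_axis: "pairing m (axis j 1) = m $ j"
  by (simp add: pairing_def axis_def if_distrib cong: if_cong)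

text \<open>
  The solutions of the integral linear system \<open>S\<close> are parametrised, up to the common denominator
  \<open>c\<close>, by their coordinates in \<open>J\<close>.
\<close>

definition coordinate_basis :: "(int ^ 'n::finite) set \<Rightarrow> 'n set \<Rightarrow> int \<Rightarrow> ('n \<Rightarrow> int ^ 'n) \<Rightarrow> bool" where
  "coordinate_basis S J c b \<longleftrightarrow> c \<noteq> 0 \<and> (\<forall>i\<in>J. \<forall>s\<in>S. pairing (b i) s = 0) \<and>
     (\<forall>i\<in>J. \<forall>j\<in>J. b i $ j = (if i = j then c else 0)) \<and>
     (\<forall>x. (\<forall>s\<in>S. x \<bullet> rvec s = 0) \<longrightarrow> of_int c *\<^sub>R x = (\<Sum>j\<in>J. (x $ j) *\<^sub>R rvec (b j)))"

text \<open>Gaussian elimination without division. If some b k violates the new equation, coordinate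
  k is eliminated: v k times b i minus v i times b k satisfies the equation, at the price of
  multiplying the common denominator by v k.\<close>

lemma coordinate_basis_exists:
  fixes S :: "(int ^ 'n::finite) set"
  assumes "finite S"
  shows "\<exists>J c b. coordinate_basis S J c b"
  using assms
proof (induction S)
  case empty
  have "1 *\<^sub>R x = (\<Sum>j\<in>UNIV. (x $ j) *\<^sub>R rvec (axis j 1))" for x :: "real^'n"
    by (simp add: vec_eq_iff rvec_def axis_def if_distrib cong: if_cong)
  hence "coordinate_basis {} (UNIV :: 'n set) 1 (\<lambda>i. axis i 1)"
    by (auto simp: coordinate_basis_def axis_def)
  thus ?case by blast
next
  case (insert s S)
  then obtain J c b where H: "coordinate_basis S J c b" by blast
  have c: "c \<noteq> 0" and orth: "\<And>i t. i \<in> J \<Longrightarrow> t \<in> S \<Longrightarrow> pairing (b i) t = 0"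
    and dual: "\<And>i j. i \<in> J \<Longrightarrow> j \<in> J \<Longrightarrow> b i $ j = (if i = j then c else 0)"
    and gen: "\<And>x::real^'n. (\<forall>s\<in>S. x \<bullet> rvec s = 0) \<Longrightarrow> of_int c *\<^sub>R x = (\<Sum>j\<in>J. (x $ j) *\<^sub>R rvec (b j))"
    using H by (simp_all add: coordinate_basis_def)
  show ?case
  proof (cases "\<forall>i\<in>J. pairing (b i) s = 0")
    case True
    hence "coordinate_basis (insert s S) J c b" using H by (simp add: coordinate_basis_def)
    thus ?thesis by blast
  next
    case False
    then obtain k where k: "k \<in> J" "pairing (b k) s \<noteq> 0" by blast
    define v where "v i = pairing (b i) s" for i
    define b' where "b' i = (\<chi> l. v k * b i $ l) - (\<chi> l. v i * b k $ l)" for i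
    have o1: "pairing (b' i) t = v k * pairing (b i) t - v i * pairing (b k) t" for i t
      unfolding b'_def by (simp add: pairing_diff_left pairing_smult_left)
    have "of_int (c * v k) *\<^sub>R x = (\<Sum>j\<in>J - {k}. (x $ j) *\<^sub>R rvec (b' j))"
      if x: "\<forall>t\<in>insert s S. x \<bullet> rvec t = 0" for x
    proof -
      have g: "of_int c *\<^sub>R x = (\<Sum>j\<in>J. (x $ j) *\<^sub>R rvec (b j))" using gen x by simp
      have "(of_int c *\<^sub>R x) \<bullet> rvec s = 0" using x by simp
      hence z: "(\<Sum>j\<in>J. (x $ j) * of_int (v j)) = 0"
        unfolding g inner_sum_left by (simp add: rvec_inner v_def)
      have rb: "rvec (b' j) = of_int (v k) *\<^sub>R rvec (b j) - of_int (v j) *\<^sub>R rvec (b k)" for j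
        unfolding b'_def rvec_diff rvec_smult ..
      have "(\<Sum>j\<in>J - {k}. (x $ j) *\<^sub>R rvec (b' j)) = (\<Sum>j\<in>J. (x $ j) *\<^sub>R rvec (b' j))"
        using k by (simp add: sum.remove rb)
      also have "\<dots> = of_int (v k) *\<^sub>R (\<Sum>j\<in>J. (x $ j) *\<^sub>R rvec (b j)) - (\<Sum>j\<in>J. (x $ j) * of_int (v j)) *\<^sub>R rvec (b k)"
        unfolding rb scaleR_sum_right scaleR_sum_left sum_subtractf[symmetric]
        by (intro sum.cong refl) (simp add: algebra_simps)
      also have "\<dots> = of_int (v k) *\<^sub>R (of_int c *\<^sub>R x)" unfolding z g by simp
      finally show ?thesis by (simp add: mult.commute)
    qed
    moreover have "c * v k \<noteq> 0" using c k by (simp add: v_def)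
    moreover have "pairing (b' i) t = 0" if "i \<in> J - {k}" "t \<in> insert s S" for i t
      using that orth[of i t] orth[of k t] k(1) by (cases "t = s") (auto simp: o1 v_def)
    moreover have "b' i $ j = (if i = j then c * v k else 0)" if "i \<in> J - {k}" "j \<in> J - {k}" for i j
      using that dual[of i j] dual[of k j] k(1) by (auto simp: b'_def)
    ultimately have "coordinate_basis (insert s S) (J - {k}) (c * v k) b'"
      unfolding coordinate_basis_def by (intro conjI ballI allI impI)
    thus ?thesis by blast
  qed
qed

lemma sum_fun_apply: "(\<Sum>i\<in>A. f i) x = (\<Sum>i\<in>A. f i x)"
  by (induction A rule: infinite_finite_induct) auto

lemma wedge_map:
  "wedge (map g [0..<p]) us = (if length us = p
     then \<Sum>\<pi> | \<pi> permutes {..<p}. of_int (sign \<pi>) * (\<Prod>i<p. of_int (pairing (g i) (us ! \<pi> i)))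
     else 0)"
  unfolding wedge_def by (simp cong: prod.cong_simp)

lemma wedge_permute:
  assumes r: "\<rho> permutes {..<p}"
  shows "wedge (map (\<lambda>i. g (\<rho> i)) [0..<p]) = fscale (of_int (sign \<rho>)) (wedge (map g [0..<p]))"
proof
  fix us :: "(int ^ 'a) list"
  show "wedge (map (\<lambda>i. g (\<rho> i)) [0..<p]) us = fscale (of_int (sign \<rho>)) (wedge (map g [0..<p])) us"
  proof (cases "length us = p")
    case True
    let ?f = "\<lambda>\<pi>. of_int (sign \<pi>) * (\<Prod>i<p. of_int (pairing (g (\<rho> i)) (us ! \<pi> i))) :: complex"
    have "(\<Sum>\<pi> | \<pi> permutes {..<p}. ?f \<pi>) = (\<Sum>\<pi> | \<pi> permutes {..<p}. ?f (\<pi> \<circ> \<rho>))"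
      by (rule sum_permutations_compose_right[OF r])
    also have "\<dots> = (\<Sum>\<pi> | \<pi> permutes {..<p}. of_int (sign \<rho>) *
        (of_int (sign \<pi>) * (\<Prod>i<p. of_int (pairing (g i) (us ! \<pi> i)))))"
    proof (rule sum.cong[OF refl])
      fix \<pi> assume "\<pi> \<in> {\<pi>. \<pi> permutes {..<p}}"
      hence p: "\<pi> permutes {..<p}" by simp
      have "sign (\<pi> \<circ> \<rho>) = sign \<pi> * sign \<rho>"
        using p r by (intro sign_compose) (auto intro: permutes_imp_permutation[of "{..<p}"])
      moreover have "(\<Prod>i<p. of_int (pairing (g (\<rho> i)) (us ! \<pi> (\<rho> i)))) = (\<Prod>i<p. of_int (pairing (g i) (us ! \<pi> i)) :: complex)"
        using prod.permute[OF r, of "\<lambda>i. of_int (pairing (g i) (us ! \<pi> i)) :: complex"] by (simp add: comp_def)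
      ultimately show "?f (\<pi> \<circ> \<rho>) = of_int (sign \<rho>) * (of_int (sign \<pi>) * (\<Prod>i<p. of_int (pairing (g i) (us ! \<pi> i))))"
        by simp
    qed
    finally show ?thesis using True by (simp add: wedge_map fscale_def sum_distrib_left)
  qed (simp add: wedge_map fscale_def)
qed

lemma wedge_repeated:
  assumes "i < p" "j < p" "i \<noteq> j" "g i = g j"
  shows "wedge (map g [0..<p]) = 0"
proof -
  have t: "Transposition.transpose i j permutes {..<p}" using assms by (intro permutes_swap_id) auto
  have e: "g (Transposition.transpose i j k) = g k" for k using assms by (simp add: Transposition.transpose_def)
  have "wedge (map g [0..<p]) = fscale (-1) (wedge (map g [0..<p]))"
    using wedge_permute[OF t, of g] assms by (simp add: sign_swap_id e)
  hence "wedge (map g [0..<p]) us = - wedge (map g [0..<p]) us" for us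
    by (simp add: fscale_def fun_eq_iff)
  thus ?thesis by (simp add: fun_eq_iff)
qed

text \<open>Multilinearity with cleared denominators: each of the p entries absorbs one factor c,
  and the product of sums over J becomes a sum over all choice functions f.\<close>

lemma wedge_expand:
  fixes ms :: "(int ^ 'n::finite) list"
  assumes "\<And>m. m \<in> set ms \<Longrightarrow> (\<chi> k. c * m $ k) = (\<Sum>j\<in>J. (\<chi> k. m $ j * b j $ k))" "length ms = p"
  shows "fscale (of_int c ^ p) (wedge ms) =
     (\<Sum>f\<in>{..<p} \<rightarrow>\<^sub>E J. fscale (\<Prod>i<p. of_int (ms ! i $ f i)) (wedge (map (\<lambda>i. b (f i)) [0..<p])))"
proof
  fix us :: "(int ^ 'n) list"
  have pe: "of_int c * of_int (pairing (ms ! i) u) = (\<Sum>j\<in>J. of_int (ms ! i $ j) * of_int (pairing (b j) u) :: complex)"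
    if "i < p" for i u
  proof -
    have "c * pairing (ms ! i) u = pairing (\<chi> k. c * ms ! i $ k) u" by (simp add: pairing_smult_left)
    also have "\<dots> = pairing (\<Sum>j\<in>J. (\<chi> k. ms ! i $ j * b j $ k)) u" using assms that by simp
    also have "\<dots> = (\<Sum>j\<in>J. pairing (\<chi> k. ms ! i $ j * b j $ k) u)"
      unfolding pairing_def by (simp add: sum_distrib_right) (rule sum.swap)
    also have "\<dots> = (\<Sum>j\<in>J. ms ! i $ j * pairing (b j) u)" by (simp add: pairing_smult_left)
    finally have "of_int (c * pairing (ms ! i) u) = (of_int (\<Sum>j\<in>J. ms ! i $ j * pairing (b j) u) :: complex)" by simp
    thus ?thesis by simp
  qed
  show "fscale (of_int c ^ p) (wedge ms) us =
     (\<Sum>f\<in>{..<p} \<rightarrow>\<^sub>E J. fscale (\<Prod>i<p. of_int (ms ! i $ f i)) (wedge (map (\<lambda>i. b (f i)) [0..<p]))) us"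
  proof (cases "length us = p")
    case True
    have "of_int c ^ p * wedge ms us = (\<Sum>\<pi> | \<pi> permutes {..<p}. of_int (sign \<pi>) *
       (\<Prod>i<p. of_int c * of_int (pairing (ms ! i) (us ! \<pi> i))))"
      using True assms(2) by (simp add: wedge_def sum_distrib_left prod.distrib mult_ac)
    also have "\<dots> = (\<Sum>\<pi> | \<pi> permutes {..<p}. of_int (sign \<pi>) *
       (\<Prod>i<p. \<Sum>j\<in>J. of_int (ms ! i $ j) * of_int (pairing (b j) (us ! \<pi> i))))"
      by (intro sum.cong refl arg_cong2[where f = "(*)"] prod.cong) (simp add: pe)
    also have "\<dots> = (\<Sum>\<pi> | \<pi> permutes {..<p}. of_int (sign \<pi>) *
       (\<Sum>f\<in>{..<p} \<rightarrow>\<^sub>E J. \<Prod>i<p. of_int (ms ! i $ f i) * of_int (pairing (b (f i)) (us ! \<pi> i))))"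
      by (subst prod_sum_PiE) auto
    also have "\<dots> = (\<Sum>f\<in>{..<p} \<rightarrow>\<^sub>E J. (\<Prod>i<p. of_int (ms ! i $ f i)) *
       (\<Sum>\<pi> | \<pi> permutes {..<p}. of_int (sign \<pi>) * (\<Prod>i<p. of_int (pairing (b (f i)) (us ! \<pi> i)))))"
      unfolding sum_distrib_left
      by (subst sum.swap) (intro sum.cong refl, simp add: prod.distrib mult_ac)
    finally show ?thesis using True by (simp add: fscale_def wedge_map sum_fun_apply)
  next
    case False
    thus ?thesis using assms(2) by (simp add: fscale_def wedge_map wedge_def sum_fun_apply)
  qed
qed

lemma ext_power_mono: "L \<subseteq> L' \<Longrightarrow> ext_power p L \<subseteq> ext_power p L'"
  unfolding ext_power_def by (intro fun_vs.span_mono) blast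

lemma subspace_ext_power: "fun_vs.subspace (ext_power p L)"
  unfolding ext_power_def by (rule fun_vs.subspace_span)

text \<open>A reference ordering of each finite set; it normalizes both wedge products and
  alternating cochains.\<close>

definition enum_list :: "'a set \<Rightarrow> 'a list" where
  "enum_list I = (SOME l. set l = I \<and> distinct l)"

lemma enum_list:
  assumes "finite I"
  shows "set (enum_list I) = I" "distinct (enum_list I)" "length (enum_list I) = card I"
proof -
  have "set (enum_list I) = I \<and> distinct (enum_list I)"
    unfolding enum_list_def by (rule someI_ex) (use finite_distinct_list[OF assms] in blast)
  thus "set (enum_list I) = I" "distinct (enum_list I)" by auto
  thus "length (enum_list I) = card I" using distinct_card by metis
qed

lemma map_nth_upt: "length l = p \<Longrightarrow> map g l = map (\<lambda>i. g (l ! i)) [0..<p]"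
  by (rule nth_equalityI) auto

text \<open>Coordinate vectors separate the wedges of different index sets. The matrix of pairings
  is c times the identity if I = K; otherwise an element of I outside K gives a zero row.\<close>

lemma wedge_dual_eval:
  fixes b :: "'n::finite \<Rightarrow> int ^ 'n"
  assumes "\<And>i j. i \<in> J \<Longrightarrow> j \<in> J \<Longrightarrow> b i $ j = (if i = j then c else 0)"
    and I: "I \<subseteq> J" "card I = p" and K: "K \<subseteq> J" "card K = p"
  shows "wedge (map b (enum_list I)) (map (\<lambda>j. axis j 1) (enum_list K)) = (if I = K then of_int c ^ p else 0)"
proof -
  let ?l = "enum_list I" and ?k = "enum_list K"
  have l: "set ?l = I" "distinct ?l" "length ?l = p" and k: "set ?k = K" "distinct ?k" "length ?k = p"
    using enum_list[OF finite, of I] enum_list[OF finite, of K] I(2) K(2) by simp_all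
  have ev: "wedge (map b ?l) (map (\<lambda>j. axis j 1) ?k) =
      (\<Sum>\<pi> | \<pi> permutes {..<p}. of_int (sign \<pi>) * (\<Prod>i<p. of_int (if ?l ! i = ?k ! \<pi> i then c else 0)))"
    unfolding map_nth_upt[OF l(3)] wedge_map
  proof (simp add: k, intro sum.cong refl arg_cong2[where f = "(*)"] prod.cong)
    fix \<pi> i assume "\<pi> \<in> {\<pi>. \<pi> permutes {..<p}}" "i \<in> {..<p}"
    hence i: "i < p" "\<pi> i < p" using permutes_in_image[of \<pi> "{..<p}" i] by auto
    have "?l ! i \<in> set ?l" "?k ! \<pi> i \<in> set ?k" using i l(3) k(3) by simp_all
    hence "?l ! i \<in> J" "?k ! \<pi> i \<in> J" unfolding l(1) k(1) using I(1) K(1) by auto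
    thus "of_int (pairing (b (?l ! i)) (map (\<lambda>j. axis j 1) ?k ! \<pi> i)) = (of_int (if ?l ! i = ?k ! \<pi> i then c else 0) :: complex)"
      using i k assms(1) by (simp add: pairing_axis)
  qed
  show ?thesis
  proof (cases "I = K")
    case True
    have "(\<Prod>i<p. of_int (if ?l ! i = ?k ! \<pi> i then c else 0)) = (0::complex)"
      if p: "\<pi> permutes {..<p}" "\<pi> \<noteq> id" for \<pi>
    proof -
      obtain i where i: "\<pi> i \<noteq> i" using p by (auto simp: fun_eq_iff)
      hence ip: "i < p" using p(1) permutes_not_in[of \<pi> "{..<p}" i] by auto
      hence "\<pi> i < p" using permutes_in_image[OF p(1), of i] by auto
      hence "?l ! i \<noteq> ?k ! \<pi> i" using True i ip l by (simp add: nth_eq_iff_index_eq)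
      thus ?thesis using ip by (intro prod_zero) auto
    qed
    hence "wedge (map b ?l) (map (\<lambda>j. axis j 1) ?k) =
       (\<Sum>\<pi>\<in>{id}. of_int (sign \<pi>) * (\<Prod>i<p. of_int (if ?l ! i = ?k ! \<pi> i then c else 0)))"
      unfolding ev by (intro sum.mono_neutral_right) (auto simp: finite_permutations permutes_id)
    thus ?thesis using True by (simp add: sign_id)
  next
    case False
    have "\<not> I \<subseteq> K" using False I K finite_subset[of K J] card_subset_eq[of K I] by auto
    then obtain x where x: "x \<in> I" "x \<notin> K" by blast
    then obtain i where i: "i < p" "?l ! i = x" using l by (metis in_set_conv_nth)
    have "(\<Prod>i<p. of_int (if ?l ! i = ?k ! \<pi> i then c else 0)) = (0::complex)" if p: "\<pi> permutes {..<p}" for \<pi>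
    proof -
      have "\<pi> i < p" using permutes_in_image[OF p, of i] i by auto
      hence "?k ! \<pi> i \<in> K" using k nth_mem by blast
      thus ?thesis using i x by (intro prod_zero[OF _ bexI[of _ i]]) auto
    qed
    thus ?thesis using False unfolding ev by (intro trans[OF sum.neutral]) auto
  qed
qed

text \<open>The wedges \<open>w I\<close> over the p-element subsets I of J form a basis. They are
  independent by evaluation on coordinate vectors; they span because every wedge expands into words
  in the b j, which vanish for a repeated letter and are otherwise plus or minus some
  \<open>w I\<close>.\<close>

lemma dim_ext_power_basis:
  fixes L :: "(int ^ 'n::finite) set" and b :: "'n \<Rightarrow> int ^ 'n"
  assumes c: "c \<noteq> 0" and dual: "\<And>i j. i \<in> J \<Longrightarrow> j \<in> J \<Longrightarrow> b i $ j = (if i = j then c else 0)"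
    and bL: "\<And>j. j \<in> J \<Longrightarrow> b j \<in> L"
    and gen: "\<And>m. m \<in> L \<Longrightarrow> (\<chi> k. c * m $ k) = (\<Sum>j\<in>J. (\<chi> k. m $ j * b j $ k))"
  shows "fun_vs.dim (ext_power p L) = card J choose p"
    and "\<exists>T. finite T \<and> ext_power p L \<subseteq> fun_vs.span T"
proof -
  let ?I = "{I. I \<subseteq> J \<and> card I = p}"
  define w where "w I = wedge (map b (enum_list I))" for I
  have fI: "finite ?I" by simp
  have fam: "\<forall>a. (\<Sum>I\<in>?I. fscale (a I) (w I)) = 0 \<longrightarrow> (\<forall>I\<in>?I. a I = 0)"
  proof (intro allI impI ballI)
    fix a K assume a: "(\<Sum>I\<in>?I. fscale (a I) (w I)) = 0" and K: "K \<in> ?I"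
    let ?u = "map (\<lambda>j. axis j 1) (enum_list K)"
    have "0 = (\<Sum>I\<in>?I. fscale (a I) (w I)) ?u" using a by simp
    also have "\<dots> = (\<Sum>I\<in>?I. a I * w I ?u)" by (simp add: sum_fun_apply fscale_def)
    also have "\<dots> = (\<Sum>I\<in>?I. if I = K then a I * of_int c ^ p else 0)"
    proof (rule sum.cong[OF refl])
      fix I assume "I \<in> ?I"
      thus "a I * w I ?u = (if I = K then a I * of_int c ^ p else 0)"
        unfolding w_def using wedge_dual_eval[OF dual, of J I p K] K by auto
    qed
    also have "\<dots> = a K * of_int c ^ p" using K fI by (subst sum.delta) auto
    finally show "a K = 0" using c by simp
  qed
  have sub: "w ` ?I \<subseteq> ext_power p L"
  proof
    fix v assume "v \<in> w ` ?I"
    then obtain I where I: "I \<subseteq> J" "card I = p" "v = w I" by blast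
    have "set (map b (enum_list I)) \<subseteq> L" "length (map b (enum_list I)) = p"
      using enum_list[of I] I bL by auto
    thus "v \<in> ext_power p L" unfolding I(3) w_def ext_power_def by (intro fun_vs.span_base) blast
  qed
  have word: "wedge (map (\<lambda>i. b (f i)) [0..<p]) \<in> fun_vs.span (w ` ?I)" if f: "f \<in> {..<p} \<rightarrow>\<^sub>E J" for f
  proof (cases "inj_on f {..<p}")
    case False
    then obtain i j where "i < p" "j < p" "i \<noteq> j" "f i = f j" by (auto simp: inj_on_def)
    hence "wedge (map (\<lambda>i. b (f i)) [0..<p]) = 0" using wedge_repeated[of i p j "\<lambda>i. b (f i)"] by simp
    thus ?thesis by (simp add: fun_vs.span_zero)
  next
    case True
    define I where "I = f ` {..<p}"
    have I: "I \<in> ?I" using f True card_image[OF True] by (auto simp: I_def)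
    let ?l = "enum_list I"
    have l: "set ?l = I" "distinct ?l" "length ?l = p" using enum_list[of I] I by auto
    have bl: "bij_betw (\<lambda>i. ?l ! i) {..<p} I" using bij_betw_nth[OF l(2), of "{..<p}" I] l by simp
    have bf: "bij_betw f {..<p} I" using True by (simp add: bij_betw_def I_def)
    \<comment> \<open>The permutation that carries the word f to the reference ordering of its
      image.\<close>
    define \<rho> where "\<rho> i = (if i < p then inv_into {..<p} (\<lambda>i. ?l ! i) (f i) else i)" for i
    have "bij_betw (inv_into {..<p} (\<lambda>i. ?l ! i) \<circ> f) {..<p} {..<p}"
      using bij_betw_trans[OF bf bij_betw_inv_into[OF bl]] .
    hence "bij_betw \<rho> {..<p} {..<p}"
      by (rule bij_betw_cong[THEN iffD1, rotated]) (simp add: \<rho>_def)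
    hence r: "\<rho> permutes {..<p}" by (rule bij_imp_permutes) (simp add: \<rho>_def)
    have "?l ! \<rho> i = f i" if "i < p" for i
      using that bij_betw_inv_into_right[OF bl, of "f i"] by (simp add: \<rho>_def I_def)
    hence e: "map (\<lambda>i. b (f i)) [0..<p] = map (\<lambda>i. b (?l ! \<rho> i)) [0..<p]" by simp
    have e2: "wedge (map (\<lambda>i. b (f i)) [0..<p]) = fscale (of_int (sign \<rho>)) (w I)"
      unfolding w_def map_nth_upt[OF l(3), of b] e by (rule wedge_permute[OF r])
    show ?thesis unfolding e2 by (intro fun_vs.span_scale fun_vs.span_base imageI I)
  qed
  have "ext_power p L \<subseteq> fun_vs.span (w ` ?I)"
    unfolding ext_power_def
  proof (rule fun_vs.span_minimal[OF _ fun_vs.subspace_span], rule subsetI)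
    fix v assume "v \<in> {wedge ms |ms. length ms = p \<and> set ms \<subseteq> L}"
    then obtain ms where ms: "v = wedge ms" "length ms = p" "set ms \<subseteq> L" by blast
    have "fscale (of_int c ^ p) (wedge ms) \<in> fun_vs.span (w ` ?I)"
    proof -
      have "\<And>m. m \<in> set ms \<Longrightarrow> (\<chi> k. c * m $ k) = (\<Sum>j\<in>J. (\<chi> k. m $ j * b j $ k))"
        using gen ms(3) by blast
      from wedge_expand[OF this ms(2)] show ?thesis
        by (simp only:) (intro fun_vs.span_sum fun_vs.span_scale word)
    qed
    \<comment> \<open>Over the complex numbers the denominator can be divided out again.\<close>
    hence "fscale (1 / of_int c ^ p) (fscale (of_int c ^ p) (wedge ms)) \<in> fun_vs.span (w ` ?I)"
      by (rule fun_vs.span_scale)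
    thus "v \<in> fun_vs.span (w ` ?I)" using c ms by (simp add: fscale_def)
  qed
  thus "fun_vs.dim (ext_power p L) = card J choose p"
    using fun_vs.dim_family[OF fI fam sub] by (simp add: n_subsets)
  show "\<exists>T. finite T \<and> ext_power p L \<subseteq> fun_vs.span T"
    using \<open>ext_power p L \<subseteq> fun_vs.span (w ` ?I)\<close> fI by blast
qed

lemma perp_convex_cone_hull: "perp (convex_cone hull S) = {x. \<forall>s\<in>S. x \<bullet> s = 0}"
proof
  show "perp (convex_cone hull S) \<subseteq> {x. \<forall>s\<in>S. x \<bullet> s = 0}" by (auto simp: perp_def hull_inc)
  show "{x. \<forall>s\<in>S. x \<bullet> s = 0} \<subseteq> perp (convex_cone hull S)"
  proof (clarsimp simp: perp_def)
    fix x u assume x: "\<forall>s\<in>S. x \<bullet> s = 0" and u: "u \<in> convex_cone hull S"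
    have "x \<bullet> u \<ge> 0" "(- x) \<bullet> u \<ge> 0"
      using inner_ge_convex_cone_hull[OF _ u, of x] inner_ge_convex_cone_hull[OF _ u, of "- x"] x by simp_all
    thus "x \<bullet> u = 0" by simp
  qed
qed

text \<open>The vectors b j span only a sublattice containing c times \<tau>^\<bottom> \<inter> M;
  with complex coefficients this is enough. The same vectors are a real basis of
  \<open>perp \<tau>\<close>, which identifies their number with
  \<open>orbit_dim \<tau>\<close>.\<close>

theorem dim_ext_power:
  fixes \<tau> :: "(real ^ 'n::finite) set"
  assumes "rational_polyhedral_cone \<tau>"
  shows "fun_vs.dim (ext_power p (perp_lattice \<tau>)) = orbit_dim \<tau> choose p"
    and "\<exists>T. finite T \<and> ext_power p (perp_lattice \<tau>) \<subseteq> fun_vs.span T"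
proof -
  obtain S :: "(int^'n) set" where S: "finite S" "\<tau> = convex_cone hull (rvec ` S)"
    using assms unfolding rational_polyhedral_cone_def by blast
  obtain J c b where H: "coordinate_basis S J c b"
    using coordinate_basis_exists[OF S(1)] by blast
  have c: "c \<noteq> 0" and orth: "\<forall>i\<in>J. \<forall>t\<in>S. pairing (b i) t = 0"
    and dual: "\<forall>i\<in>J. \<forall>j\<in>J. b i $ j = (if i = j then c else 0)"
    and gen: "\<forall>x::real^'n. (\<forall>s\<in>S. x \<bullet> rvec s = 0) \<longrightarrow> of_int c *\<^sub>R x = (\<Sum>j\<in>J. (x $ j) *\<^sub>R rvec (b j))"
    using H by (simp_all add: coordinate_basis_def)
  have perp: "perp \<tau> = {x. \<forall>s\<in>S. x \<bullet> rvec s = 0}" unfolding S(2) perp_convex_cone_hull by simp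
  have bL: "b j \<in> perp_lattice \<tau>" if "j \<in> J" for j
    using orth that by (simp add: perp_lattice_def perp rvec_inner)
  have od: "orbit_dim \<tau> = card J"
    unfolding orbit_dim_def
  proof (rule real_vector.dim_family[where f = "\<lambda>j. rvec (b j)"])
    show "finite J" by simp
    show "(\<lambda>j. rvec (b j)) ` J \<subseteq> perp \<tau>" using bL by (auto simp: perp_lattice_def)
    show "\<forall>a. (\<Sum>j\<in>J. a j *\<^sub>R rvec (b j)) = 0 \<longrightarrow> (\<forall>i\<in>J. a i = 0)"
    proof (intro allI impI ballI)
      fix a i assume a: "(\<Sum>j\<in>J. a j *\<^sub>R rvec (b j)) = 0" and i: "i \<in> J"
      have "0 = (\<Sum>j\<in>J. a j *\<^sub>R rvec (b j)) $ i" using a by simp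
      also have "\<dots> = (\<Sum>j\<in>J. if j = i then a j * of_int c else 0)"
        unfolding sum_component by (rule sum.cong) (use dual i in \<open>auto simp: rvec_def\<close>)
      also have "\<dots> = a i * of_int c" using i by simp
      finally show "a i = 0" using c by simp
    qed
    show "perp \<tau> \<subseteq> span ((\<lambda>j. rvec (b j)) ` J)"
    proof
      fix x assume "x \<in> perp \<tau>"
      hence "of_int c *\<^sub>R x = (\<Sum>j\<in>J. (x $ j) *\<^sub>R rvec (b j))" using gen perp by blast
      hence "(1 / of_int c) *\<^sub>R of_int c *\<^sub>R x \<in> span ((\<lambda>j. rvec (b j)) ` J)"
        by (simp only:) (intro span_scale span_sum span_base imageI)
      thus "x \<in> span ((\<lambda>j. rvec (b j)) ` J)" using c by simp
    qed
  qed
  have g: "(\<chi> k. c * m $ k) = (\<Sum>j\<in>J. (\<chi> k. m $ j * b j $ k))" if m: "m \<in> perp_lattice \<tau>" for m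
  proof -
    have "of_int c *\<^sub>R rvec m = (\<Sum>j\<in>J. (rvec m $ j) *\<^sub>R rvec (b j))"
      using gen m perp by (auto simp: perp_lattice_def)
    hence "real_of_int (c * m $ k) = real_of_int (\<Sum>j\<in>J. m $ j * b j $ k)" for k
      by (simp add: vec_eq_iff rvec_def)
    hence "c * m $ k = (\<Sum>j\<in>J. m $ j * b j $ k)" for k by (simp only: of_int_eq_iff)
    thus ?thesis by (simp add: vec_eq_iff)
  qed
  show "fun_vs.dim (ext_power p (perp_lattice \<tau>)) = orbit_dim \<tau> choose p"
    "\<exists>T. finite T \<and> ext_power p (perp_lattice \<tau>) \<subseteq> fun_vs.span T"
    unfolding od by (rule dim_ext_power_basis[OF c _ bL g]; use dual in blast)+
qed

subsection \<open>Alternating Cech cochains\<close>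

definition del_nth :: "nat \<Rightarrow> 'a list \<Rightarrow> 'a list" where
  "del_nth j xs = take j xs @ drop (Suc j) xs"

definition swap_nth :: "nat \<Rightarrow> nat \<Rightarrow> 'a list \<Rightarrow> 'a list" where
  "swap_nth i j xs = xs[i := xs ! j, j := xs ! i]"

lemma length_del_nth: "j < length xs \<Longrightarrow> length (del_nth j xs) = length xs - 1"
  by (simp add: del_nth_def)

lemma nth_del_nth: "j < length xs \<Longrightarrow> k < length xs - 1 \<Longrightarrow> del_nth j xs ! k = (if k < j then xs ! k else xs ! Suc k)"
  by (auto simp: del_nth_def nth_append min_def)

lemma set_del_nth: "set (del_nth j xs) \<subseteq> set xs"
  by (auto simp: del_nth_def dest: in_set_takeD in_set_dropD)

lemma length_swap_nth [simp]: "length (swap_nth i j xs) = length xs" by (simp add: swap_nth_def)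

lemma nth_swap_nth:
  "i < length xs \<Longrightarrow> j < length xs \<Longrightarrow> k < length xs \<Longrightarrow>
     swap_nth i j xs ! k = xs ! (Transposition.transpose i j k)"
  by (auto simp: swap_nth_def nth_list_update Transposition.transpose_def)

lemma set_swap_nth: "i < length xs \<Longrightarrow> j < length xs \<Longrightarrow> set (swap_nth i j xs) = set xs"
  by (simp add: swap_nth_def)

lemma del_nth_del_nth:
  assumes "j \<le> k" "Suc k < length xs"
  shows "del_nth k (del_nth j xs) = del_nth j (del_nth (Suc k) xs)"
proof (rule nth_equalityI)
  show "length (del_nth k (del_nth j xs)) = length (del_nth j (del_nth (Suc k) xs))"
    using assms by (simp add: length_del_nth)
  fix i assume "i < length (del_nth k (del_nth j xs))"
  hence "i < length xs - 2" using assms by (simp add: length_del_nth)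
  thus "del_nth k (del_nth j xs) ! i = del_nth j (del_nth (Suc k) xs) ! i"
    using assms by (auto simp: nth_del_nth length_del_nth)
qed

lemma del_nth_swap_before:
  assumes "j < i" "Suc i < length xs"
  shows "del_nth j (swap_nth i (Suc i) xs) = swap_nth (i - 1) i (del_nth j xs)"
proof (rule nth_equalityI)
  show "length (del_nth j (swap_nth i (Suc i) xs)) = length (swap_nth (i - 1) i (del_nth j xs))"
    using assms by (simp add: length_del_nth)
  fix k assume "k < length (del_nth j (swap_nth i (Suc i) xs))"
  hence "k < length xs - 1" using assms by (simp add: length_del_nth)
  thus "del_nth j (swap_nth i (Suc i) xs) ! k = swap_nth (i - 1) i (del_nth j xs) ! k"
    using assms by (auto simp: nth_del_nth length_del_nth nth_swap_nth Transposition.transpose_def)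
qed

lemma del_nth_swap_after:
  assumes "Suc i < j" "j < length xs"
  shows "del_nth j (swap_nth i (Suc i) xs) = swap_nth i (Suc i) (del_nth j xs)"
proof (rule nth_equalityI)
  show "length (del_nth j (swap_nth i (Suc i) xs)) = length (swap_nth i (Suc i) (del_nth j xs))"
    using assms by (simp add: length_del_nth)
  fix k assume "k < length (del_nth j (swap_nth i (Suc i) xs))"
  hence "k < length xs - 1" using assms by (simp add: length_del_nth)
  thus "del_nth j (swap_nth i (Suc i) xs) ! k = swap_nth i (Suc i) (del_nth j xs) ! k"
    using assms by (auto simp: nth_del_nth length_del_nth nth_swap_nth Transposition.transpose_def)
qed

lemma del_nth_swap_same:
  assumes "Suc i < length xs"
  shows "del_nth i (swap_nth i (Suc i) xs) = del_nth (Suc i) xs"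
    and "del_nth (Suc i) (swap_nth i (Suc i) xs) = del_nth i xs"
  by (rule nth_equalityI; use assms in \<open>auto simp: nth_del_nth length_del_nth nth_swap_nth Transposition.transpose_def less_Suc_eq\<close>)+

lemma swap_nth_conj:
  assumes "i < j" "Suc j < length xs"
  shows "swap_nth i (Suc j) xs = swap_nth j (Suc j) (swap_nth i j (swap_nth j (Suc j) xs))"
  by (rule nth_equalityI; use assms in \<open>auto simp: nth_swap_nth Transposition.transpose_def\<close>)

text \<open>A transposition is conjugate, by an adjacent one, to a transposition of smaller
  distance, so the sign changes an odd number of times. This reduces the alternation of the
  differential to neighbouring entries.\<close>

lemma alternating_from_adjacent:
  fixes f :: "'a list \<Rightarrow> complex"
  assumes adj: "\<And>xs i. Suc i < length xs \<Longrightarrow> f (swap_nth i (Suc i) xs) = - f xs"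
  shows "i < j \<Longrightarrow> j < length xs \<Longrightarrow> f (swap_nth i j xs) = - f xs"
proof (induction j arbitrary: xs)
  case (Suc j)
  show ?case
  proof (cases "i = j")
    case False
    hence ij: "i < j" using Suc.prems by simp
    show ?thesis using Suc.IH[OF ij] Suc.prems adj by (simp add: swap_nth_conj[OF ij])
  qed (use adj Suc.prems in auto)
qed simp

lemma alternating_permute:
  fixes f :: "'a list \<Rightarrow> complex"
  assumes alt: "\<And>xs i j. i < j \<Longrightarrow> j < length xs \<Longrightarrow> f (swap_nth i j xs) = - f xs"
    and "\<pi> permutes {..<length l}"
  shows "f (map (\<lambda>i. l ! \<pi> i) [0..<length l]) = of_int (sign \<pi>) * f l"
  using finite_lessThan assms(2)
proof (induction rule: permutes_rev_induct)
  case id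
  show ?case by (simp add: map_nth sign_id)
next
  case (swap a b p)
  show ?case
  proof (cases "a = b")
    case True thus ?thesis using swap by simp
  next
    case False
    define x y where "x = min a b" and "y = max a b"
    have xy: "x < y" "y < length l" using False swap by (auto simp: x_def y_def)
    have t: "Transposition.transpose a b = Transposition.transpose x y"
      by (auto simp: x_def y_def min_def max_def transpose_commute)
    have "map (\<lambda>i. l ! (p \<circ> Transposition.transpose a b) i) [0..<length l] = swap_nth x y (map (\<lambda>i. l ! p i) [0..<length l])"
    proof (rule nth_equalityI)
      fix i assume "i < length (map (\<lambda>i. l ! (p \<circ> Transposition.transpose a b) i) [0..<length l])"
      hence i: "i < length l" by simp
      moreover have "Transposition.transpose x y i < length l" using i xy by (auto simp: Transposition.transpose_def)
      ultimately show "map (\<lambda>i. l ! (p \<circ> Transposition.transpose a b) i) [0..<length l] ! i = swap_nth x y (map (\<lambda>i. l ! p i) [0..<length l]) ! i"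
        using xy by (simp add: nth_swap_nth t)
    qed simp
    hence "f (map (\<lambda>i. l ! (p \<circ> Transposition.transpose a b) i) [0..<length l]) = - f (map (\<lambda>i. l ! p i) [0..<length l])"
      using alt[OF xy(1)] xy(2) by simp
    moreover have "sign (p \<circ> Transposition.transpose a b) = - sign p"
      using swap False permutes_imp_permutation[of "{..<length l}" p]
      by (simp add: sign_compose sign_swap_id permutation_swap_id)
    moreover have "f (map (\<lambda>i. l ! p i) [0..<length l]) = of_int (sign p) * f l" using swap by simp
    ultimately show ?thesis by (simp only: of_int_minus mult_minus_left)
  qed
qed

definition list_index :: "'a list \<Rightarrow> 'a \<Rightarrow> nat" where
  "list_index l x = (THE i. i < length l \<and> l ! i = x)"

lemma list_index:
  assumes "distinct l" "x \<in> set l"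
  shows "list_index l x < length l" "l ! list_index l x = x"
proof -
  have "\<exists>!i. i < length l \<and> l ! i = x" using assms by (metis distinct_Ex1)
  from theI'[OF this] show "list_index l x < length l" "l ! list_index l x = x"
    by (simp_all add: list_index_def)
qed

lemma list_index_nth: "distinct l \<Longrightarrow> i < length l \<Longrightarrow> list_index l (l ! i) = i"
  using list_index[of l "l ! i"] nth_eq_iff_index_eq[of l] nth_mem by metis

text \<open>Sends a position in xs to the position of the same entry in the reference list l. It is
  the identity beyond the list, so that it is a permutation of the natural numbers.\<close>

definition sort_perm :: "'a list \<Rightarrow> 'a list \<Rightarrow> nat \<Rightarrow> nat" where
  "sort_perm l xs i = (if i < length xs then list_index l (xs ! i) else i)"

lemma sort_perm:
  assumes "distinct l" "distinct xs" "set xs = set l"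
  shows "sort_perm l xs permutes {..<length l}" "map (\<lambda>i. l ! sort_perm l xs i) [0..<length l] = xs"
proof -
  have len: "length xs = length l" using assms by (metis distinct_card)
  have ix: "list_index l (xs ! i) < length l" "l ! list_index l (xs ! i) = xs ! i" if "i < length l" for i
    using list_index[OF assms(1), of "xs ! i"] assms(3) len that nth_mem[of i xs] by auto
  have inj: "inj_on (sort_perm l xs) {..<length l}"
  proof (rule inj_onI)
    fix i j assume ij: "i \<in> {..<length l}" "j \<in> {..<length l}" "sort_perm l xs i = sort_perm l xs j"
    have "l ! sort_perm l xs k = xs ! k" if "k < length l" for k using ix(2)[OF that] that by (simp add: sort_perm_def len)
    hence "xs ! i = xs ! j" using ij by (metis lessThan_iff)
    thus "i = j" using ij len assms(2) by (simp add: nth_eq_iff_index_eq)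
  qed
  have "sort_perm l xs ` {..<length l} \<subseteq> {..<length l}" using ix len by (auto simp: sort_perm_def)
  hence "bij_betw (sort_perm l xs) {..<length l} {..<length l}"
    using inj by (simp add: bij_betw_def endo_inj_surj)
  thus "sort_perm l xs permutes {..<length l}"
    by (rule bij_imp_permutes) (simp add: sort_perm_def len)
  show "map (\<lambda>i. l ! sort_perm l xs i) [0..<length l] = xs"
    by (rule nth_equalityI) (auto simp: sort_perm_def len ix)
qed

lemma sort_perm_swap:
  assumes "i < j" "j < length xs"
  shows "sort_perm l (swap_nth i j xs) = sort_perm l xs \<circ> Transposition.transpose i j"
proof
  fix k
  have "Transposition.transpose i j k < length xs \<longleftrightarrow> k < length xs"
    using assms by (auto simp: Transposition.transpose_def)
  thus "sort_perm l (swap_nth i j xs) k = (sort_perm l xs \<circ> Transposition.transpose i j) k"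
    using assms by (auto simp: sort_perm_def nth_swap_nth)
qed

lemma sort_perm_self: "distinct l \<Longrightarrow> sort_perm l l = id"
  by (auto simp: sort_perm_def list_index_nth fun_eq_iff)

text \<open>
  \<open>F \<sigma> m\<close> is the space of sections of weight \<open>m\<close> on \<open>U\<^sub>\<sigma>\<close>.  The restriction to \<open>U\<^sub>\<tau>\<close> is the inclusion in
  the weights satisfying \<open>vis \<tau>\<close> and zero in the others; \<open>trans\<close> makes it functorial.
\<close>

locale cech_system =
  fixes \<Sigma> :: "(real ^ 'n::finite) set set"
    and F :: "(real ^ 'n) set \<Rightarrow> int ^ 'n \<Rightarrow> ('b \<Rightarrow> complex) set"
    and vis :: "(real ^ 'n) set \<Rightarrow> int ^ 'n \<Rightarrow> bool"
    and S :: "(real ^ 'n) set \<Rightarrow> ('n, 'b) chart_section set"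
    and R :: "(real ^ 'n) set \<Rightarrow> ('n, 'b) chart_section \<Rightarrow> ('n, 'b) chart_section"
  assumes fin: "finite \<Sigma>"
    and Inter_closed: "T \<subseteq> \<Sigma> \<Longrightarrow> T \<noteq> {} \<Longrightarrow> \<Inter>T \<in> \<Sigma>"
    and sub: "\<sigma> \<in> \<Sigma> \<Longrightarrow> fun_vs.subspace (F \<sigma> m)"
    and finite_dim: "\<sigma> \<in> \<Sigma> \<Longrightarrow> \<exists>T. finite T \<and> F \<sigma> m \<subseteq> fun_vs.span T"
    and S_def: "\<sigma> \<in> \<Sigma> \<Longrightarrow> S \<sigma> = {s. finite {m. \<exists>b. s (m, b) \<noteq> 0} \<and> (\<forall>m. (\<lambda>b. s (m, b)) \<in> F \<sigma> m)}"
    and R_def: "R \<tau> s = (\<lambda>(m, b). if vis \<tau> m then s (m, b) else 0)"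
    and restr: "\<sigma> \<in> \<Sigma> \<Longrightarrow> \<tau> \<in> \<Sigma> \<Longrightarrow> \<tau> \<subseteq> \<sigma> \<Longrightarrow> vis \<tau> m \<Longrightarrow> F \<sigma> m \<subseteq> F \<tau> m"
    and trans: "\<sigma> \<in> \<Sigma> \<Longrightarrow> \<tau> \<in> \<Sigma> \<Longrightarrow> \<kappa> \<in> \<Sigma> \<Longrightarrow> \<tau> \<subseteq> \<sigma> \<Longrightarrow> \<kappa> \<subseteq> \<tau> \<Longrightarrow> vis \<kappa> m \<Longrightarrow> w \<in> F \<sigma> m \<Longrightarrow> w \<noteq> 0 \<Longrightarrow> vis \<tau> m"
begin

abbreviation C where "C \<equiv> cech_cochains \<Sigma> S"
abbreviation D where "D \<equiv> cech_diff \<Sigma> R"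

lemma D_eq: "D q c (ss, m, b) = (if length ss = Suc (Suc q) \<and> set ss \<subseteq> \<Sigma> \<and> vis (\<Inter>(set ss)) m
     then \<Sum>j<Suc (Suc q). (-1) ^ j * c (del_nth j ss, m, b) else 0)"
  by (simp add: cech_diff_def R_def component_def del_nth_def)

lemma Inter_list: "set ss \<subseteq> \<Sigma> \<Longrightarrow> length ss = Suc q \<Longrightarrow> \<Inter>(set ss) \<in> \<Sigma>"
  by (rule Inter_closed) auto

text \<open>Separates the conditions weight by weight; finiteness of the support is the only one
  that links different weights.\<close>

lemma C_iff: "c \<in> C q \<longleftrightarrow>
   (\<forall>ss m. length ss = Suc q \<and> set ss \<subseteq> \<Sigma> \<longrightarrow> (\<lambda>b. c (ss, m, b)) \<in> F (\<Inter>(set ss)) m) \<and>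
   (\<forall>ss. length ss = Suc q \<and> set ss \<subseteq> \<Sigma> \<longrightarrow> finite {m. \<exists>b. c (ss, m, b) \<noteq> 0}) \<and>
   (\<forall>ss m b. \<not> (length ss = Suc q \<and> set ss \<subseteq> \<Sigma>) \<longrightarrow> c (ss, m, b) = 0) \<and>
   (\<forall>ss i j m b. i < j \<and> j < length ss \<longrightarrow> c (swap_nth i j ss, m, b) = - c (ss, m, b))"
proof -
  have 1: "(\<forall>ss. if length ss = Suc q \<and> set ss \<subseteq> \<Sigma> then component c ss \<in> S (\<Inter>(set ss)) else component c ss = 0) \<longleftrightarrow>
   (\<forall>ss m. length ss = Suc q \<and> set ss \<subseteq> \<Sigma> \<longrightarrow> (\<lambda>b. c (ss, m, b)) \<in> F (\<Inter>(set ss)) m) \<and>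
   (\<forall>ss. length ss = Suc q \<and> set ss \<subseteq> \<Sigma> \<longrightarrow> finite {m. \<exists>b. c (ss, m, b) \<noteq> 0}) \<and>
   (\<forall>ss m b. \<not> (length ss = Suc q \<and> set ss \<subseteq> \<Sigma>) \<longrightarrow> c (ss, m, b) = 0)"
  proof -
    have "component c ss \<in> S (\<Inter>(set ss)) \<longleftrightarrow> finite {m. \<exists>b. c (ss, m, b) \<noteq> 0} \<and> (\<forall>m. (\<lambda>b. c (ss, m, b)) \<in> F (\<Inter>(set ss)) m)"
      if "length ss = Suc q \<and> set ss \<subseteq> \<Sigma>" for ss
      using S_def[OF Inter_list] that by (simp add: component_def)
    moreover have "component c ss = 0 \<longleftrightarrow> (\<forall>m b. c (ss, m, b) = 0)" for ss
      by (auto simp: component_def fun_eq_iff)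
    ultimately have "(\<forall>ss. if length ss = Suc q \<and> set ss \<subseteq> \<Sigma> then component c ss \<in> S (\<Inter>(set ss)) else component c ss = 0) \<longleftrightarrow>
      (\<forall>ss. if length ss = Suc q \<and> set ss \<subseteq> \<Sigma>
         then finite {m. \<exists>b. c (ss, m, b) \<noteq> 0} \<and> (\<forall>m. (\<lambda>b. c (ss, m, b)) \<in> F (\<Inter>(set ss)) m)
         else (\<forall>m b. c (ss, m, b) = 0))"
      by (intro iff_allI) simp
    thus ?thesis unfolding if_bool_eq_conj by blast
  qed
  have 2: "(\<forall>ss i j. i < j \<and> j < length ss \<longrightarrow> component c (ss[i := ss ! j, j := ss ! i]) = - component c ss) \<longleftrightarrow>
     (\<forall>ss i j m b. i < j \<and> j < length ss \<longrightarrow> c (swap_nth i j ss, m, b) = - c (ss, m, b))"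
    by (simp add: component_def swap_nth_def fun_eq_iff)
  show ?thesis unfolding cech_cochains_def mem_Collect_eq 1 2 by blast
qed

lemma CD:
  assumes "c \<in> C q"
  shows "length ss = Suc q \<Longrightarrow> set ss \<subseteq> \<Sigma> \<Longrightarrow> (\<lambda>b. c (ss, m, b)) \<in> F (\<Inter>(set ss)) m"
    and "length ss = Suc q \<Longrightarrow> set ss \<subseteq> \<Sigma> \<Longrightarrow> finite {m. \<exists>b. c (ss, m, b) \<noteq> 0}"
    and "\<not> (length ss = Suc q \<and> set ss \<subseteq> \<Sigma>) \<Longrightarrow> c (ss, m, b) = 0"
    and "i < j \<Longrightarrow> j < length ss \<Longrightarrow> c (swap_nth i j ss, m, b) = - c (ss, m, b)"
  using assms unfolding C_iff by blast+

lemma subspace_C: "fun_vs.subspace (C q)"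
  unfolding fun_vs.subspace_def
proof (intro conjI ballI allI)
  show "0 \<in> C q"
    using fun_vs.subspace_0[OF sub[OF Inter_list]] unfolding C_iff by (simp add: zero_fun_def)
next
  fix x y assume x: "x \<in> C q" and y: "y \<in> C q"
  show "x + y \<in> C q"
    unfolding C_iff
  proof (intro conjI allI impI)
    fix ss m assume ss: "length ss = Suc q \<and> set ss \<subseteq> \<Sigma>"
    have "(\<lambda>b. x (ss, m, b)) + (\<lambda>b. y (ss, m, b)) \<in> F (\<Inter>(set ss)) m"
      using fun_vs.subspace_add[OF sub[OF Inter_list]] CD(1)[OF x] CD(1)[OF y] ss by blast
    thus "(\<lambda>b. (x + y) (ss, m, b)) \<in> F (\<Inter>(set ss)) m" by (simp add: plus_fun_def)
  next
    fix ss assume ss: "length ss = Suc q \<and> set ss \<subseteq> \<Sigma>"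
    have "finite ({m. \<exists>b. x (ss, m, b) \<noteq> 0} \<union> {m. \<exists>b. y (ss, m, b) \<noteq> 0})"
      using CD(2)[OF x] CD(2)[OF y] ss by simp
    thus "finite {m. \<exists>b. (x + y) (ss, m, b) \<noteq> 0}" by (rule finite_subset[rotated]) auto
  next
    fix ss :: "(real ^ 'n) set list" and m b assume "\<not> (length ss = Suc q \<and> set ss \<subseteq> \<Sigma>)"
    thus "(x + y) (ss, m, b) = 0" using CD(3)[OF x] CD(3)[OF y] by simp
  next
    fix ss :: "(real ^ 'n) set list" and i j m b assume "i < j \<and> j < length ss"
    thus "(x + y) (swap_nth i j ss, m, b) = - (x + y) (ss, m, b)" using CD(4)[OF x] CD(4)[OF y] by simp
  qed
next
  fix a x assume x: "x \<in> C q"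
  show "fscale a x \<in> C q"
    unfolding C_iff
  proof (intro conjI allI impI)
    fix ss m assume ss: "length ss = Suc q \<and> set ss \<subseteq> \<Sigma>"
    have "fscale a (\<lambda>b. x (ss, m, b)) \<in> F (\<Inter>(set ss)) m"
      using fun_vs.subspace_scale[OF sub[OF Inter_list]] CD(1)[OF x] ss by blast
    thus "(\<lambda>b. fscale a x (ss, m, b)) \<in> F (\<Inter>(set ss)) m" by (simp add: fscale_def)
  next
    fix ss assume ss: "length ss = Suc q \<and> set ss \<subseteq> \<Sigma>"
    show "finite {m. \<exists>b. fscale a x (ss, m, b) \<noteq> 0}"
      by (rule finite_subset[OF _ CD(2)[OF x, of ss]]) (use ss in \<open>auto simp: fscale_def\<close>)
  next
    fix ss :: "(real ^ 'n) set list" and m b assume "\<not> (length ss = Suc q \<and> set ss \<subseteq> \<Sigma>)"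
    thus "fscale a x (ss, m, b) = 0" using CD(3)[OF x] by (simp add: fscale_def)
  next
    fix ss :: "(real ^ 'n) set list" and i j m b assume "i < j \<and> j < length ss"
    thus "fscale a x (swap_nth i j ss, m, b) = - fscale a x (ss, m, b)" using CD(4)[OF x] by (simp add: fscale_def)
  qed
qed

lemma D_add: "D q (x + y) = D q x + D q y"
  by (auto simp: fun_eq_iff D_eq sum.distrib distrib_left)

lemma D_scale: "D q (fscale a x) = fscale a (D q x)"
  by (auto simp: fun_eq_iff D_eq fscale_def sum_distrib_left mult_ac simp del: sum.lessThan_Suc)

lemma D_0: "D q 0 = 0" using D_add[of q 0 0] by simp

lemma del_nth_props:
  assumes "length ss = Suc (Suc q)" "set ss \<subseteq> \<Sigma>" "j < Suc (Suc q)"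
  shows "length (del_nth j ss) = Suc q" "set (del_nth j ss) \<subseteq> \<Sigma>" "\<Inter>(set ss) \<subseteq> \<Inter>(set (del_nth j ss))"
  using assms set_del_nth[of j ss] by (auto simp: length_del_nth)

text \<open>Values stay in the right spaces by \<open>restr\<close>, which compares an intersection
  with the larger one obtained by deleting an entry.\<close>

lemma D_C:
  assumes c: "c \<in> C q" shows "D q c \<in> C (Suc q)"
  unfolding C_iff
proof (intro conjI allI impI)
  fix ss m assume ss: "length ss = Suc (Suc q) \<and> set ss \<subseteq> \<Sigma>"
  have \<tau>: "\<Inter>(set ss) \<in> \<Sigma>" using Inter_list ss by blast
  show "(\<lambda>b. D q c (ss, m, b)) \<in> F (\<Inter>(set ss)) m"
  proof (cases "vis (\<Inter>(set ss)) m")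
    case False
    thus ?thesis using fun_vs.subspace_0[OF sub[OF \<tau>]] by (simp add: D_eq zero_fun_def)
  next
    case True
    have "(\<lambda>b. c (del_nth j ss, m, b)) \<in> F (\<Inter>(set ss)) m" if j: "j < Suc (Suc q)" for j
    proof -
      note d = del_nth_props[OF conjunct1[OF ss] conjunct2[OF ss] j]
      show ?thesis using CD(1)[OF c d(1,2)] restr[OF Inter_list[OF d(2,1)] \<tau> d(3) True] by blast
    qed
    hence "(\<Sum>j<Suc (Suc q). fscale ((-1) ^ j) (\<lambda>b. c (del_nth j ss, m, b))) \<in> F (\<Inter>(set ss)) m"
      by (intro fun_vs.subspace_sum fun_vs.subspace_scale sub \<tau>) auto
    moreover have "(\<Sum>j<Suc (Suc q). fscale ((-1) ^ j) (\<lambda>b. c (del_nth j ss, m, b))) = (\<lambda>b. D q c (ss, m, b))"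
      using ss True by (auto simp: fun_eq_iff D_eq fscale_def sum_fun_apply)
    ultimately show ?thesis by simp
  qed
next
  fix ss assume ss: "length ss = Suc (Suc q) \<and> set ss \<subseteq> \<Sigma>"
  have "finite (\<Union>j<Suc (Suc q). {m. \<exists>b. c (del_nth j ss, m, b) \<noteq> 0})"
    using CD(2)[OF c] del_nth_props ss by blast
  moreover have "{m. \<exists>b. D q c (ss, m, b) \<noteq> 0} \<subseteq> (\<Union>j<Suc (Suc q). {m. \<exists>b. c (del_nth j ss, m, b) \<noteq> 0})"
  proof
    fix m assume "m \<in> {m. \<exists>b. D q c (ss, m, b) \<noteq> 0}"
    then obtain b where "D q c (ss, m, b) \<noteq> 0" by blast
    hence "(\<Sum>j<Suc (Suc q). (-1) ^ j * c (del_nth j ss, m, b)) \<noteq> 0" by (simp add: D_eq split: if_splits)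
    then obtain j where "j < Suc (Suc q)" "(-1) ^ j * c (del_nth j ss, m, b) \<noteq> 0"
      by (meson lessThan_iff sum.neutral)
    thus "m \<in> (\<Union>j<Suc (Suc q). {m. \<exists>b. c (del_nth j ss, m, b) \<noteq> 0})" by auto
  qed
  ultimately show "finite {m. \<exists>b. D q c (ss, m, b) \<noteq> 0}" by (rule finite_subset[rotated])
next
  fix ss :: "(real ^ 'n) set list" and m b assume "\<not> (length ss = Suc (Suc q) \<and> set ss \<subseteq> \<Sigma>)"
  thus "D q c (ss, m, b) = 0" by (auto simp: D_eq)
next
  fix ss :: "(real ^ 'n) set list" and i j :: nat and m b assume ij: "i < j \<and> j < length ss"
  show "D q c (swap_nth i j ss, m, b) = - D q c (ss, m, b)"
  proof (rule alternating_from_adjacent[of "\<lambda>ss. D q c (ss, m, b)", OF _ conjunct1[OF ij] conjunct2[OF ij]])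
    fix ss :: "(real ^ 'n) set list" and i assume i: "Suc i < length ss"
    let ?ss = "swap_nth i (Suc i) ss" and ?t = "Transposition.transpose i (Suc i)"
    have set: "set ?ss = set ss" using i by (simp add: set_swap_nth)
    show "D q c (?ss, m, b) = - D q c (ss, m, b)"
    proof (cases "length ss = Suc (Suc q)")
      case True
      \<comment> \<open>The swap permutes the summands. Deleting another entry leaves an adjacent
        swap in the list, and c changes sign; deleting one of the two swapped entries shifts the
        index j, and the power of -1 changes sign.\<close>
      have "(-1) ^ j * c (del_nth j ?ss, m, b) = - ((-1) ^ ?t j * c (del_nth (?t j) ss, m, b))"
        if j: "j < Suc (Suc q)" for j
      proof -
        have l: "length (del_nth j ss) = Suc q" using True j by (simp add: length_del_nth)
        consider "j < i" | "j = i" | "j = Suc i" | "Suc i < j" by linarith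
        thus ?thesis
        proof cases
          case 1
          thus ?thesis using CD(4)[OF c, of "i - 1" i "del_nth j ss"] i l True
            by (simp add: del_nth_swap_before Transposition.transpose_def)
        next
          case 2 thus ?thesis using i by (simp add: del_nth_swap_same Transposition.transpose_def)
        next
          case 3 thus ?thesis using i by (simp add: del_nth_swap_same Transposition.transpose_def)
        next
          case 4
          thus ?thesis using CD(4)[OF c, of i "Suc i" "del_nth j ss"] i l True j
            by (simp add: del_nth_swap_after Transposition.transpose_def)
        qed
      qed
      hence "(\<Sum>j<Suc (Suc q). (-1) ^ j * c (del_nth j ?ss, m, b)) =
          (\<Sum>j<Suc (Suc q). - ((-1) ^ ?t j * c (del_nth (?t j) ss, m, b)))"
        by (intro sum.cong) auto
      also have "\<dots> = - (\<Sum>j<Suc (Suc q). (-1) ^ ?t j * c (del_nth (?t j) ss, m, b))"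
        by (simp only: sum_negf)
      also have "(\<Sum>j<Suc (Suc q). (-1) ^ ?t j * c (del_nth (?t j) ss, m, b)) =
          (\<Sum>j<Suc (Suc q). (-1) ^ j * c (del_nth j ss, m, b))"
        using sum.permute[OF permutes_swap_id[of i "{..<Suc (Suc q)}" "Suc i"], of "\<lambda>j. (-1) ^ j * c (del_nth j ss, m, b)"] i True
        by (simp only: comp_def) auto
      finally show ?thesis using True by (simp add: D_eq set del: sum.lessThan_Suc)
    qed (simp add: D_eq)
  qed
qed

lemma D_D:
  assumes c: "c \<in> C q" shows "D (Suc q) (D q c) = 0"
proof
  fix x :: "(real ^ 'n) set list \<times> (int ^ 'n) \<times> 'b"
  obtain ss m b where x: "x = (ss, m, b)" by (cases x)
  let ?n = "Suc (Suc q)"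
  show "D (Suc q) (D q c) x = 0 x"
  proof (cases "length ss = Suc ?n \<and> set ss \<subseteq> \<Sigma> \<and> vis (\<Inter>(set ss)) m")
    case False
    thus ?thesis by (auto simp: x D_eq)
  next
    case True
    hence ss: "length ss = Suc ?n" "set ss \<subseteq> \<Sigma>" "vis (\<Inter>(set ss)) m" by auto
    let ?g = "\<lambda>j k. (-1) ^ (j + k) * c (del_nth k (del_nth j ss), m, b)"
    have inner: "(-1) ^ j * D q c (del_nth j ss, m, b) = (\<Sum>k<?n. ?g j k)" if j: "j < Suc ?n" for j
    proof -
      note d = del_nth_props[OF ss(1,2) j]
      \<comment> \<open>The inner differential is cut off when m is not visible on the intermediate
        intersection. By \<open>trans\<close> those terms vanish anyway, since m is visible on the
        smallest intersection.\<close>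
      have "c (del_nth k (del_nth j ss), m, b) = 0" if nv: "\<not> vis (\<Inter>(set (del_nth j ss))) m" and k: "k < ?n" for k
      proof -
        note e = del_nth_props[OF d(1,2) k]
        have "(\<lambda>b. c (del_nth k (del_nth j ss), m, b)) = 0"
          using trans[OF Inter_list[OF e(2,1)] Inter_list[OF d(2,1)] Inter_list[OF ss(2,1)] e(3) d(3) ss(3) CD(1)[OF c e(1,2)]] nv
          by blast
        thus ?thesis by (simp add: fun_eq_iff)
      qed
      hence "D q c (del_nth j ss, m, b) = (\<Sum>k<?n. (-1) ^ k * c (del_nth k (del_nth j ss), m, b))"
        using d by (auto simp: D_eq simp del: sum.lessThan_Suc)
      thus ?thesis by (simp add: sum_distrib_left power_add mult.assoc del: sum.lessThan_Suc)
    qed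
    let ?A = "{(j, k). j < Suc ?n \<and> k < ?n \<and> k < j}" and ?B = "{(j, k). j < Suc ?n \<and> k < ?n \<and> j \<le> k}"
    have fA: "finite ?A" and fB: "finite ?B"
      by (rule finite_subset[of _ "{..<Suc ?n} \<times> {..<?n}"]; auto)+
    have "D (Suc q) (D q c) x = (\<Sum>j<Suc ?n. (-1) ^ j * D q c (del_nth j ss, m, b))"
      using ss by (simp add: x D_eq[of "Suc q"] del: sum.lessThan_Suc)
    also have "\<dots> = (\<Sum>j<Suc ?n. \<Sum>k<?n. ?g j k)"
      using inner by (intro sum.cong) auto
    also have "\<dots> = (\<Sum>(j, k)\<in>{..<Suc ?n} \<times> {..<?n}. ?g j k)" by (rule sum.cartesian_product)
    also have "{..<Suc ?n} \<times> {..<?n} = ?A \<union> ?B" by auto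
    also have "(\<Sum>(j, k)\<in>?A \<union> ?B. ?g j k) = (\<Sum>(j, k)\<in>?A. ?g j k) + (\<Sum>(j, k)\<in>?B. ?g j k)"
      by (rule sum.union_disjoint[OF fA fB]) auto
    \<comment> \<open>Deleting j and then k, with j \<le> k, is the same as deleting k + 1 and then
      j; the total exponents differ by one.\<close>
    also have "(\<Sum>(j, k)\<in>?B. ?g j k) = (\<Sum>(j, k)\<in>?A. - ?g j k)"
    proof (rule sum.reindex_bij_witness[of _ "\<lambda>(j, k). (k, j - 1)" "\<lambda>(j, k). (Suc k, j)"])
      fix p assume "p \<in> ?B"
      then obtain j k where p: "p = (j, k)" "j \<le> k" "k < ?n" by blast
      have "del_nth k (del_nth j ss) = del_nth j (del_nth (Suc k) ss)"
        using del_nth_del_nth[OF p(2), of ss] p(3) ss(1) by simp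
      thus "(case case p of (j, k) \<Rightarrow> (Suc k, j) of (j, k) \<Rightarrow> - ?g j k) = (case p of (j, k) \<Rightarrow> ?g j k)"
        by (simp add: p add.commute)
    qed auto
    finally show ?thesis by (simp add: sum_negf case_prod_unfold)
  qed
qed

lemma C_repeated:
  assumes c: "c \<in> C q" and "\<not> distinct ss" shows "c (ss, m, b) = 0"
proof -
  obtain i j where ij: "i < length ss" "j < length ss" "i \<noteq> j" "ss ! i = ss ! j"
    using assms(2) distinct_conv_nth by blast
  define x y where "x = min i j" and "y = max i j"
  have xy: "x < y" "y < length ss" "ss ! x = ss ! y" using ij by (auto simp: x_def y_def min_def max_def)
  have "ss[x := ss ! y] = ss" "ss[y := ss ! x] = ss" using xy(3) by (metis list_update_id)+
  hence "swap_nth x y ss = ss" by (simp add: swap_nth_def)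
  thus ?thesis using CD(4)[OF c xy(1,2), of m b] by simp
qed

lemma C_large:
  assumes c: "c \<in> C q" and "card \<Sigma> \<le> q" shows "c = 0"
proof
  fix x :: "(real ^ 'n) set list \<times> (int ^ 'n) \<times> 'b"
  obtain ss m b where x: "x = (ss, m, b)" by (cases x)
  have "c (ss, m, b) = 0"
  proof (cases "distinct ss \<and> set ss \<subseteq> \<Sigma>")
    case True
    hence "length ss \<le> card \<Sigma>" using card_mono[OF fin, of "set ss"] distinct_card by metis
    thus ?thesis using CD(3)[OF c] assms(2) by simp
  qed (use C_repeated[OF c] CD(3)[OF c] in blast)
  thus "c x = 0 x" by (simp add: x)
qed

end

subsection \<open>Weights and the Euler characteristic of the Cech complex\<close>

lemma character_torus_inv: "t \<in> torus \<Longrightarrow> character m (torus_inv t) = character (- m) t"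
  by (simp add: character_def torus_inv_def power_int_minus power_int_inverse)

lemma character_separates:
  assumes "m \<noteq> m'" shows "\<exists>t\<in>torus. character m t \<noteq> character m' t"
proof -
  obtain i where i: "m $ i \<noteq> m' $ i" using assms by (auto simp: vec_eq_iff)
  \<comment> \<open>The integer powers of 2 are distinct, so this t sees the coordinate in which m
    and m' differ.\<close>
  define t :: "complex ^ 'a" where "t = (\<chi> k. if k = i then 2 else 1)"
  have ch: "character n t = 2 powi (n $ i)" for n
  proof -
    have "character n t = (\<Prod>k\<in>UNIV. if k = i then 2 powi (n $ i) else 1)"
      unfolding character_def t_def by (intro prod.cong) auto
    thus ?thesis by simp
  qed
  have lt: "(2::complex) powi a \<noteq> 2 powi b" if "a < b" for a b
  proof
    assume "(2::complex) powi a = 2 powi b"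
    hence "norm ((2::complex) powi a) = norm ((2::complex) powi b)" by simp
    hence "(2::real) powi a = 2 powi b" by (simp add: norm_power_int)
    thus False using power_int_strict_increasing[OF that, of "2::real"] by simp
  qed
  have "character m t \<noteq> character m' t"
    using i lt[of "m $ i" "m' $ i"] lt[of "m' $ i" "m $ i"] unfolding ch by (metis linorder_neqE)
  moreover have "t \<in> torus" by (simp add: torus_def t_def)
  ultimately show ?thesis by blast
qed

text \<open>Projection to the terms in \<chi>^m. The torus acts on its image through the character
  of -m.\<close>

definition wt :: "int ^ 'n \<Rightarrow> ('n::finite, 'b) cochain \<Rightarrow> ('n, 'b) cochain" where
  "wt m c = (\<lambda>(ss, m', b). if m' = m then c (ss, m', b) else 0)"

lemma wt_apply: "wt m c (ss, m', b) = (if m' = m then c (ss, m', b) else 0)"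
  by (simp add: wt_def)

lemma wt_add: "wt m (x + y) = wt m x + wt m y"
  and wt_diff: "wt m (x - y) = wt m x - wt m y"
  and wt_scale: "wt m (fscale a x) = fscale a (wt m x)"
  and wt_wt: "wt m (wt m' x) = (if m = m' then wt m x else 0)"
  and wt_act: "wt m (cochain_act t x) = fscale (character m (torus_inv t)) (wt m x)"
  by (auto simp: wt_def fun_eq_iff fscale_def cochain_act_def)

lemma wt_0 [simp]: "wt m 0 = 0" by (auto simp: wt_def fun_eq_iff)

context cech_system
begin

abbreviation Z where "Z \<equiv> cech_cocycles \<Sigma> S R"
abbreviation B where "B \<equiv> cech_coboundaries \<Sigma> S R"

lemma Z_iff: "c \<in> Z q \<longleftrightarrow> c \<in> C q \<and> D q c = 0" by (simp add: cech_cocycles_def)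

lemma B_eq: "B q = (if q = 0 then {0} else D (q - 1) ` C (q - 1))" by (simp add: cech_coboundaries_def)

lemma subspace_Z: "fun_vs.subspace (Z q)"
  using subspace_C[of q] unfolding fun_vs.subspace_def by (simp add: Z_iff D_add D_scale D_0)

lemma subspace_B: "fun_vs.subspace (B q)"
proof (cases "q = 0")
  case True
  thus ?thesis by (simp add: B_eq fun_vs.subspace_def fscale_def fun_eq_iff)
next
  case False
  have "fun_vs.subspace (D (q - 1) ` C (q - 1))"
    unfolding fun_vs.subspace_def
  proof (intro conjI ballI allI)
    show "0 \<in> D (q - 1) ` C (q - 1)" using fun_vs.subspace_0[OF subspace_C] D_0 by (metis image_eqI)
    show "x + y \<in> D (q - 1) ` C (q - 1)" if "x \<in> D (q - 1) ` C (q - 1)" "y \<in> D (q - 1) ` C (q - 1)" for x y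
      using that fun_vs.subspace_add[OF subspace_C] by (auto simp: D_add[symmetric])
    show "fscale a x \<in> D (q - 1) ` C (q - 1)" if "x \<in> D (q - 1) ` C (q - 1)" for a x
      using that fun_vs.subspace_scale[OF subspace_C] by (auto simp: D_scale[symmetric])
  qed
  thus ?thesis using False by (simp add: B_eq)
qed

lemma B_sub_Z: "B q \<subseteq> Z q"
proof (cases q)
  case 0
  thus ?thesis using fun_vs.subspace_0[OF subspace_Z] by (simp add: B_eq)
next
  case (Suc k)
  thus ?thesis using D_C[of _ k] D_D[of _ k] by (auto simp: B_eq Z_iff)
qed

lemma wt_C: assumes c: "c \<in> C q" shows "wt m c \<in> C q"
  unfolding C_iff
proof (intro conjI allI impI)
  fix ss m' assume ss: "length ss = Suc q \<and> set ss \<subseteq> \<Sigma>"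
  show "(\<lambda>b. wt m c (ss, m', b)) \<in> F (\<Inter>(set ss)) m'"
    using CD(1)[OF c, of ss m'] ss fun_vs.subspace_0[OF sub[OF Inter_list], of ss q m']
    by (cases "m' = m") (simp_all add: wt_apply zero_fun_def)
next
  fix ss assume ss: "length ss = Suc q \<and> set ss \<subseteq> \<Sigma>"
  show "finite {m'. \<exists>b. wt m c (ss, m', b) \<noteq> 0}"
    by (rule finite_subset[of _ "{m}"]) (auto simp: wt_apply)
next
  fix ss :: "(real ^ 'n) set list" and m' b assume "\<not> (length ss = Suc q \<and> set ss \<subseteq> \<Sigma>)"
  thus "wt m c (ss, m', b) = 0" using CD(3)[OF c] by (simp add: wt_apply)
next
  fix ss :: "(real ^ 'n) set list" and i j m' b assume "i < j \<and> j < length ss"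
  thus "wt m c (swap_nth i j ss, m', b) = - wt m c (ss, m', b)" using CD(4)[OF c] by (simp add: wt_apply)
qed

lemma wt_D: "wt m (D q c) = D q (wt m c)"
  by (auto simp: fun_eq_iff wt_apply D_eq simp del: sum.lessThan_Suc)

lemma wt_Z: "c \<in> Z q \<Longrightarrow> wt m c \<in> Z q"
  using wt_C wt_D[of m q c] by (simp add: Z_iff)

lemma wt_B: "c \<in> B q \<Longrightarrow> wt m c \<in> B q"
  using wt_C by (auto simp: B_eq wt_D split: if_splits)

lemma finite_supp:
  assumes c: "c \<in> C q" shows "finite {m. wt m c \<noteq> 0}"
proof -
  let ?L = "{ss. set ss \<subseteq> \<Sigma> \<and> length ss = Suc q}"
  have "finite ?L" using finite_lists_length_eq[OF fin] .
  hence "finite (\<Union>ss\<in>?L. {m. \<exists>b. c (ss, m, b) \<noteq> 0})" using CD(2)[OF c] by blast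
  moreover have "{m. wt m c \<noteq> 0} \<subseteq> (\<Union>ss\<in>?L. {m. \<exists>b. c (ss, m, b) \<noteq> 0})"
  proof
    fix m assume "m \<in> {m. wt m c \<noteq> 0}"
    then obtain ss m' b where "wt m c (ss, m', b) \<noteq> 0" by (auto simp: fun_eq_iff)
    hence n: "c (ss, m, b) \<noteq> 0" by (auto simp: wt_apply split: if_splits)
    hence "ss \<in> ?L" using CD(3)[OF c] by blast
    thus "m \<in> (\<Union>ss\<in>?L. {m. \<exists>b. c (ss, m, b) \<noteq> 0})" using n by blast
  qed
  ultimately show ?thesis by (rule finite_subset[rotated])
qed

text \<open>With a = 1 this is the decomposition into weights; with character values for a it writes
  the torus action as a combination of weight projections.\<close>

lemma wt_decomp:
  fixes c :: "('n, 'b) cochain"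
  assumes "finite {m. wt m c \<noteq> 0}"
  shows "(\<lambda>(ss, m, b). a m * c (ss, m, b)) = (\<Sum>m | wt m c \<noteq> 0. fscale (a m) (wt m c))"
proof
  fix x :: "(real ^ 'n) set list \<times> (int ^ 'n) \<times> 'b"
  obtain ss m b where x: "x = (ss, m, b)" by (cases x)
  have "(\<Sum>m | wt m c \<noteq> 0. fscale (a m) (wt m c)) x = (\<Sum>m' | wt m' c \<noteq> 0. if m' = m then a m * c (ss, m, b) else 0)"
    unfolding sum_fun_apply x by (intro sum.cong) (auto simp: wt_apply fscale_def)
  also have "\<dots> = a m * c (ss, m, b)"
  proof (cases "wt m c = 0")
    case True
    have "c (ss, m, b) = wt m c (ss, m, b)" by (simp add: wt_apply)
    hence "c (ss, m, b) = 0" using True by simp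
    thus ?thesis using assms True by simp
  qed (use assms in simp)
  finally show "(case x of (ss, m, b) \<Rightarrow> a m * c (ss, m, b)) = (\<Sum>m | wt m c \<noteq> 0. fscale (a m) (wt m c)) x"
    by (simp add: x)
qed

definition Cw where "Cw q m = {c \<in> C q. wt m c = c}"

lemma subspace_Cw: "fun_vs.subspace (Cw q m)"
  using subspace_C[of q] unfolding fun_vs.subspace_def Cw_def
  by (auto simp: wt_add wt_scale)

text \<open>\<open>weight_dim\<close> demands an eigenvector only modulo coboundaries. If m'
  \<noteq> -m, some t has different character values for -m' and m; projecting the condition for
  this t to m' shows that the m'-component of w is a coboundary. Only the component at -m survives
  in the class.\<close>

lemma weight_space:
  "{w \<in> Z q. \<forall>t\<in>torus. cochain_act t w - fscale (character m t) w \<in> B q} =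
   {x + y | x y. x \<in> Z q \<inter> Cw q (- m) \<and> y \<in> B q}"
proof (intro set_eqI iffI)
  fix w assume "w \<in> {x + y | x y. x \<in> Z q \<inter> Cw q (- m) \<and> y \<in> B q}"
  then obtain x y where w: "w = x + y" "x \<in> Z q" "x \<in> Cw q (- m)" "y \<in> B q" by blast
  have yC: "y \<in> C q" using w(4) B_sub_Z Z_iff by blast
  have "cochain_act t w - fscale (character m t) w \<in> B q" if t: "t \<in> torus" for t
  proof -
    have "cochain_act t x = cochain_act t (wt (- m) x)" using w(3) by (simp add: Cw_def)
    also have "\<dots> = fscale (character m t) (wt (- m) x)"
      using character_torus_inv[OF t, of "- m"] by (auto simp: fun_eq_iff cochain_act_def wt_def fscale_def)
    also have "\<dots> = fscale (character m t) x" using w(3) by (simp add: Cw_def)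
    finally have x: "cochain_act t x = fscale (character m t) x" .
    \<comment> \<open>Coboundaries are stable under the weight projections, hence under the
      torus.\<close>
    have "cochain_act t y \<in> B q"
      unfolding cochain_act_def wt_decomp[OF finite_supp[OF yC]]
      using w(4) by (intro fun_vs.subspace_sum[OF subspace_B] fun_vs.subspace_scale[OF subspace_B] wt_B)
    moreover have "cochain_act t w - fscale (character m t) w = cochain_act t y - fscale (character m t) y"
      using x by (auto simp: w(1) fun_eq_iff cochain_act_def fscale_def algebra_simps)
    ultimately show ?thesis
      using w(4) fun_vs.subspace_diff[OF subspace_B] fun_vs.subspace_scale[OF subspace_B] by metis
  qed
  moreover have "w \<in> Z q" using w B_sub_Z fun_vs.subspace_add[OF subspace_Z] by blast
  ultimately show "w \<in> {w \<in> Z q. \<forall>t\<in>torus. cochain_act t w - fscale (character m t) w \<in> B q}" by blast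
next
  fix w assume "w \<in> {w \<in> Z q. \<forall>t\<in>torus. cochain_act t w - fscale (character m t) w \<in> B q}"
  hence w: "w \<in> Z q" "\<And>t. t \<in> torus \<Longrightarrow> cochain_act t w - fscale (character m t) w \<in> B q" by auto
  have wC: "w \<in> C q" using w Z_iff by blast
  note fs = finite_supp[OF wC]
  have inB: "wt m' w \<in> B q" if m': "m' \<noteq> - m" for m'
  proof -
    have "- m' \<noteq> m" using m' by auto
    then obtain t where t: "t \<in> torus" "character (- m') t \<noteq> character m t"
      using character_separates[of "- m'" m] by blast
    let ?d = "character m' (torus_inv t) - character m t"
    have d: "?d \<noteq> 0" using t character_torus_inv[OF t(1), of m'] by simp
    have "wt m' (cochain_act t w - fscale (character m t) w) = fscale ?d (wt m' w)"
      by (simp add: wt_diff wt_act wt_scale fun_vs.scale_left_diff_distrib)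
    hence "fscale ?d (wt m' w) \<in> B q" using wt_B[OF w(2)[OF t(1)], of m'] by simp
    hence "fscale (1 / ?d) (fscale ?d (wt m' w)) \<in> B q" by (rule fun_vs.subspace_scale[OF subspace_B])
    thus ?thesis using d by (simp add: fscale_def)
  qed
  define y where "y = (\<Sum>m'\<in>{m'. wt m' w \<noteq> 0} - {- m}. wt m' w)"
  have "y \<in> B q" unfolding y_def using inB by (intro fun_vs.subspace_sum[OF subspace_B]) auto
  moreover have "w = wt (- m) w + y"
  proof -
    have "w = (\<Sum>m' | wt m' w \<noteq> 0. wt m' w)"
      using wt_decomp[OF fs, of "\<lambda>_. 1"] by (simp add: fscale_def)
    also have "\<dots> = wt (- m) w + y"
      unfolding y_def using fs by (cases "wt (- m) w = 0") (simp_all add: sum.remove[of _ "- m"])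
    finally show ?thesis .
  qed
  moreover have "wt (- m) w \<in> Z q \<inter> Cw q (- m)"
    using wt_Z[OF w(1)] wt_C[OF wC] by (simp add: Cw_def wt_wt)
  ultimately show "w \<in> {x + y | x y. x \<in> Z q \<inter> Cw q (- m) \<and> y \<in> B q}" by blast
qed

text \<open>An alternating cochain is determined by its values on one ordering of each set of cones.\<close>

lemma dim_Cw:
  "fun_vs.dim (Cw q m) = (\<Sum>T | T \<subseteq> \<Sigma> \<and> card T = Suc q. fun_vs.dim (F (\<Inter>T) m)) \<and>
   (\<exists>X. finite X \<and> Cw q m \<subseteq> fun_vs.span X)"
proof -
  let ?T = "{T. T \<subseteq> \<Sigma> \<and> card T = Suc q}"
  have fT: "finite ?T" using fin by simp
  have TS: "\<Inter>T \<in> \<Sigma>" if "T \<in> ?T" for T using Inter_closed[of T] that by fastforce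
  have lT: "set (enum_list T) = T" "distinct (enum_list T)" "length (enum_list T) = Suc q" if "T \<in> ?T" for T
    using enum_list[of T] that fin finite_subset by auto
  have "\<forall>T\<in>?T. \<exists>X. finite X \<and> fun_vs.independent X \<and> fun_vs.span X = F (\<Inter>T) m"
  proof
    fix T assume T: "T \<in> ?T"
    obtain X where X: "X \<subseteq> F (\<Inter>T) m" "fun_vs.independent X" "F (\<Inter>T) m \<subseteq> fun_vs.span X"
      "card X = fun_vs.dim (F (\<Inter>T) m)"
      by (rule fun_vs.basis_exists)
    obtain Y where "finite Y" "F (\<Inter>T) m \<subseteq> fun_vs.span Y" using finite_dim[OF TS[OF T]] by blast
    hence "finite X" using fun_vs.finite_independent_in_span X by blast
    moreover have "fun_vs.span X = F (\<Inter>T) m"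
      using X sub[OF TS[OF T]] by (simp add: fun_vs.span_minimal subset_antisym)
    ultimately show "\<exists>X. finite X \<and> fun_vs.independent X \<and> fun_vs.span X = F (\<Inter>T) m" using X by blast
  qed
  from bchoice[OF this] obtain Bs where
    Bs': "\<forall>T\<in>?T. finite (Bs T) \<and> fun_vs.independent (Bs T) \<and> fun_vs.span (Bs T) = F (\<Inter>T) m" ..
  have Bs: "finite (Bs T)" "fun_vs.independent (Bs T)" "fun_vs.span (Bs T) = F (\<Inter>T) m" if "T \<in> ?T" for T
    using bspec[OF Bs' that, THEN conjunct1] bspec[OF Bs' that, THEN conjunct2, THEN conjunct1]
      bspec[OF Bs' that, THEN conjunct2, THEN conjunct2] .
  let ?I = "Sigma ?T Bs"
  have fI: "finite ?I" by (intro finite_SigmaI fT Bs(1))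
  \<comment> \<open>Elementary cochains: w on the reference ordering of T, w times the sign of the
    reordering on the other orderings of T, zero elsewhere.\<close>
  define e where "e = (\<lambda>(T, w) (ss :: (real ^ 'n) set list, m' :: int ^ 'n, b :: 'b).
     if set ss = T \<and> length ss = Suc q \<and> m' = m then of_int (sign (sort_perm (enum_list T) ss)) * w b else (0::complex))"
  have e_apply: "e (T, w) (ss, m', b) =
     (if set ss = T \<and> length ss = Suc q \<and> m' = m then of_int (sign (sort_perm (enum_list T) ss)) * w b else 0)" for T w ss m' b
    by (simp add: e_def)
  have e_self: "e (T, w) (enum_list T', m, b) = (if T = T' then w b else 0)" if "T' \<in> ?T" for T T' w b
    using lT[OF that] by (auto simp: e_apply sort_perm_self sign_id)
  have eC: "e (T, w) \<in> Cw q m" if T: "T \<in> ?T" and w: "w \<in> Bs T" for T w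
  proof -
    have wF: "w \<in> F (\<Inter>T) m" using Bs(3)[OF T] w fun_vs.span_base by blast
    have "e (T, w) \<in> C q"
      unfolding C_iff
    proof (intro conjI allI impI)
      fix ss m' assume ss: "length ss = Suc q \<and> set ss \<subseteq> \<Sigma>"
      show "(\<lambda>b. e (T, w) (ss, m', b)) \<in> F (\<Inter>(set ss)) m'"
      proof (cases "set ss = T \<and> m' = m")
        case True
        have "fscale (of_int (sign (sort_perm (enum_list T) ss))) w \<in> F (\<Inter>T) m"
          using wF fun_vs.subspace_scale[OF sub[OF TS[OF T]]] by blast
        thus ?thesis using True ss by (simp add: e_apply fscale_def)
      next
        case False
        hence "(\<lambda>b. e (T, w) (ss, m', b)) = 0" by (auto simp: e_apply fun_eq_iff)
        thus ?thesis using fun_vs.subspace_0[OF sub[OF Inter_list]] ss by simp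
      qed
    next
      fix ss assume "length ss = Suc q \<and> set ss \<subseteq> \<Sigma>"
      show "finite {m'. \<exists>b. e (T, w) (ss, m', b) \<noteq> 0}"
        by (rule finite_subset[of _ "{m}"]) (auto simp: e_apply)
    next
      fix ss :: "(real ^ 'n) set list" and m' b assume "\<not> (length ss = Suc q \<and> set ss \<subseteq> \<Sigma>)"
      thus "e (T, w) (ss, m', b) = 0" using T by (auto simp: e_apply)
    next
      fix ss :: "(real ^ 'n) set list" and i j m' b assume ij: "i < j \<and> j < length ss"
      show "e (T, w) (swap_nth i j ss, m', b) = - e (T, w) (ss, m', b)"
      proof (cases "set ss = T \<and> length ss = Suc q")
        case True
        have d: "distinct ss" using True T by (simp add: card_distinct)
        have p: "sort_perm (enum_list T) ss permutes {..<length (enum_list T)}"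
          using sort_perm(1)[OF lT(2)[OF T] d] True lT(1)[OF T] by simp
        have "sign (sort_perm (enum_list T) ss \<circ> Transposition.transpose i j) = - sign (sort_perm (enum_list T) ss)"
          using ij permutes_imp_permutation[OF _ p]
          by (simp add: sign_compose sign_swap_id permutation_swap_id)
        thus ?thesis using ij True by (simp add: e_apply set_swap_nth sort_perm_swap)
      qed (use ij in \<open>auto simp: e_apply set_swap_nth\<close>)
    qed
    moreover have "wt m (e (T, w)) = e (T, w)" by (auto simp: wt_def e_def fun_eq_iff)
    ultimately show ?thesis by (simp add: Cw_def)
  qed
  \<comment> \<open>Evaluation on the reference ordering of T' annihilates all elementary cochains
    that belong to other sets.\<close>
  have fam: "\<forall>a. (\<Sum>i\<in>?I. fscale (a i) (e i)) = 0 \<longrightarrow> (\<forall>i\<in>?I. a i = 0)"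
  proof (intro allI impI ballI)
    fix a i assume a: "(\<Sum>i\<in>?I. fscale (a i) (e i)) = 0" and i: "i \<in> ?I"
    obtain T' w' where i': "i = (T', w')" "T' \<in> ?T" "w' \<in> Bs T'" using i by blast
    have "(\<Sum>w\<in>Bs T'. fscale (a (T', w)) w) = 0"
    proof
      fix b
      have "0 = (\<Sum>i\<in>?I. fscale (a i) (e i)) (enum_list T', m, b)" using a by simp
      also have "\<dots> = (\<Sum>T\<in>?T. \<Sum>w\<in>Bs T. a (T, w) * e (T, w) (enum_list T', m, b))"
        using fT Bs(1) by (subst sum.Sigma) (auto simp: sum_fun_apply fscale_def intro!: sum.cong)
      also have "\<dots> = (\<Sum>T\<in>?T. if T = T' then \<Sum>w\<in>Bs T'. a (T', w) * w b else 0)"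
        by (intro sum.cong refl) (simp add: e_self[OF i'(2)])
      also have "\<dots> = (\<Sum>w\<in>Bs T'. a (T', w) * w b)" using fT i'(2) by (subst sum.delta) auto
      finally show "(\<Sum>w\<in>Bs T'. fscale (a (T', w)) w) b = 0 b" by (simp add: sum_fun_apply fscale_def)
    qed
    thus "a i = 0"
      using fun_vs.independentD[OF Bs(2)[OF i'(2)] Bs(1)[OF i'(2)] subset_refl, of "\<lambda>w. a (T', w)"] i' by blast
  qed
  have sub1: "e ` ?I \<subseteq> Cw q m" using eC by blast
  have sub2: "Cw q m \<subseteq> fun_vs.span (e ` ?I)"
  proof
    fix c assume "c \<in> Cw q m"
    hence c: "c \<in> C q" "wt m c = c" by (auto simp: Cw_def)
    have "\<forall>T\<in>?T. \<exists>a. (\<lambda>b. c (enum_list T, m, b)) = (\<Sum>w\<in>Bs T. fscale (a w) w)"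
    proof
      fix T assume T: "T \<in> ?T"
      have "(\<lambda>b. c (enum_list T, m, b)) \<in> fun_vs.span (Bs T)"
        using CD(1)[OF c(1), of "enum_list T" m] lT[OF T] T Bs(3)[OF T] by simp
      thus "\<exists>a. (\<lambda>b. c (enum_list T, m, b)) = (\<Sum>w\<in>Bs T. fscale (a w) w)"
        using fun_vs.span_finite[OF Bs(1)[OF T]] by auto
    qed
    from bchoice[OF this] obtain a where
      a: "\<forall>T\<in>?T. (\<lambda>b. c (enum_list T, m, b)) = (\<Sum>w\<in>Bs T. fscale (a T w) w)" ..
    have aev: "c (enum_list T, m, b) = (\<Sum>w\<in>Bs T. a T w * w b)" if "T \<in> ?T" for T b
    proof -
      have "c (enum_list T, m, b) = (\<Sum>w\<in>Bs T. fscale (a T w) w) b" using bspec[OF a that] by (rule fun_cong)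
      thus ?thesis by (simp add: sum_fun_apply fscale_def)
    qed
    have "c = (\<Sum>i\<in>?I. fscale (case i of (T, w) \<Rightarrow> a T w) (e i))"
    proof
      fix x :: "(real ^ 'n) set list \<times> (int ^ 'n) \<times> 'b"
      obtain ss m' b where x: "x = (ss, m', b)" by (cases x)
      have "(\<Sum>i\<in>?I. fscale (case i of (T, w) \<Rightarrow> a T w) (e i)) x = (\<Sum>T\<in>?T. \<Sum>w\<in>Bs T. a T w * e (T, w) x)"
        using fT Bs(1) by (subst sum.Sigma) (auto simp: sum_fun_apply fscale_def intro!: sum.cong)
      also have "\<dots> = c x"
      proof (cases "m' = m \<and> length ss = Suc q \<and> distinct ss \<and> set ss \<subseteq> \<Sigma>")
        case True
        let ?T' = "set ss" and ?p = "sort_perm (enum_list (set ss)) ss"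
        have T': "?T' \<in> ?T" using True by (simp add: distinct_card)
        have "(\<Sum>T\<in>?T. \<Sum>w\<in>Bs T. a T w * e (T, w) x) =
            (\<Sum>T\<in>?T. if T = ?T' then \<Sum>w\<in>Bs ?T'. a ?T' w * (of_int (sign ?p) * w b) else 0)"
          using True by (intro sum.cong refl) (auto simp: x e_apply)
        also have "\<dots> = of_int (sign ?p) * c (enum_list ?T', m, b)"
          using fT T' by (subst sum.delta) (auto simp: aev sum_distrib_left mult_ac)
        also have "\<dots> = c (map (\<lambda>i. enum_list ?T' ! ?p i) [0..<length (enum_list ?T')], m, b)"
          using alternating_permute[of "\<lambda>ss. c (ss, m, b)", OF CD(4)[OF c(1)] sort_perm(1)[of "enum_list ?T'" ss]]
            lT[OF T'] True by simp
        also have "map (\<lambda>i. enum_list ?T' ! ?p i) [0..<length (enum_list ?T')] = ss"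
          using sort_perm(2)[of "enum_list ?T'" ss] lT[OF T'] True by simp
        finally show ?thesis using True by (simp add: x)
      next
        case False
        have "c (ss, m', b) = 0"
        proof (cases "m' = m")
          case True
          thus ?thesis using False CD(3)[OF c(1)] C_repeated[OF c(1)] by blast
        next
          case False
          hence "wt m c (ss, m', b) = 0" by (simp add: wt_apply)
          thus ?thesis using c(2) by simp
        qed
        moreover have "e (T, w) x = 0" if "T \<in> ?T" for T w
          using that False card_distinct[of ss] by (auto simp: x e_apply)
        ultimately show ?thesis by (simp add: x)
      qed
      finally show "c x = (\<Sum>i\<in>?I. fscale (case i of (T, w) \<Rightarrow> a T w) (e i)) x" by simp
    qed
    also have "\<dots> \<in> fun_vs.span (e ` ?I)"
      by (intro fun_vs.span_sum fun_vs.span_scale fun_vs.span_base imageI)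
    finally show "c \<in> fun_vs.span (e ` ?I)" .
  qed
  have "fun_vs.dim (Cw q m) = card ?I" by (rule fun_vs.dim_family[OF fI fam sub1 sub2])
  also have "\<dots> = (\<Sum>T\<in>?T. card (Bs T))" using fT Bs(1) by (simp add: card_SigmaI)
  also have "\<dots> = (\<Sum>T\<in>?T. fun_vs.dim (F (\<Inter>T) m))"
  proof (rule sum.cong[OF refl])
    fix T assume T: "T \<in> ?T"
    show "card (Bs T) = fun_vs.dim (F (\<Inter>T) m)"
      unfolding Bs(3)[OF T, symmetric] by (rule fun_vs.dim_span_eq_card_independent[OF Bs(2)[OF T], symmetric])
  qed
  finally show ?thesis using fI sub2 by blast
qed

text \<open>The differential commutes with the weight projections, so a coboundary of weight m has a
  primitive of weight m.\<close>

lemma B_Int_Cw: "Z q \<inter> Cw q m \<inter> B q = (if q = 0 then {0} else D (q - 1) ` Cw (q - 1) m)"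
proof (cases q)
  case 0
  thus ?thesis using fun_vs.subspace_0[OF subspace_Z] fun_vs.subspace_0[OF subspace_Cw] by (auto simp: B_eq)
next
  case (Suc k)
  have "D k ` Cw k m \<subseteq> Z q \<inter> Cw q m \<inter> B q"
    using D_C[of _ k] D_D[of _ k] Suc by (auto simp: Cw_def B_eq Z_iff wt_D)
  moreover have "x \<in> D k ` Cw k m" if xC: "x \<in> Cw q m" and xB: "x \<in> B q" for x
  proof -
    obtain c where c: "x = D k c" "c \<in> C k" using xB Suc by (auto simp: B_eq)
    have "x = D k (wt m c)" using xC c wt_D[of m k c] by (simp add: Cw_def)
    moreover have "wt m c \<in> Cw k m" using wt_C[OF c(2)] by (simp add: Cw_def wt_wt)
    ultimately show ?thesis by blast
  qed
  ultimately show ?thesis using Suc by auto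
qed

text \<open>The Euler-Poincare principle in one weight. Cochains of degree i correspond to sets T of
  i + 1 cones, so \<open>card T + 1\<close> has the parity of the degree. The weight is -m because
  the torus acts by the inverse.\<close>

theorem euler_characteristic:
  "(\<Sum>i<card \<Sigma>. (-1) ^ i * int (weight_dim \<Sigma> S R i m)) =
   (\<Sum>T | T \<subseteq> \<Sigma> \<and> T \<noteq> {}. (-1) ^ (card T + 1) * int (fun_vs.dim (F (\<Inter>T) (- m))))"
proof -
  define c z b where "c i = int (fun_vs.dim (Cw i (- m)))" and "z i = int (fun_vs.dim (Z i \<inter> Cw i (- m)))"
    and "b i = int (fun_vs.dim (Z i \<inter> Cw i (- m) \<inter> B i))" for i
  have wd: "int (weight_dim \<Sigma> S R i m) = z i - b i" for i
  proof -
    obtain X where X: "finite X" "Cw i (- m) \<subseteq> fun_vs.span X" using dim_Cw by blast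
    have s: "fun_vs.subspace (Z i \<inter> Cw i (- m))" using subspace_Z subspace_Cw by (rule fun_vs.subspace_inter)
    have "Z i \<inter> Cw i (- m) \<subseteq> fun_vs.span X" using X by blast
    from quot_dim_sum[OF s this X(1) subspace_B[of i]] show ?thesis
      unfolding weight_dim_def weight_space z_def b_def by simp
  qed
  have cz: "c i = z i + b (Suc i)" for i
  proof -
    obtain X where X: "finite X" "Cw i (- m) \<subseteq> fun_vs.span X" using dim_Cw by blast
    have "{x \<in> Cw i (- m). D i x = 0} = Z i \<inter> Cw i (- m)" by (auto simp: Cw_def Z_iff)
    thus ?thesis
      using rank_nullity[of "D i", OF D_add D_scale subspace_Cw X(2,1)]
      unfolding c_def z_def b_def B_Int_Cw by simp
  qed
  have dim0: "fun_vs.dim {0} = 0"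
    by (rule fun_vs.dim_unique[of "{}"]) (auto simp: fun_vs.span_empty fun_vs.independent_empty)
  have b0: "b 0 = 0" unfolding b_def B_Int_Cw using dim0 by simp
  have bN: "b (card \<Sigma>) = 0"
  proof -
    have "Z (card \<Sigma>) \<inter> Cw (card \<Sigma>) (- m) \<inter> B (card \<Sigma>) = {0}"
      using C_large[of _ "card \<Sigma>"] fun_vs.subspace_0[OF subspace_Z] fun_vs.subspace_0[OF subspace_Cw] fun_vs.subspace_0[OF subspace_B]
      by (auto simp: Cw_def)
    thus ?thesis unfolding b_def using dim0 by simp
  qed
  \<comment> \<open>The boundary dimensions telescope; those in degree 0 and degree
    \<open>card \<Sigma>\<close> vanish.\<close>
  have tel: "(\<Sum>i<N. (-1) ^ i * (z i - b i)) = (\<Sum>i<N. (-1) ^ i * c i) + (-1) ^ N * b N" for N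
    by (induction N) (simp_all add: b0 cz algebra_simps)
  have "(\<Sum>i<card \<Sigma>. (-1) ^ i * int (weight_dim \<Sigma> S R i m)) = (\<Sum>i<card \<Sigma>. (-1) ^ i * c i)"
    using tel[of "card \<Sigma>"] bN by (simp add: wd)
  also have "\<dots> = (\<Sum>i<card \<Sigma>. \<Sum>T | T \<subseteq> \<Sigma> \<and> card T = Suc i. (-1) ^ (card T + 1) * int (fun_vs.dim (F (\<Inter>T) (- m))))"
    unfolding c_def dim_Cw[THEN conjunct1] of_nat_sum sum_distrib_left
    by (intro sum.cong refl) auto
  also have "\<dots> = (\<Sum>T\<in>(\<Union>i<card \<Sigma>. {T. T \<subseteq> \<Sigma> \<and> card T = Suc i}). (-1) ^ (card T + 1) * int (fun_vs.dim (F (\<Inter>T) (- m))))"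
    using fin by (subst sum.UNION_disjoint) auto
  also have "(\<Union>i<card \<Sigma>. {T. T \<subseteq> \<Sigma> \<and> card T = Suc i}) = {T. T \<subseteq> \<Sigma> \<and> T \<noteq> {}}"
  proof (intro set_eqI iffI)
    fix T assume T: "T \<in> {T. T \<subseteq> \<Sigma> \<and> T \<noteq> {}}"
    hence "card T > 0" "card T \<le> card \<Sigma>" using fin finite_subset card_mono by (auto simp: card_gt_0_iff)
    thus "T \<in> (\<Union>i<card \<Sigma>. {T. T \<subseteq> \<Sigma> \<and> card T = Suc i})" using T
      by (intro UN_I[of "card T - 1"]) auto
  qed auto
  finally show ?thesis .
qed

end

subsection \<open>Orbits and characters\<close>

lemma character_add: "t \<in> torus \<Longrightarrow> character (m + m') t = character m t * character m' t"
  by (auto simp: character_def torus_def power_int_add prod.distrib)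

lemma character_0: "character 0 t = 1" by (simp add: character_def)

lemma character_mult: "character m (\<chi> i. s $ i * t $ i) = character m s * character m t"
  by (simp add: character_def power_int_mult_distrib prod.distrib)

lemma character_one: "character m (\<chi> i. 1) = 1" by (simp add: character_def)

text \<open>The classical induction: compare the relation translated by s with its multiple by the
  value of the character a at s. The term of a cancels, and the coefficient of m is multiplied by a
  nonzero number for suitable s.\<close>

lemma characters_independent:
  assumes "finite M" "\<And>t. t \<in> torus \<Longrightarrow> (\<Sum>m\<in>M. c m * character m t) = 0" "m \<in> M"
  shows "c m = 0"
proof -
  have "\<forall>m\<in>M. c m = 0" using assms(1,2)
  proof (induction M arbitrary: c rule: finite_induct)
    case (insert a M)
    have cM: "c m = 0" if m: "m \<in> M" for m
    proof -
      have "m \<noteq> a" using m insert.hyps by blast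
      then obtain s where s: "s \<in> torus" "character m s \<noteq> character a s"
        using character_separates by blast
      have "(\<Sum>m\<in>M. c m * (character m s - character a s) * character m t) = 0" if t: "t \<in> torus" for t
      proof -
        let ?st = "\<chi> i. s $ i * t $ i"
        have "?st \<in> torus" using s(1) t by (simp add: torus_def)
        hence "(\<Sum>m\<in>insert a M. c m * character m ?st) - character a s * (\<Sum>m\<in>insert a M. c m * character m t) = 0"
          using insert.prems t by simp
        hence "(\<Sum>m\<in>insert a M. c m * (character m s - character a s) * character m t) = 0"
          by (simp only: sum_distrib_left sum_subtractf[symmetric] character_mult) (simp only: algebra_simps)
        thus ?thesis using insert.hyps by simp
      qed
      hence "\<forall>m\<in>M. c m * (character m s - character a s) = 0"
        by (rule insert.IH)
      thus ?thesis using m s(2) by auto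
    qed
    have "(\<chi> i. 1) \<in> torus" by (simp add: torus_def)
    hence "(\<Sum>m\<in>insert a M. c m * character m (\<chi> i. 1)) = 0" by (rule insert.prems)
    hence "c a = 0" using insert.hyps cM by (simp add: character_one)
    thus ?case using cM by simp
  qed simp
  thus ?thesis using assms(3) by blast
qed

lemma perp_lattice_antimono: "\<tau> \<subseteq> \<sigma> \<Longrightarrow> perp_lattice \<sigma> \<subseteq> perp_lattice \<tau>"
  by (auto simp: perp_lattice_def perp_def)

lemma perp_lattice_closed:
  "0 \<in> perp_lattice \<sigma>" "x \<in> perp_lattice \<sigma> \<Longrightarrow> y \<in> perp_lattice \<sigma> \<Longrightarrow> x + y \<in> perp_lattice \<sigma>"
  "x \<in> perp_lattice \<sigma> \<Longrightarrow> - x \<in> perp_lattice \<sigma>"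
  by (auto simp: perp_lattice_def perp_def rvec_0 rvec_add rvec_uminus inner_add_left)

lemma orbit_character:
  assumes "t \<in> torus" shows "(\<sigma>, \<lambda>m. if m \<in> perp_lattice \<sigma> then character m t else 0) \<in> orbit \<sigma>"
  using assms by (auto simp: orbit_def perp_lattice_closed character_add character_0)

text \<open>O_\<sigma> lies in the closure of O_\<tau>. A regular function vanishing on O_\<tau> has
  no monomial in \<tau>^\<bottom>, by independence of characters; a fortiori it has none in
  \<sigma>^\<bottom>, and only those are nonzero at points of O_\<sigma>.\<close>

lemma cones_in_upward:
  assumes f: "fan \<Sigma>" and z: "zariski_closed \<Sigma> Z" and \<tau>: "\<tau> \<in> cones_in \<Sigma> Z" and \<sigma>: "\<sigma> \<in> \<Sigma>" "\<tau> \<subseteq> \<sigma>"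
  shows "\<sigma> \<in> cones_in \<Sigma> Z"
proof -
  have \<tau>S: "\<tau> \<in> \<Sigma>" "orbit \<tau> \<subseteq> Z" using \<tau> by (auto simp: cones_in_def)
  have face: "\<tau> face_of \<sigma>" using fan_subset_face[OF f \<sigma>(1) \<tau>S(1) \<sigma>(2)] .
  obtain G where G: "G \<subseteq> regular_functions \<sigma>" "Z \<inter> chart \<Sigma> \<sigma> = {x \<in> chart \<Sigma> \<sigma>. \<forall>g\<in>G. eval_at g x = 0}"
    using z \<sigma>(1) unfolding zariski_closed_def by blast
  have g0: "g m = 0" if g: "g \<in> G" and m: "m \<in> perp_lattice \<tau>" for g m
  proof (rule ccontr)
    assume nz: "g m \<noteq> 0"
    have fin: "finite {m. g m \<noteq> 0}" using g G(1) by (auto simp: regular_functions_def)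
    let ?M = "{m. g m \<noteq> 0} \<inter> perp_lattice \<tau>"
    have "(\<Sum>m\<in>?M. g m * character m t) = 0" if t: "t \<in> torus" for t
    proof -
      let ?x = "(\<tau>, \<lambda>m. if m \<in> perp_lattice \<tau> then character m t else 0)"
      have x: "?x \<in> orbit \<tau>" by (rule orbit_character[OF t])
      hence "?x \<in> Z \<inter> chart \<Sigma> \<sigma>" using \<tau>S face unfolding chart_def by blast
      hence "eval_at g ?x = 0" using G(2) g by blast
      moreover have "eval_at g ?x = (\<Sum>m\<in>?M. g m * character m t)"
        unfolding eval_at_def using fin by (intro sum.mono_neutral_cong_right) auto
      ultimately show ?thesis by simp
    qed
    moreover have "finite ?M" using fin by simp
    ultimately have "g m = 0" using characters_independent[of ?M g m] nz m by blast
    thus False using nz by simp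
  qed
  have "orbit \<sigma> \<subseteq> Z"
  proof
    fix y assume y: "y \<in> orbit \<sigma>"
    have "\<sigma> face_of \<sigma>" using fan_cone(5)[OF f \<sigma>(1)] by (rule face_of_refl)
    hence c: "y \<in> chart \<Sigma> \<sigma>" using y \<sigma>(1) unfolding chart_def by blast
    have "eval_at g y = 0" if g: "g \<in> G" for g
      unfolding eval_at_def
    proof (intro sum.neutral ballI)
      fix m assume m: "m \<in> {m. g m \<noteq> 0}"
      hence "m \<notin> perp_lattice \<sigma>" using g0[OF g] perp_lattice_antimono[OF \<sigma>(2)] by blast
      hence "snd y m = 0" using y by (auto simp: orbit_def)
      thus "g m * snd y m = 0" by simp
    qed
    thus "y \<in> Z" using c G(2) by blast
  qed
  thus ?thesis using \<sigma>(1) by (simp add: cones_in_def)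
qed

section \<open>Extension of characters from sublattices to M\<close>

definition partial_hom :: "(int ^ 'n::finite) set \<Rightarrow> (int ^ 'n \<Rightarrow> complex) \<Rightarrow> bool" where
  "partial_hom L \<gamma> \<longleftrightarrow> 0 \<in> L \<and> (\<forall>x\<in>L. \<forall>y\<in>L. x + y \<in> L) \<and> (\<forall>x\<in>L. - x \<in> L) \<and>
     \<gamma> 0 = 1 \<and> (\<forall>x\<in>L. \<forall>y\<in>L. \<gamma> (x + y) = \<gamma> x * \<gamma> y)"

lemma partial_homD:
  assumes "partial_hom L \<gamma>"
  shows "0 \<in> L" "x \<in> L \<Longrightarrow> y \<in> L \<Longrightarrow> x + y \<in> L" "x \<in> L \<Longrightarrow> - x \<in> L"
    "\<gamma> 0 = 1" "x \<in> L \<Longrightarrow> y \<in> L \<Longrightarrow> \<gamma> (x + y) = \<gamma> x * \<gamma> y"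
  using assms by (auto simp: partial_hom_def)

lemma partial_hom_diff:
  assumes "partial_hom L \<gamma>" "x \<in> L" "y \<in> L" shows "x - y \<in> L"
  using partial_homD(2,3)[OF assms(1)] assms(2,3) by (metis uminus_add_conv_diff add.commute)

lemma partial_hom_nz:
  assumes "partial_hom L \<gamma>" "x \<in> L" shows "\<gamma> x \<noteq> 0"
  using partial_homD(3-5)[OF assms(1)] assms(2) by (metis add.right_inverse mult_zero_left zero_neq_one)

lemma partial_hom_smult:
  assumes h: "partial_hom L \<gamma>" and x: "x \<in> L"
  shows "k *s x \<in> L \<and> \<gamma> (k *s x) = \<gamma> x powi k"
proof -
  have nat: "int n *s x \<in> L \<and> \<gamma> (int n *s x) = \<gamma> x ^ n" for n
  proof (induction n)
    case 0
    have "(0::int) *s x = 0" by (simp add: vec_eq_iff)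
    thus ?case using partial_homD[OF h] by simp
  next
    case (Suc n)
    have e: "int (Suc n) *s x = x + int n *s x" by (simp add: vec_eq_iff algebra_simps)
    show ?case unfolding e using Suc partial_homD[OF h] x by simp
  qed
  show ?thesis
  proof (cases "k \<ge> 0")
    case True
    thus ?thesis using nat[of "nat k"] by (simp add: power_int_def)
  next
    case False
    define n where "n = nat (- k)"
    have e: "k *s x = - (int n *s x)" using False by (simp add: vec_eq_iff n_def)
    have "\<gamma> (int n *s x) * \<gamma> (- (int n *s x)) = 1"
      using partial_homD(3-5)[OF h] nat[of n] by (metis add.right_inverse)
    hence "\<gamma> (- (int n *s x)) = inverse (\<gamma> x ^ n)" using nat[of n] by (metis inverse_unique)
    thus ?thesis unfolding e using nat[of n] partial_homD(3)[OF h] False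
      by (simp add: power_int_def n_def power_inverse)
  qed
qed

lemma complex_root_exists:
  assumes "w \<noteq> 0" "n > 0" shows "\<exists>z::complex. z \<noteq> 0 \<and> z ^ n = w"
proof -
  have e: "of_nat n * (Ln w / of_nat n) = Ln w" using assms by simp
  have "exp (Ln w / of_nat n) ^ n = exp (of_nat n * (Ln w / of_nat n))" by (simp only: exp_of_nat_mult)
  also have "\<dots> = w" unfolding e using assms(1) by simp
  finally show ?thesis by (intro exI[of _ "exp (Ln w / of_nat n)"]) simp
qed

text \<open>Finds the value z to be assigned to v. If no positive multiple of v lies in L, the value
  1 will do. Otherwise take a d-th root of the value at d v, with d the least such multiple;
  division with remainder shows that every multiple of v in L is a multiple of d v.\<close>

lemma partial_hom_root:
  assumes h: "partial_hom L \<gamma>"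
  shows "\<exists>z. z \<noteq> 0 \<and> (\<forall>k. k *s v \<in> L \<longrightarrow> \<gamma> (k *s v) = z powi k)"
proof (cases "\<exists>n>0. int n *s v \<in> L")
  case False
  have "k = 0" if k: "k *s v \<in> L" for k
  proof (rule ccontr)
    assume "k \<noteq> 0"
    have "- (k *s v) = (- k) *s v" by (simp add: vec_eq_iff)
    hence "(- k) *s v \<in> L" using partial_homD(3)[OF h k] by simp
    hence "\<bar>k\<bar> *s v \<in> L" using k by (cases "k \<ge> 0") auto
    thus False using False \<open>k \<noteq> 0\<close> by (metis zero_less_abs_iff zero_less_imp_eq_int)
  qed
  moreover have "(0::int) *s v = 0" by (simp add: vec_eq_iff)
  ultimately have "\<forall>k. k *s v \<in> L \<longrightarrow> \<gamma> (k *s v) = 1 powi k"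
    using partial_homD(4)[OF h] by (metis power_int_1_left)
  thus ?thesis by (intro exI[of _ 1]) auto
next
  case True
  define d where "d = (LEAST n. n > 0 \<and> int n *s v \<in> L)"
  have d: "d > 0" "int d *s v \<in> L" using LeastI_ex[OF True] by (auto simp: d_def)
  have min: "\<not> (n > 0 \<and> int n *s v \<in> L)" if "n < d" for n using not_less_Least that unfolding d_def by blast
  obtain z where z: "z \<noteq> 0" "z ^ d = \<gamma> (int d *s v)"
    using complex_root_exists[OF partial_hom_nz[OF h d(2)] d(1)] by blast
  have "\<gamma> (k *s v) = z powi k" if k: "k *s v \<in> L" for k
  proof -
    let ?q = "k div int d" and ?r = "nat (k mod int d)"
    have q: "?q *s (int d *s v) \<in> L" "\<gamma> (?q *s (int d *s v)) = \<gamma> (int d *s v) powi ?q"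
      using partial_hom_smult[OF h d(2)] by blast+
    have r: "int ?r = k mod int d" "?r < d" using d(1) by (auto simp: nat_less_iff)
    have "int ?r *s v = k *s v - ?q *s (int d *s v)"
      unfolding r(1) by (simp add: vec_eq_iff minus_div_mult_eq_mod[symmetric] algebra_simps)
    hence "int ?r *s v \<in> L" using partial_hom_diff[OF h k q(1)] by simp
    hence "?r = 0" using min[OF r(2)] by auto
    hence "k mod int d = 0" using r(1) by simp
    hence k': "k = int d * ?q" by auto
    have "k *s v = ?q *s (int d *s v)" by (subst k') (simp add: vec_eq_iff)
    hence "\<gamma> (k *s v) = (z ^ d) powi ?q" using q z by simp
    also have "\<dots> = z powi (int d * ?q)" by (simp add: power_int_mult)
    finally show ?thesis using k' by simp
  qed
  thus ?thesis using z by blast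
qed

lemma partial_hom_extend:
  assumes h: "partial_hom L \<gamma>"
  shows "\<exists>L' \<gamma>'. partial_hom L' \<gamma>' \<and> L \<subseteq> L' \<and> v \<in> L' \<and> (\<forall>x\<in>L. \<gamma>' x = \<gamma> x)"
proof -
  note H = partial_homD[OF h]
  obtain z where z: "z \<noteq> 0" "\<And>k. k *s v \<in> L \<Longrightarrow> \<gamma> (k *s v) = z powi k"
    using partial_hom_root[OF h] by blast
  define L' where "L' = {x + k *s v | x k. x \<in> L}"
  \<comment> \<open>The decomposition of y is not unique; \<open>val\<close> shows that the value
    does not depend on it, thanks to the choice of z.\<close>
  define \<gamma>' where "\<gamma>' y = (let p = SOME p. fst p \<in> L \<and> y = fst p + snd p *s v in \<gamma> (fst p) * z powi (snd p))" for y
  have val: "\<gamma>' (x + k *s v) = \<gamma> x * z powi k" if x: "x \<in> L" for x k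
  proof -
    let ?P = "\<lambda>p. fst p \<in> L \<and> x + k *s v = fst p + snd p *s v"
    define p where "p = (SOME p. ?P p)"
    have "?P (x, k)" using x by simp
    hence p: "?P p" unfolding p_def by (rule someI)
    have e: "(snd p - k) *s v = x - fst p"
      using p by (simp add: vec_eq_iff algebra_simps)
    hence m: "(snd p - k) *s v \<in> L" using partial_hom_diff[OF h x] p by simp
    have "x = fst p + (snd p - k) *s v" using e by simp
    hence "\<gamma> x = \<gamma> (fst p) * z powi (snd p - k)" using H(5)[OF _ m, of "fst p"] p z(2)[OF m] by simp
    hence "\<gamma> x * z powi k = \<gamma> (fst p) * z powi (snd p)" using z(1) by (simp add: power_int_diff)
    thus ?thesis by (simp add: \<gamma>'_def p_def[symmetric])
  qed
  have zero: "(0::int) *s v = 0" by (simp add: vec_eq_iff)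
  have inL: "x \<in> L'" if "x \<in> L" for x
    unfolding L'_def using that zero by (intro CollectI exI[of _ x] exI[of _ 0]) simp
  have agree: "\<gamma>' x = \<gamma> x" if "x \<in> L" for x using val[OF that, of 0] zero by simp
  have "v = 0 + 1 *s v" by (simp add: vec_eq_iff)
  hence "v \<in> L'" unfolding L'_def using H(1) by blast
  moreover have "partial_hom L' \<gamma>'"
    unfolding partial_hom_def
  proof (intro conjI ballI)
    show "0 \<in> L'" using inL H(1) by blast
    show "\<gamma>' 0 = 1" using agree[OF H(1)] H(4) by simp
    fix x assume "x \<in> L'"
    then obtain x1 k where x: "x = x1 + k *s v" "x1 \<in> L" unfolding L'_def by blast
    have "- x = - x1 + (- k) *s v" by (simp add: x vec_eq_iff)
    thus "- x \<in> L'" unfolding L'_def using H(3)[OF x(2)] by blast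
    fix y assume "y \<in> L'"
    then obtain y1 l where y: "y = y1 + l *s v" "y1 \<in> L" unfolding L'_def by blast
    have s: "x + y = (x1 + y1) + (k + l) *s v" by (simp add: x y vec_eq_iff algebra_simps)
    thus "x + y \<in> L'" unfolding L'_def using H(2)[OF x(2) y(2)] by blast
    show "\<gamma>' (x + y) = \<gamma>' x * \<gamma>' y"
      unfolding s val[OF H(2)[OF x(2) y(2)]] unfolding x(1) y(1) val[OF x(2)] val[OF y(2)]
      using H(5)[OF x(2) y(2)] z(1) by (simp add: power_int_add)
  qed
  ultimately show ?thesis using inL agree by blast
qed

text \<open>Adjoining the finitely many unit vectors one after another reaches all of M. This
  provides the surjectivity of the maps between orbits.\<close>

lemma partial_hom_extend_total:
  assumes h: "partial_hom L \<gamma>"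
  shows "\<exists>\<gamma>'. partial_hom UNIV \<gamma>' \<and> (\<forall>x\<in>L. \<gamma>' x = \<gamma> x)"
proof -
  have "\<exists>L' \<gamma>'. partial_hom L' \<gamma>' \<and> L \<subseteq> L' \<and> (\<forall>i\<in>A. axis i 1 \<in> L') \<and> (\<forall>x\<in>L. \<gamma>' x = \<gamma> x)"
    if "finite A" for A :: "'a set"
    using that
  proof induction
    case empty thus ?case using h by blast
  next
    case (insert i A)
    then obtain L1 \<gamma>1 where 1: "partial_hom L1 \<gamma>1" "L \<subseteq> L1" "\<forall>i\<in>A. axis i 1 \<in> L1" "\<forall>x\<in>L. \<gamma>1 x = \<gamma> x" by blast
    obtain L2 \<gamma>2 where 2: "partial_hom L2 \<gamma>2" "L1 \<subseteq> L2" "axis i 1 \<in> L2" "\<forall>x\<in>L1. \<gamma>2 x = \<gamma>1 x"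
      using partial_hom_extend[OF 1(1)] by blast
    have "\<forall>j\<in>insert i A. axis j 1 \<in> L2" using 1(3) 2(2,3) by blast
    moreover have "\<forall>x\<in>L. \<gamma>2 x = \<gamma> x" using 1(2,4) 2(4) by auto
    moreover have "L \<subseteq> L2" using 1(2) 2(2) by blast
    ultimately show ?case using 2(1) by blast
  qed
  then obtain L' \<gamma>' where L': "partial_hom L' \<gamma>'" "\<forall>i. axis i 1 \<in> L'" "\<forall>x\<in>L. \<gamma>' x = \<gamma> x"
    by (metis finite_UNIV UNIV_I finite)
  have "m \<in> L'" for m
  proof -
    have "m = (\<Sum>i\<in>UNIV. (m $ i) *s axis i 1)"
      by (simp add: vec_eq_iff axis_def if_distrib cong: if_cong)
    moreover have "(\<Sum>i\<in>A. (m $ i) *s axis i 1) \<in> L'" if "finite A" for A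
      using that by induction (use partial_homD(1,2)[OF L'(1)] partial_hom_smult[OF L'(1)] L'(2) in auto)
    ultimately show ?thesis by (metis finite)
  qed
  hence "L' = UNIV" by blast
  thus ?thesis using L' by blast
qed

subsection \<open>The polytope of a globally generated divisor\<close>

locale gg_divisor =
  fixes \<Sigma> :: "(real ^ 'n::finite) set set" and a :: "(real ^ 'n) set \<Rightarrow> int"
  assumes cf: "complete_fan \<Sigma>" and car: "cartier \<Sigma> a" and gg: "globally_generated \<Sigma> a"
begin

lemma is_fan: "fan \<Sigma>" using cf by (simp add: complete_fan_def)

abbreviation md where "md \<equiv> cartier_datum a"

abbreviation P where "P \<equiv> divisor_polytope \<Sigma> a"

lemma md: "\<sigma> \<in> \<Sigma> \<Longrightarrow> \<rho> \<in> rays \<sigma> \<Longrightarrow> pairing (md \<sigma>) (ray_gen \<rho>) = - a \<rho>"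
proof -
  assume \<sigma>: "\<sigma> \<in> \<Sigma>" and \<rho>: "\<rho> \<in> rays \<sigma>"
  have "\<exists>m. \<forall>\<rho>\<in>rays \<sigma>. pairing m (ray_gen \<rho>) = - a \<rho>" using car \<sigma> unfolding cartier_def by blast
  hence "\<forall>\<rho>\<in>rays \<sigma>. pairing (md \<sigma>) (ray_gen \<rho>) = - a \<rho>" unfolding cartier_datum_def by (rule someI_ex)
  thus ?thesis using \<rho> by blast
qed

lemma md_face:
  assumes "\<sigma> \<in> \<Sigma>" "\<tau> \<in> \<Sigma>" "\<tau> \<subseteq> \<sigma>" "u \<in> \<tau>"
  shows "rvec (md \<sigma>) \<bullet> u = rvec (md \<tau>) \<bullet> u"
proof -
  have "rays \<tau> \<subseteq> rays \<sigma>"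
    using fan_subset_face[OF is_fan assms(1,2,3)] face_of_trans unfolding rays_def by blast
  hence "(rvec (md \<sigma>) - rvec (md \<tau>)) \<bullet> rvec (ray_gen \<rho>) = 0" if "\<rho> \<in> rays \<tau>" for \<rho>
    using md[OF assms(1), of \<rho>] md[OF assms(2) that] that by (auto simp: inner_diff_left rvec_inner)
  hence "(rvec (md \<sigma>) - rvec (md \<tau>)) \<bullet> u = 0" by (rule orthogonal_via_rays[OF is_fan assms(2) _ assms(4)])
  thus ?thesis by (simp add: inner_diff_left)
qed

text \<open>The support function of \<open>D\<close>: linear on every cone and equal there to the Cartier datum.\<close>

definition psi where "psi u = rvec (md (SOME \<sigma>. \<sigma> \<in> \<Sigma> \<and> u \<in> \<sigma>)) \<bullet> u"

lemma psi_eq: assumes "\<sigma> \<in> \<Sigma>" "u \<in> \<sigma>" shows "psi u = rvec (md \<sigma>) \<bullet> u"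
proof -
  define \<rho> where "\<rho> = (SOME \<sigma>. \<sigma> \<in> \<Sigma> \<and> u \<in> \<sigma>)"
  have \<rho>: "\<rho> \<in> \<Sigma>" "u \<in> \<rho>" using someI[of "\<lambda>\<sigma>. \<sigma> \<in> \<Sigma> \<and> u \<in> \<sigma>" \<sigma>] assms by (auto simp: \<rho>_def)
  have i: "\<sigma> \<inter> \<rho> \<in> \<Sigma>" using fan_face[OF is_fan assms(1) fan_Int_face[OF is_fan assms(1) \<rho>(1)]] assms(2) \<rho>(2) by blast
  have "rvec (md \<sigma>) \<bullet> u = rvec (md (\<sigma> \<inter> \<rho>)) \<bullet> u" by (rule md_face[OF assms(1) i]) (use assms \<rho> in auto)
  also have "\<dots> = rvec (md \<rho>) \<bullet> u" by (rule md_face[OF \<rho>(1) i, symmetric]) (use assms \<rho> in auto)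
  finally show ?thesis by (simp add: psi_def \<rho>_def)
qed

lemma cover: "\<exists>\<sigma>\<in>\<Sigma>. u \<in> \<sigma>" using cf unfolding complete_fan_def by blast

text \<open>This is where global generation enters. A global section that is nonzero at the
  distinguished point of O_\<sigma> has a monomial \<chi>^v with v - m_\<sigma> in
  \<sigma>^\<bottom>, so v agrees with \<open>psi\<close> on \<sigma>; being a section on every
  chart, it satisfies v \<ge> \<open>psi\<close> everywhere.\<close>

lemma ex_linear_datum:
  assumes \<sigma>: "\<sigma> \<in> \<Sigma>"
  shows "\<exists>v. (\<forall>u\<in>\<sigma>. rvec v \<bullet> u = psi u) \<and> (\<forall>u. rvec v \<bullet> u \<ge> psi u)"
proof -
  let ?x = "(\<sigma>, \<lambda>m. if m \<in> perp_lattice \<sigma> then 1 else 0 :: complex)"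
  have cl: "0 \<in> perp_lattice \<sigma>" "\<And>x y. x \<in> perp_lattice \<sigma> \<Longrightarrow> y \<in> perp_lattice \<sigma> \<Longrightarrow> x + y \<in> perp_lattice \<sigma>"
    by (auto simp: perp_lattice_def perp_def rvec_0 rvec_add inner_add_left)
  have "?x \<in> orbit \<sigma>" using cl by (auto simp: orbit_def)
  hence "?x \<in> toric_variety \<Sigma>" using \<sigma> by (auto simp: toric_variety_def)
  then obtain s where s: "s \<in> (\<Inter>\<sigma>\<in>\<Sigma>. divisor_sections a \<sigma>)" "eval_at (\<lambda>m. s (m + md \<sigma>)) ?x \<noteq> 0"
    using gg unfolding globally_generated_def by fastforce
  then obtain m where m: "s (m + md \<sigma>) * snd ?x m \<noteq> 0" unfolding eval_at_def by (meson sum.neutral)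
  hence ms: "s (m + md \<sigma>) \<noteq> 0" "m \<in> perp_lattice \<sigma>" by (auto split: if_splits)
  define v where "v = m + md \<sigma>"
  have "rvec v \<bullet> u = psi u" if "u \<in> \<sigma>" for u
    using ms(2) that psi_eq[OF \<sigma> that] by (simp add: v_def rvec_add inner_add_left perp_lattice_def perp_def)
  moreover have "rvec v \<bullet> u \<ge> psi u" for u
  proof -
    obtain \<rho> where \<rho>: "\<rho> \<in> \<Sigma>" "u \<in> \<rho>" using cover by blast
    have "(\<lambda>m. s (m + md \<rho>)) \<in> regular_functions \<rho>" using s(1) \<rho>(1) by (auto simp: divisor_sections_def)
    moreover have "s ((v - md \<rho>) + md \<rho>) \<noteq> 0" using ms by (simp add: v_def)
    ultimately have "rvec (v - md \<rho>) \<in> dual_cone \<rho>" unfolding regular_functions_def by blast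
    hence "rvec (v - md \<rho>) \<bullet> u \<ge> 0" using \<rho> by (simp add: dual_cone_def)
    thus ?thesis using psi_eq[OF \<rho>] by (simp add: rvec_diff inner_diff_left)
  qed
  ultimately show ?thesis by blast
qed

text \<open>A lattice point of \<open>P\<^sub>D\<close> that agrees with the support function on \<open>\<sigma>\<close>.\<close>

definition lin_datum where "lin_datum \<sigma> = (SOME v. (\<forall>u\<in>\<sigma>. rvec v \<bullet> u = psi u) \<and> (\<forall>u. rvec v \<bullet> u \<ge> psi u))"

text \<open>Finitely many lattice points of P, not necessarily vertices, whose minimum is
  \<open>psi\<close> and whose convex hull is P.\<close>

definition V where "V = (\<lambda>\<sigma>. rvec (lin_datum \<sigma>)) ` \<Sigma>"

lemma finite_V: "finite V" unfolding V_def using fan_finite[OF is_fan] by simp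

lemma V_ge: "v \<in> V \<Longrightarrow> v \<bullet> u \<ge> psi u"
  using someI_ex[OF ex_linear_datum] unfolding V_def lin_datum_def by blast

lemma V_eq: "\<exists>v\<in>V. v \<bullet> u = psi u"
proof -
  obtain \<sigma> where "\<sigma> \<in> \<Sigma>" "u \<in> \<sigma>" using cover by blast
  thus ?thesis using someI_ex[OF ex_linear_datum[of \<sigma>]] unfolding V_def lin_datum_def by blast
qed

text \<open>On each cone \<open>psi\<close> is linear, so the inequalities at the ray generators
  propagate to all directions.\<close>

lemma P_iff: "m \<in> P \<longleftrightarrow> (\<forall>u. m \<bullet> u \<ge> psi u)"
proof
  assume m: "m \<in> P"
  show "\<forall>u. m \<bullet> u \<ge> psi u"
  proof
    fix u
    obtain \<sigma> where \<sigma>: "\<sigma> \<in> \<Sigma>" "u \<in> \<sigma>" using cover by blast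
    have "(m - rvec (md \<sigma>)) \<bullet> u \<ge> 0"
    proof (rule dual_cone_via_rays[OF is_fan \<sigma>(1) _ \<sigma>(2)])
      fix \<rho> assume \<rho>: "\<rho> \<in> rays \<sigma>"
      have "m \<bullet> rvec (ray_gen \<rho>) \<ge> - real_of_int (a \<rho>)"
        using m fan_rays_of_cone[OF is_fan \<sigma>(1) \<rho>] by (auto simp: divisor_polytope_def)
      thus "(m - rvec (md \<sigma>)) \<bullet> rvec (ray_gen \<rho>) \<ge> 0"
        using md[OF \<sigma>(1) \<rho>] by (simp add: inner_diff_left rvec_inner)
    qed
    thus "m \<bullet> u \<ge> psi u" using psi_eq[OF \<sigma>] by (simp add: inner_diff_left)
  qed
next
  assume m: "\<forall>u. m \<bullet> u \<ge> psi u"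
  show "m \<in> P"
    unfolding divisor_polytope_def
  proof (intro CollectI ballI)
    fix \<rho> assume \<rho>: "\<rho> \<in> fan_rays \<Sigma>"
    hence r: "\<rho> \<in> \<Sigma>" "dim \<rho> = 1" by (auto simp: fan_rays_def)
    have "\<rho> \<in> rays \<rho>" using r fan_cone(5)[OF is_fan r(1)] by (simp add: rays_def face_of_refl)
    hence "psi (rvec (ray_gen \<rho>)) = - real_of_int (a \<rho>)"
      using psi_eq[OF r(1) fan_ray_gen(3)[OF is_fan \<rho>]] md[OF r(1)] by (simp add: rvec_inner)
    thus "m \<bullet> rvec (ray_gen \<rho>) \<ge> - real_of_int (a \<rho>)" using m by metis
  qed
qed

lemma V_sub_P: "V \<subseteq> P" using V_ge by (auto simp: P_iff)

lemma convex_P: "convex P"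
  unfolding convex_def
proof (intro ballI allI impI)
  fix x y :: "real ^ 'n" and s t :: real assume xy: "x \<in> P" "y \<in> P" and st: "0 \<le> s" "0 \<le> t" "s + t = 1"
  show "s *\<^sub>R x + t *\<^sub>R y \<in> P"
    unfolding P_iff
  proof
    fix u
    have "psi u = s * psi u + t * psi u" using st by (simp flip: distrib_right)
    also have "\<dots> \<le> s * (x \<bullet> u) + t * (y \<bullet> u)"
      using xy st by (intro add_mono mult_left_mono) (auto simp: P_iff)
    finally show "psi u \<le> (s *\<^sub>R x + t *\<^sub>R y) \<bullet> u" by (simp add: inner_add_left)
  qed
qed

text \<open>A point separated from the hull would lie below \<open>psi\<close> in the direction of
  the separating functional, since the minimum is attained on V.\<close>

lemma P_eq_hull: "P = convex hull V"
proof
  show "convex hull V \<subseteq> P" by (rule hull_minimal[of V P convex, OF V_sub_P convex_P])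
  show "P \<subseteq> convex hull V"
  proof (rule subsetI, rule ccontr)
    fix m assume m: "m \<in> P" "m \<notin> convex hull V"
    have "closed (convex hull V)" using finite_V by (simp add: compact_imp_closed finite_imp_compact_convex_hull)
    then obtain w b where w: "w \<bullet> m < b" "\<forall>x\<in>convex hull V. b < w \<bullet> x"
      using separating_hyperplane_closed_point[OF convex_convex_hull _ m(2)] by blast
    obtain v where v: "v \<in> V" "v \<bullet> w = psi w" using V_eq by blast
    have "b < w \<bullet> v" using w(2) v(1) hull_inc by metis
    moreover have "psi w \<le> m \<bullet> w" using m(1) by (simp add: P_iff)
    ultimately show False using w(1) v(2) by (simp add: inner_commute)
  qed
qed

lemma polytope_P: "polytope P" using P_eq_hull finite_V unfolding polytope_def by blast

section \<open>Faces of the polytope and cones of its normal fan\<close>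

definition min_face where "min_face u = {m \<in> P. m \<bullet> u = psi u}"

lemma min_face_face: "min_face u face_of P"
proof -
  have "P \<inter> {m. u \<bullet> m = psi u} face_of P"
    by (rule face_of_Int_supporting_hyperplane_ge[OF convex_P]) (simp add: P_iff inner_commute)
  moreover have "min_face u = P \<inter> {m. u \<bullet> m = psi u}" by (auto simp: min_face_def inner_commute)
  ultimately show ?thesis by simp
qed

lemma min_face_nonempty: "min_face u \<noteq> {}"
proof -
  obtain v where "v \<in> V" "v \<bullet> u = psi u" using V_eq by blast
  thus ?thesis using V_sub_P unfolding min_face_def by blast
qed

lemma face_is_min_face:
  assumes "E face_of P" "E \<noteq> {}" shows "\<exists>u. min_face u = E"
proof -
  have "E exposed_face_of P" using exposed_face_of_polyhedron[OF polytope_imp_polyhedron[OF polytope_P]] assms by blast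
  then obtain c b where c: "P \<subseteq> {x. c \<bullet> x \<le> b}" "E = P \<inter> {x. c \<bullet> x = b}" unfolding exposed_face_of_def by blast
  obtain e where e: "e \<in> P" "c \<bullet> e = b" using assms(2) c by blast
  \<comment> \<open>The exposing functional c bounds P from above, whereas normal cones are inner
    ones; hence the direction -c.\<close>
  obtain v where v: "v \<in> V" "v \<bullet> (- c) = psi (- c)" using V_eq by blast
  have "psi (- c) \<le> e \<bullet> (- c)" using e(1) P_iff by blast
  moreover have "c \<bullet> v \<le> b" using v(1) V_sub_P c(1) by blast
  ultimately have "psi (- c) = - b" using v(2) e(2) by (simp add: inner_commute)
  hence "min_face (- c) = E" unfolding min_face_def c(2) by (auto simp: inner_commute)
  thus ?thesis by blast
qed

lemma normal_cone_iff:
  assumes "E \<subseteq> P" "E \<noteq> {}" shows "u \<in> normal_cone P E \<longleftrightarrow> E \<subseteq> min_face u"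
proof
  assume u: "u \<in> normal_cone P E"
  obtain v where v: "v \<in> V" "v \<bullet> u = psi u" using V_eq by blast
  show "E \<subseteq> min_face u"
  proof
    fix m assume m: "m \<in> E"
    have "m \<bullet> u \<le> v \<bullet> u" using u m v(1) V_sub_P unfolding normal_cone_def by blast
    moreover have "psi u \<le> m \<bullet> u" using m assms(1) P_iff by blast
    ultimately show "m \<in> min_face u" using m assms(1) v(2) by (auto simp: min_face_def)
  qed
next
  assume "E \<subseteq> min_face u"
  thus "u \<in> normal_cone P E" by (auto simp: normal_cone_def min_face_def P_iff)
qed

text \<open>The face of \<open>P\<^sub>D\<close> to whose orbit the toric morphism \<open>X \<rightarrow> X\<^sub>D\<close> maps \<open>O\<^sub>\<sigma>\<close>.\<close>

definition cone_face where "cone_face \<sigma> = {m \<in> P. \<forall>u\<in>\<sigma>. m \<bullet> u = psi u}"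

text \<open>On \<sigma> the function m - \<open>psi\<close> is linear and nonnegative; if it
  vanishes at a relative interior point, it vanishes on all of \<sigma>.\<close>

lemma cone_face_eq:
  assumes "\<sigma> \<in> \<Sigma>" "x \<in> rel_interior \<sigma>" shows "cone_face \<sigma> = min_face x"
proof
  have xs: "x \<in> \<sigma>" using assms rel_interior_subset by blast
  thus "cone_face \<sigma> \<subseteq> min_face x" by (auto simp: cone_face_def min_face_def)
  show "min_face x \<subseteq> cone_face \<sigma>"
  proof
    fix m assume m: "m \<in> min_face x"
    let ?d = "m - rvec (md \<sigma>)"
    have e: "?d \<bullet> u = m \<bullet> u - psi u" if "u \<in> \<sigma>" for u using psi_eq[OF assms(1) that] by (simp add: inner_diff_left)
    have "(\<sigma> \<inter> {u. ?d \<bullet> u = 0}) face_of \<sigma>"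
      using m by (intro face_of_Int_supporting_hyperplane_ge fan_cone(5)[OF is_fan assms(1)]) (simp add: e min_face_def P_iff)
    moreover have "x \<in> \<sigma> \<inter> {u. ?d \<bullet> u = 0}" using xs m by (simp add: e min_face_def)
    ultimately have "\<sigma> \<subseteq> \<sigma> \<inter> {u. ?d \<bullet> u = 0}"
      using subset_of_face_of[of _ \<sigma> \<sigma>] assms(2) by blast
    thus "m \<in> cone_face \<sigma>" using m e by (auto simp: cone_face_def min_face_def)
  qed
qed

lemma cone_face_face:
  assumes "\<sigma> \<in> \<Sigma>" shows "cone_face \<sigma> face_of P" "cone_face \<sigma> \<noteq> {}"
proof -
  obtain x where "x \<in> rel_interior \<sigma>" using fan_rel_interior_nonempty[OF is_fan assms] by blast
  thus "cone_face \<sigma> face_of P" "cone_face \<sigma> \<noteq> {}" using cone_face_eq[OF assms] min_face_face min_face_nonempty by auto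
qed

lemma subset_normal_cone_iff:
  assumes "\<sigma> \<in> \<Sigma>" "E face_of P" "E \<noteq> {}"
  shows "\<sigma> \<subseteq> normal_cone P E \<longleftrightarrow> E \<subseteq> cone_face \<sigma>"
  using normal_cone_iff[OF face_of_imp_subset[OF assms(2)] assms(3)] face_of_imp_subset[OF assms(2)]
  by (auto simp: cone_face_def min_face_def)

lemma normal_cone_antimono: "E \<subseteq> E' \<Longrightarrow> normal_cone P E' \<subseteq> normal_cone P E"
  by (auto simp: normal_cone_def)

lemma normal_cone_inj:
  assumes "E face_of P" "E \<noteq> {}" "E' face_of P" "E' \<noteq> {}" "normal_cone P E = normal_cone P E'"
  shows "E = E'"
proof -
  have "E' \<subseteq> E" if h: "E face_of P" "E \<noteq> {}" "E' face_of P" "E' \<noteq> {}" "normal_cone P E = normal_cone P E'" for E E'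
  proof -
    obtain u where u: "min_face u = E" using face_is_min_face[OF h(1,2)] by blast
    hence "u \<in> normal_cone P E'"
      using normal_cone_iff[OF face_of_imp_subset[OF h(1)] h(2), of u] h(5) by simp
    thus ?thesis using normal_cone_iff[OF face_of_imp_subset[OF h(3)] h(4), of u] u by simp
  qed
  thus ?thesis using assms by (metis subset_antisym)
qed

text \<open>By the Galois correspondence \<open>subset_normal_cone_iff\<close>, the smallest cone
  occurring in \<open>toric_morphism\<close> is the one that belongs to the largest admissible
  face.\<close>

lemma smallest_normal_cone:
  assumes "\<sigma> \<in> \<Sigma>"
  shows "\<Inter>{\<sigma>' \<in> normal_fan P. \<sigma> \<subseteq> \<sigma>'} = normal_cone P (cone_face \<sigma>)"
proof
  have "normal_cone P (cone_face \<sigma>) \<in> normal_fan P" using cone_face_face[OF assms] unfolding normal_fan_def by blast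
  moreover have "\<sigma> \<subseteq> normal_cone P (cone_face \<sigma>)" using subset_normal_cone_iff[OF assms cone_face_face[OF assms]] by blast
  ultimately show "\<Inter>{\<sigma>' \<in> normal_fan P. \<sigma> \<subseteq> \<sigma>'} \<subseteq> normal_cone P (cone_face \<sigma>)" by blast
  show "normal_cone P (cone_face \<sigma>) \<subseteq> \<Inter>{\<sigma>' \<in> normal_fan P. \<sigma> \<subseteq> \<sigma>'}"
  proof (rule Inter_greatest)
    fix \<sigma>' assume "\<sigma>' \<in> {\<sigma>' \<in> normal_fan P. \<sigma> \<subseteq> \<sigma>'}"
    then obtain E where E: "\<sigma>' = normal_cone P E" "E face_of P" "E \<noteq> {}" "\<sigma> \<subseteq> \<sigma>'" unfolding normal_fan_def by blast
    thus "normal_cone P (cone_face \<sigma>) \<subseteq> \<sigma>'" using subset_normal_cone_iff[OF assms E(2,3)] normal_cone_antimono by blast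
  qed
qed

text \<open>The orthogonal complement of the direction space of E, for a nonempty face the linear
  span of its normal cone.\<close>

definition const_dirs where "const_dirs E = {u. \<forall>m\<in>E. \<forall>m'\<in>E. m \<bullet> u = m' \<bullet> u}"

lemma espI: "(\<And>m m'. m \<in> E \<Longrightarrow> m' \<in> E \<Longrightarrow> m \<bullet> u = m' \<bullet> u) \<Longrightarrow> u \<in> const_dirs E"
  unfolding const_dirs_def by blast

lemma espD: "u \<in> const_dirs E \<Longrightarrow> m \<in> E \<Longrightarrow> m' \<in> E \<Longrightarrow> m \<bullet> u = m' \<bullet> u"
  unfolding const_dirs_def by blast

lemma min_face_const_dirs: "E \<subseteq> min_face u \<Longrightarrow> u \<in> const_dirs E"
  by (rule espI) (auto simp: min_face_def subset_iff)

text \<open>The relative interior of the normal cone of \<open>E\<close>.\<close>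

definition open_normal_cone where "open_normal_cone E = {u. min_face u = E}"

text \<open>A description by linear equations and finitely many strict inequalities, from which
  convexity, relative openness and dimension can be read off.\<close>

lemma open_normal_cone_iff:
  assumes E: "E face_of P" "m0 \<in> E"
  shows "u \<in> open_normal_cone E \<longleftrightarrow> u \<in> const_dirs E \<and> (\<forall>v\<in>V - E. v \<bullet> u > m0 \<bullet> u)"
proof
  assume u: "u \<in> open_normal_cone E"
  hence e: "min_face u = E" by (simp add: open_normal_cone_def)
  have m0: "m0 \<bullet> u = psi u" using E(2) e by (auto simp: min_face_def)
  have "u \<in> const_dirs E" using e by (intro min_face_const_dirs) simp
  moreover have "v \<bullet> u > m0 \<bullet> u" if "v \<in> V - E" for v
  proof -
    have "v \<bullet> u \<noteq> psi u" using that e V_sub_P by (auto simp: min_face_def)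
    thus ?thesis using V_ge[of v u] that m0 by auto
  qed
  ultimately show "u \<in> const_dirs E \<and> (\<forall>v\<in>V - E. v \<bullet> u > m0 \<bullet> u)" by blast
next
  assume u: "u \<in> const_dirs E \<and> (\<forall>v\<in>V - E. v \<bullet> u > m0 \<bullet> u)"
  have EP: "E \<subseteq> P" using E(1) by (rule face_of_imp_subset)
  have all: "m \<bullet> u = m0 \<bullet> u" if "m \<in> E" for m using espD[OF conjunct1[OF u] that E(2)] .
  obtain v where v: "v \<in> V" "v \<bullet> u = psi u" using V_eq by blast
  have "psi u \<le> m0 \<bullet> u" using EP E(2) P_iff by blast
  have "v \<in> E"
  proof (rule ccontr)
    assume "v \<notin> E"
    hence "m0 \<bullet> u < v \<bullet> u" using u v(1) by blast
    thus False using v(2) \<open>psi u \<le> m0 \<bullet> u\<close> by simp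
  qed
  hence m0: "m0 \<bullet> u = psi u" using all v by simp
  have "E \<subseteq> min_face u" using EP all m0 by (auto simp: min_face_def)
  moreover have "min_face u \<subseteq> E"
  proof -
    have "compact V" using finite_V by (rule finite_imp_compact)
    moreover have "min_face u face_of convex hull V" using min_face_face P_eq_hull by simp
    \<comment> \<open>A face of the hull of V is the hull of points of V; these are minimal in
      direction u and therefore in E.\<close>
    ultimately obtain V' where V': "V' \<subseteq> V" "min_face u = convex hull V'"
      using face_of_convex_hull_subset by metis
    have "V' \<subseteq> E"
    proof
      fix w assume w: "w \<in> V'"
      hence "w \<in> min_face u" using V'(2) hull_inc by metis
      hence "w \<bullet> u = m0 \<bullet> u" using m0 by (simp add: min_face_def)
      thus "w \<in> E" using u w V'(1) by (metis DiffI order_less_irrefl subsetD)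
    qed
    thus ?thesis unfolding V'(2) using face_of_imp_convex[OF E(1)] by (simp add: hull_minimal)
  qed
  ultimately show "u \<in> open_normal_cone E" by (auto simp: open_normal_cone_def)
qed

lemma subspace_const_dirs: "subspace (const_dirs E)"
  unfolding subspace_def
proof (intro conjI ballI allI)
  show "0 \<in> const_dirs E" by (rule espI) simp
  fix x y assume xy: "x \<in> const_dirs E" "y \<in> const_dirs E"
  show "x + y \<in> const_dirs E"
    by (rule espI) (simp only: inner_add_right, intro arg_cong2[where f = "(+)"] espD[OF xy(1)] espD[OF xy(2)])
next
  fix c x assume x: "x \<in> const_dirs E"
  show "c *\<^sub>R x \<in> const_dirs E"
    by (rule espI) (simp only: inner_scaleR_right, intro arg_cong2[where f = "(*)"] refl espD[OF x])
qed

lemma open_normal_cone_open: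
  assumes E: "E face_of P" "E \<noteq> {}"
  shows "\<exists>U. open U \<and> convex U \<and> open_normal_cone E = const_dirs E \<inter> U"
proof -
  obtain m0 where m0: "m0 \<in> E" using E by blast
  let ?U = "\<Inter>v\<in>V - E. {u. (m0 - v) \<bullet> u < 0}"
  have "open_normal_cone E = const_dirs E \<inter> ?U" using open_normal_cone_iff[OF E(1) m0] by (auto simp: inner_diff_left)
  moreover have "open ?U" using finite_V by (intro open_INT) (auto simp: open_halfspace_lt)
  moreover have "convex ?U" by (intro convex_INT) (auto simp: convex_halfspace_lt)
  ultimately show ?thesis by blast
qed

lemma open_normal_cone_props:
  assumes E: "E face_of P" "E \<noteq> {}"
  shows "convex (open_normal_cone E)" "relatively_open (open_normal_cone E)" "open_normal_cone E \<noteq> {}" "aff_dim (open_normal_cone E) = int (dim (const_dirs E))" "open_normal_cone E \<subseteq> const_dirs E"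
proof -
  obtain U where U: "open U" "convex U" "open_normal_cone E = const_dirs E \<inter> U" using open_normal_cone_open[OF E] by blast
  show "convex (open_normal_cone E)" unfolding U(3) using U(2) subspace_imp_convex[OF subspace_const_dirs] by (intro convex_Int)
  have ro: "relatively_open (const_dirs E)" using subspace_imp_affine[OF subspace_const_dirs] by (rule relatively_open_affine)
  show "relatively_open (open_normal_cone E)" unfolding U(3) by (intro relatively_open_Int ro relatively_open_open U)
  show ne: "open_normal_cone E \<noteq> {}" using face_is_min_face[OF E] by (auto simp: open_normal_cone_def)
  show "aff_dim (open_normal_cone E) = int (dim (const_dirs E))"
    using aff_dim_Int_open[OF ro U(1)] ne aff_dim_subspace[OF subspace_const_dirs] unfolding U(3) by metis
  show "open_normal_cone E \<subseteq> const_dirs E" using U by blast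
qed

lemma normal_cone_closure:
  assumes E: "E face_of P" "E \<noteq> {}" and u: "u \<in> normal_cone P E"
  shows "u \<in> closure (open_normal_cone E)"
proof -
  obtain m0 where m0: "m0 \<in> E" using E by blast
  have EP: "E \<subseteq> P" using E(1) by (rule face_of_imp_subset)
  obtain w where w: "w \<in> open_normal_cone E" using open_normal_cone_props(3)[OF E] by blast
  note W = open_normal_cone_iff[OF E(1) m0, THEN iffD1, OF w]
  have um: "E \<subseteq> min_face u" using u normal_cone_iff[OF EP E(2)] by blast
  have k: "u + t *\<^sub>R w \<in> open_normal_cone E" if t: "t > 0" for t
  proof -
    have "u + t *\<^sub>R w \<in> const_dirs E"
      using W min_face_const_dirs[OF um] subspace_const_dirs by (intro subspace_add subspace_scale) auto
    moreover have "v \<bullet> (u + t *\<^sub>R w) > m0 \<bullet> (u + t *\<^sub>R w)" if v: "v \<in> V - E" for v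
    proof -
      have "m0 \<bullet> u \<le> v \<bullet> u" using V_ge[of v u] v um m0 by (auto simp: min_face_def)
      moreover have "t * (m0 \<bullet> w) < t * (v \<bullet> w)" using W v t by simp
      ultimately show ?thesis by (simp add: inner_add_right)
    qed
    ultimately show ?thesis using open_normal_cone_iff[OF E(1) m0] by blast
  qed
  show ?thesis by (rule closure_ray[OF k])
qed

text \<open>The orbit of X_D labelled by E has dimension dim E: the normal cone has full dimension
  in \<open>const_dirs E\<close> because it contains a nonempty relatively open part of it.\<close>

lemma dim_const_dirs:
  assumes E: "E face_of P" "E \<noteq> {}"
  shows "int (dim (const_dirs E)) + aff_dim E = int CARD('n)" "orbit_dim (normal_cone P E) = nat (aff_dim E)"
proof -
  obtain m0 where m0: "m0 \<in> E" using E by blast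
  let ?W = "(\<lambda>m. m - m0) ` E"
  have dW: "aff_dim E = int (dim ?W)" using aff_dim_eq_dim[of m0 E] m0 by (simp add: hull_inc)
  have "const_dirs E = perp ?W"
  proof (intro set_eqI iffI)
    fix u assume ue: "u \<in> const_dirs E"
    have "m \<bullet> u = m0 \<bullet> u" if "m \<in> E" for m by (rule espD[OF ue that m0])
    thus "u \<in> perp ?W" by (auto simp: perp_def inner_diff_right inner_commute[of u])
  next
    fix u assume "u \<in> perp ?W"
    hence "\<And>m. m \<in> E \<Longrightarrow> m \<bullet> u = m0 \<bullet> u" by (auto simp: perp_def inner_diff_right inner_commute[of u])
    thus "u \<in> const_dirs E" by (intro espI) (metis)
  qed
  thus i: "int (dim (const_dirs E)) + aff_dim E = int CARD('n)" using dim_perp[of ?W] dW by simp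
  have EP: "E \<subseteq> P" using E(1) by (rule face_of_imp_subset)
  have "normal_cone P E \<subseteq> const_dirs E" using normal_cone_iff[OF EP E(2)] min_face_const_dirs by blast
  moreover have "open_normal_cone E \<subseteq> normal_cone P E" using normal_cone_iff[OF EP E(2)] by (auto simp: open_normal_cone_def)
  moreover have "aff_dim (open_normal_cone E) \<le> int (dim (open_normal_cone E))"
    using aff_dim_subset[OF span_superset[of "open_normal_cone E"]] by (simp add: aff_dim_subspace)
  ultimately have "dim (normal_cone P E) = dim (const_dirs E)"
    using open_normal_cone_props(4)[OF E] dim_subset[of "open_normal_cone E" "normal_cone P E"] dim_subset[of "normal_cone P E" "const_dirs E"] by simp
  thus "orbit_dim (normal_cone P E) = nat (aff_dim E)"
    using i dim_perp[of "normal_cone P E"] by (simp add: orbit_dim_def)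
qed

text \<open>The fan refines the normal fan: the minimizing face is constant on the relative interior
  of a cone.\<close>

lemma open_normal_cone_meets:
  assumes "\<sigma> \<in> \<Sigma>"
  shows "cone_face \<sigma> = E \<Longrightarrow> rel_interior \<sigma> \<inter> open_normal_cone E = rel_interior \<sigma>"
    and "cone_face \<sigma> \<noteq> E \<Longrightarrow> rel_interior \<sigma> \<inter> open_normal_cone E = {}"
  using cone_face_eq[OF assms] by (auto simp: open_normal_cone_def)

lemma rel_interior_face_zero:
  assumes E: "E face_of P" and m: "m \<in> rel_interior E"
  shows "m \<bullet> u = psi u \<longleftrightarrow> u \<in> normal_cone P E"
proof -
  have EP: "E \<subseteq> P" and mE: "m \<in> E" using E face_of_imp_subset m rel_interior_subset by blast+
  have "E \<noteq> {}" using mE by blast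
  note n = normal_cone_iff[OF EP this, of u]
  show ?thesis
  proof
    assume "m \<bullet> u = psi u"
    hence "m \<in> min_face u" using mE EP by (auto simp: min_face_def)
    hence "E \<subseteq> min_face u" using subset_of_face_of[OF min_face_face EP] m by blast
    thus "u \<in> normal_cone P E" using n by blast
  next
    assume "u \<in> normal_cone P E"
    thus "m \<bullet> u = psi u" using n mE by (auto simp: min_face_def)
  qed
qed

end

subsection \<open>Moebius inversion on the fan\<close>

text \<open>Descending induction from the maximal sets: the sums over all larger sets determine a
  function. This replaces an explicit Moebius function.\<close>

lemma moebius_unique:
  fixes g h :: "'a set \<Rightarrow> int"
  assumes "finite A" and eq: "\<And>\<tau>. \<tau> \<in> A \<Longrightarrow> (\<Sum>\<sigma>\<in>{\<sigma>\<in>A. \<tau> \<subseteq> \<sigma>}. g \<sigma>) = (\<Sum>\<sigma>\<in>{\<sigma>\<in>A. \<tau> \<subseteq> \<sigma>}. h \<sigma>)"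
    and "\<tau> \<in> A"
  shows "g \<tau> = h \<tau>"
  using assms(3)
proof (induction "card {\<sigma>\<in>A. \<tau> \<subset> \<sigma>}" arbitrary: \<tau> rule: less_induct)
  case less
  have "g \<sigma> = h \<sigma>" if \<sigma>: "\<sigma> \<in> A" "\<tau> \<subset> \<sigma>" for \<sigma>
  proof (rule less.hyps[OF _ \<sigma>(1)])
    have "{\<rho>\<in>A. \<sigma> \<subset> \<rho>} \<subset> {\<rho>\<in>A. \<tau> \<subset> \<rho>}" using \<sigma> by blast
    thus "card {\<rho>\<in>A. \<sigma> \<subset> \<rho>} < card {\<rho>\<in>A. \<tau> \<subset> \<rho>}" using assms(1) by (intro psubset_card_mono) auto
  qed
  hence "(\<Sum>\<sigma>\<in>{\<sigma>\<in>A. \<tau> \<subset> \<sigma>}. g \<sigma>) = (\<Sum>\<sigma>\<in>{\<sigma>\<in>A. \<tau> \<subset> \<sigma>}. h \<sigma>)" by (intro sum.cong) auto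
  moreover have "{\<sigma>\<in>A. \<tau> \<subseteq> \<sigma>} = insert \<tau> {\<sigma>\<in>A. \<tau> \<subset> \<sigma>}" using less.prems by blast
  ultimately show ?case using eq[OF less.prems] assms(1) by simp
qed

lemma alternating_subset_sum:
  assumes "finite A" "A \<noteq> {}"
  shows "(\<Sum>T | T \<subseteq> A \<and> T \<noteq> {}. (-1) ^ (card T + 1)) = (1::int)"
proof -
  obtain x B where A: "A = insert x B" "x \<notin> B" using assms(2) by (meson Set.set_insert ex_in_conv)
  have fB: "finite B" using assms(1) A by simp
  have inj: "inj_on (insert x) (Pow B)" using A(2) by (auto simp: inj_on_def)
  have "(\<Sum>T\<in>insert x ` Pow B. (-1) ^ card T) = (\<Sum>T\<in>Pow B. - ((-1) ^ card T) :: int)"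
    using A(2) fB finite_subset[OF _ fB] by (subst sum.reindex[OF inj]) (auto intro!: sum.cong simp: card_insert_if subset_iff)
  moreover have "(\<Sum>T\<in>Pow A. (-1) ^ card T) = (\<Sum>T\<in>Pow B. (-1) ^ card T) + (\<Sum>T\<in>insert x ` Pow B. (-1) ^ card T :: int)"
    unfolding A(1) Pow_insert using fB A(2) by (intro sum.union_disjoint) auto
  ultimately have "(\<Sum>T\<in>Pow A. (-1) ^ card T) = (0::int)" by (simp add: sum_negf)
  moreover have "Pow A = insert {} {T. T \<subseteq> A \<and> T \<noteq> {}}" by auto
  moreover have "finite {T. T \<subseteq> A \<and> T \<noteq> {}}" using assms(1) by simp
  ultimately have "(\<Sum>T | T \<subseteq> A \<and> T \<noteq> {}. (-1) ^ card T) = (-1::int)" by simp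
  thus ?thesis by (simp add: sum_negf)
qed

text \<open>n + dim O_\<sigma> has the parity of dim \<sigma> = n - dim O_\<sigma>; the sum avoids
  subtraction and splits off a factor common to all cones.\<close>

lemma cell_sign_cone:
  fixes \<sigma> :: "(real ^ 'n::finite) set"
  assumes "fan \<Sigma>" "\<sigma> \<in> \<Sigma>"
  shows "cell_sign (rel_interior \<sigma>) = (-1) ^ (CARD('n) + orbit_dim \<sigma>)"
proof -
  have "aff_dim (rel_interior \<sigma>) = aff_dim \<sigma>"
    using rel_interior_same_affine_hull[OF fan_cone(5)[OF assms]] by (metis aff_dim_affine_hull)
  also have "\<dots> = int (dim \<sigma>)" using fan_cone(7)[OF assms] by (intro aff_dim_zero) (simp add: hull_inc)
  finally have "cell_sign (rel_interior \<sigma>) = (-1) ^ dim \<sigma>"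
    using fan_rel_interior_nonempty[OF assms] by (simp add: cell_sign_def)
  also have "\<dots> = (-1) ^ (CARD('n) + orbit_dim \<sigma>)"
    using dim_perp[of \<sigma>] unfolding orbit_dim_def by (metis (no_types, lifting) add.assoc even_add minus_one_power_iff mult_2 even_mult_iff even_numeral)
  finally show ?thesis .
qed

lemma cell_sign_UNIV: "cell_sign (UNIV :: (real ^ 'n::finite) set) = (-1) ^ CARD('n)"
  by (simp add: cell_sign_def aff_dim_UNIV)

lemma fan_star_codim_sum:
  fixes \<Sigma> :: "(real ^ 'n::finite) set set"
  assumes cf: "complete_fan \<Sigma>" and \<tau>: "\<tau> \<in> \<Sigma>"
  shows "(\<Sum>\<sigma>\<in>{\<sigma>\<in>\<Sigma>. \<tau> \<subseteq> \<sigma>}. (-1) ^ orbit_dim \<sigma>) = (1::int)"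
proof -
  have is_fan: "fan \<Sigma>" using cf by (simp add: complete_fan_def)
  obtain x where "x \<in> rel_interior \<tau>" using fan_rel_interior_nonempty[OF is_fan \<tau>] by blast
  hence "(\<Sum>\<sigma>\<in>{\<sigma>\<in>\<Sigma>. \<tau> \<subseteq> \<sigma>}. cell_sign (rel_interior \<sigma> \<inter> UNIV)) = cell_sign (UNIV :: (real ^ 'n) set)"
    using fan_star_euler[OF cf \<tau> convex_UNIV relatively_open_open[OF open_UNIV]] by simp
  hence "(\<Sum>\<sigma>\<in>{\<sigma>\<in>\<Sigma>. \<tau> \<subseteq> \<sigma>}. (-1) ^ CARD('n) * (-1) ^ orbit_dim \<sigma>) = ((-1) ^ CARD('n) :: int)"
    using cell_sign_cone[OF is_fan] by (simp add: cell_sign_UNIV power_add)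
  hence "(-1) ^ CARD('n) * (\<Sum>\<sigma>\<in>{\<sigma>\<in>\<Sigma>. \<tau> \<subseteq> \<sigma>}. (-1) ^ orbit_dim \<sigma>) = ((-1) ^ CARD('n) :: int)"
    by (simp only: sum_distrib_left)
  thus ?thesis by simp
qed

lemma fan_Inter_mem:
  assumes is_fan: "fan \<Sigma>" shows "T \<subseteq> \<Sigma> \<Longrightarrow> T \<noteq> {} \<Longrightarrow> \<Inter>T \<in> \<Sigma>"
proof -
  have "\<Inter>T \<in> \<Sigma>" if "finite T" "T \<noteq> {}" "T \<subseteq> \<Sigma>" for T
    using that
  proof (induction T rule: finite_ne_induct)
    case (insert \<sigma> T)
    hence i: "\<Inter>T \<in> \<Sigma>" "\<sigma> \<in> \<Sigma>" by auto
    have "\<sigma> \<inter> \<Inter>T \<noteq> {}" using fan_cone(7)[OF is_fan i(1)] fan_cone(7)[OF is_fan i(2)] by blast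
    thus ?case using fan_face[OF is_fan i(2) fan_Int_face[OF is_fan i(2,1)]] by simp
  qed simp
  thus "T \<subseteq> \<Sigma> \<Longrightarrow> T \<noteq> {} \<Longrightarrow> \<Inter>T \<in> \<Sigma>" using fan_finite[OF is_fan] finite_subset by blast
qed

text \<open>Here \<mu> \<sigma> is the signed number of sets of cones with intersection \<sigma>.
  Its sum over all \<sigma> \<supseteq> \<tau> is the alternating count of nonempty subsets of the
  star of \<tau>, which is 1, just as for the sign (-1)^(dim O_\<sigma>).\<close>

lemma nerve_sum:
  fixes \<Sigma> :: "(real ^ 'n::finite) set set" and g :: "(real ^ 'n) set \<Rightarrow> int"
  assumes cf: "complete_fan \<Sigma>"
  shows "(\<Sum>T | T \<subseteq> \<Sigma> \<and> T \<noteq> {}. (-1) ^ (card T + 1) * g (\<Inter>T)) = (\<Sum>\<sigma>\<in>\<Sigma>. (-1) ^ orbit_dim \<sigma> * g \<sigma>)"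
proof -
  have is_fan: "fan \<Sigma>" using cf by (simp add: complete_fan_def)
  note fin = fan_finite[OF is_fan]
  let ?S = "{T. T \<subseteq> \<Sigma> \<and> T \<noteq> {}}"
  define \<mu> :: "(real ^ 'n) set \<Rightarrow> int" where "\<mu> \<sigma> = (\<Sum>T\<in>{T\<in>?S. \<Inter>T = \<sigma>}. (-1) ^ (card T + 1))" for \<sigma>
  have fS: "finite ?S" using fin by simp
  have \<mu>: "\<mu> \<tau> = (-1) ^ orbit_dim \<tau>" if "\<tau> \<in> \<Sigma>" for \<tau>
  proof (rule moebius_unique[OF fin _ that])
    fix \<tau> assume \<tau>: "\<tau> \<in> \<Sigma>"
    let ?U = "{\<sigma>\<in>\<Sigma>. \<tau> \<subseteq> \<sigma>}"
    let ?S' = "{T. T \<subseteq> ?U \<and> T \<noteq> {}}"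
    have fU: "finite ?U" using fin by simp
    have fS': "finite ?S'" using fU by simp
    have im: "Inter ` ?S' \<subseteq> ?U"
    proof
      fix \<sigma> assume "\<sigma> \<in> Inter ` ?S'"
      then obtain T where T: "\<sigma> = \<Inter>T" "T \<subseteq> ?U" "T \<noteq> {}" by blast
      have "T \<subseteq> \<Sigma>" using T(2) by blast
      thus "\<sigma> \<in> ?U" using fan_Inter_mem[OF is_fan _ T(3)] T by blast
    qed
    have "(\<Sum>\<sigma>\<in>?U. \<mu> \<sigma>) = (\<Sum>\<sigma>\<in>?U. \<Sum>T\<in>{T\<in>?S'. \<Inter>T = \<sigma>}. (-1) ^ (card T + 1))"
      unfolding \<mu>_def
    proof (rule sum.cong[OF refl])
      fix \<sigma> assume \<sigma>: "\<sigma> \<in> ?U"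
      \<comment> \<open>An intersection contains \<tau> iff every member does.\<close>
      have "{T\<in>?S. \<Inter>T = \<sigma>} = {T\<in>?S'. \<Inter>T = \<sigma>}" using \<sigma> by blast
      thus "(\<Sum>T\<in>{T\<in>?S. \<Inter>T = \<sigma>}. (-1) ^ (card T + 1)) = (\<Sum>T\<in>{T\<in>?S'. \<Inter>T = \<sigma>}. (-1 :: int) ^ (card T + 1))" by simp
    qed
    also have "\<dots> = (\<Sum>T\<in>?S'. (-1) ^ (card T + 1))" by (rule sum.group[OF fS' fU im])
    also have "\<dots> = 1" using \<tau> by (intro alternating_subset_sum[OF fU]) blast
    also have "\<dots> = (\<Sum>\<sigma>\<in>?U. (-1) ^ orbit_dim \<sigma>)" using fan_star_codim_sum[OF cf \<tau>] by simp
    finally show "(\<Sum>\<sigma>\<in>?U. \<mu> \<sigma>) = (\<Sum>\<sigma>\<in>?U. (-1) ^ orbit_dim \<sigma>)" .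
  qed
  have im: "Inter ` ?S \<subseteq> \<Sigma>" using fan_Inter_mem[OF is_fan] by blast
  have "(\<Sum>T\<in>?S. (-1) ^ (card T + 1) * g (\<Inter>T)) = (\<Sum>\<sigma>\<in>\<Sigma>. \<Sum>T\<in>{T\<in>?S. \<Inter>T = \<sigma>}. (-1) ^ (card T + 1) * g (\<Inter>T))"
    by (rule sum.group[OF fS fin im, symmetric])
  also have "\<dots> = (\<Sum>\<sigma>\<in>\<Sigma>. \<mu> \<sigma> * g \<sigma>)"
    unfolding \<mu>_def sum_distrib_right by (intro sum.cong refl) auto
  also have "\<dots> = (\<Sum>\<sigma>\<in>\<Sigma>. (-1) ^ orbit_dim \<sigma> * g \<sigma>)" using \<mu> by (intro sum.cong) auto
  finally show ?thesis .
qed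

context gg_divisor
begin

section \<open>Weight spaces of the twisted forms\<close>

lemma dual_iff: "\<sigma> \<in> \<Sigma> \<Longrightarrow> rvec (m - md \<sigma>) \<in> dual_cone \<sigma> \<longleftrightarrow> (\<forall>u\<in>\<sigma>. psi u \<le> rvec m \<bullet> u)"
  using psi_eq by (auto simp: dual_cone_def rvec_diff inner_diff_left)

definition zero_locus where "zero_locus m = {u. rvec m \<bullet> u = psi u}"

lemma face_at_zero_locus:
  assumes "\<sigma> \<in> \<Sigma>" "\<forall>u\<in>\<sigma>. psi u \<le> rvec m \<bullet> u"
  shows "face_at \<sigma> (m - md \<sigma>) = \<sigma> \<inter> zero_locus m" "\<sigma> \<inter> zero_locus m \<in> \<Sigma>"
proof -
  have d: "rvec (m - md \<sigma>) \<in> dual_cone \<sigma>" using dual_iff[OF assms(1)] assms(2) by blast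
  note F = face_at_eq[OF fan_cone(1)[OF is_fan assms(1)] d]
  show e: "face_at \<sigma> (m - md \<sigma>) = \<sigma> \<inter> zero_locus m"
    unfolding F(1) zero_locus_def using psi_eq[OF assms(1)] by (auto simp: rvec_diff inner_diff_left)
  show "\<sigma> \<inter> zero_locus m \<in> \<Sigma>" using fan_face[OF is_fan assms(1) F(2,3)] e by simp
qed

definition fiber where
  "fiber \<Sigma>Z p \<sigma> m = (if rvec (m - md \<sigma>) \<in> dual_cone \<sigma> \<and> face_at \<sigma> (m - md \<sigma>) \<in> \<Sigma>Z
     then ext_power p (perp_lattice (face_at \<sigma> (m - md \<sigma>))) else {0})"

lemma twisted_forms_eq:
  "twisted_forms a \<Sigma>Z p \<sigma> = {s. finite {m. \<exists>b. s (m, b) \<noteq> 0} \<and> (\<forall>m. (\<lambda>b. s (m, b)) \<in> fiber \<Sigma>Z p \<sigma> m)}"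
proof (intro set_eqI)
  fix s :: "'n form_section"
  let ?d = "md \<sigma>"
  have "{m. \<exists>us. s (m + ?d, us) \<noteq> 0} = (\<lambda>m. m - ?d) ` {m. \<exists>us. s (m, us) \<noteq> 0}"
    by (force simp: image_iff)
  hence fin: "finite {m. \<exists>us. s (m + ?d, us) \<noteq> 0} \<longleftrightarrow> finite {m. \<exists>us. s (m, us) \<noteq> 0}"
    by (simp add: finite_image_iff inj_on_def)
  have "(\<forall>m. if rvec m \<in> dual_cone \<sigma> \<and> face_at \<sigma> m \<in> \<Sigma>Z then (\<lambda>us. s (m + ?d, us)) \<in> ext_power p (perp_lattice (face_at \<sigma> m))
       else (\<lambda>us. s (m + ?d, us)) = 0) \<longleftrightarrow> (\<forall>m. (\<lambda>us. s (m + ?d, us)) \<in> fiber \<Sigma>Z p \<sigma> (m + ?d))"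
    by (simp add: fiber_def)
  also have "\<dots> \<longleftrightarrow> (\<forall>m. (\<lambda>b. s (m, b)) \<in> fiber \<Sigma>Z p \<sigma> m)"
    by (metis diff_add_cancel)
  finally show "s \<in> twisted_forms a \<Sigma>Z p \<sigma> \<longleftrightarrow> s \<in> {s. finite {m. \<exists>b. s (m, b) \<noteq> 0} \<and> (\<forall>m. (\<lambda>b. s (m, b)) \<in> fiber \<Sigma>Z p \<sigma> m)}"
    unfolding twisted_forms_def ishida_forms_def mem_Collect_eq prod.case fin by blast
qed

text \<open>In terms of \<open>psi\<close> the weight space no longer involves the choice of the
  Cartier datum.\<close>

lemma fiber_eq:
  assumes "\<sigma> \<in> \<Sigma>"
  shows "fiber \<Sigma>Z p \<sigma> m = (if (\<forall>u\<in>\<sigma>. psi u \<le> rvec m \<bullet> u) \<and> \<sigma> \<inter> zero_locus m \<in> \<Sigma>Z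
     then ext_power p (perp_lattice (\<sigma> \<inter> zero_locus m)) else {0})"
  unfolding fiber_def dual_iff[OF assms] using face_at_zero_locus[OF assms] by auto

lemma subspace_fiber: "fun_vs.subspace (fiber \<Sigma>Z p \<sigma> m)"
  by (simp add: fiber_def subspace_ext_power)

text \<open>Passing to a smaller cone shrinks the zero face and enlarges its orthogonal lattice,
  hence the exterior power. Functoriality rests on \<open>up\<close>: if the zero face of the
  smallest cone belongs to Z, so does the larger zero face of the intermediate one.\<close>

lemma cech_system_fiber:
  assumes up: "\<And>\<sigma> \<tau>. \<tau> \<in> \<Sigma>Z \<Longrightarrow> \<sigma> \<in> \<Sigma> \<Longrightarrow> \<tau> \<subseteq> \<sigma> \<Longrightarrow> \<sigma> \<in> \<Sigma>Z" and sub: "\<Sigma>Z \<subseteq> \<Sigma>"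
  shows "cech_system \<Sigma> (fiber \<Sigma>Z p) (\<lambda>\<tau> m. face_at \<tau> (m - md \<tau>) \<in> \<Sigma>Z) (twisted_forms a \<Sigma>Z p) (twisted_restrict a \<Sigma>Z)"
proof
  show "finite \<Sigma>" by (rule fan_finite[OF is_fan])
  show "\<Inter>T \<in> \<Sigma>" if "T \<subseteq> \<Sigma>" "T \<noteq> {}" for T using fan_Inter_mem[OF is_fan that] .
  show "fun_vs.subspace (fiber \<Sigma>Z p \<sigma> m)" for \<sigma> m
    by (rule subspace_fiber)
  show "\<exists>T. finite T \<and> fiber \<Sigma>Z p \<sigma> m \<subseteq> fun_vs.span T" if \<sigma>: "\<sigma> \<in> \<Sigma>" for \<sigma> m
  proof (cases "(\<forall>u\<in>\<sigma>. psi u \<le> rvec m \<bullet> u) \<and> \<sigma> \<inter> zero_locus m \<in> \<Sigma>Z")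
    case True
    thus ?thesis unfolding fiber_eq[OF \<sigma>] using dim_ext_power(2)[OF fan_cone(1)[OF is_fan]] sub by auto
  next
    case False
    thus ?thesis unfolding fiber_eq[OF \<sigma>] by (intro exI[of _ "{}"]) (auto simp: fun_vs.span_empty)
  qed
  show "twisted_forms a \<Sigma>Z p \<sigma> = {s. finite {m. \<exists>b. s (m, b) \<noteq> 0} \<and> (\<forall>m. (\<lambda>b. s (m, b)) \<in> fiber \<Sigma>Z p \<sigma> m)}" for \<sigma>
    by (rule twisted_forms_eq)
  show "twisted_restrict a \<Sigma>Z \<tau> s = (\<lambda>(m, b). if face_at \<tau> (m - md \<tau>) \<in> \<Sigma>Z then s (m, b) else 0)" for \<tau> s
    by (simp add: twisted_restrict_def)
  show "fiber \<Sigma>Z p \<sigma> m \<subseteq> fiber \<Sigma>Z p \<tau> m"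
    if h: "\<sigma> \<in> \<Sigma>" "\<tau> \<in> \<Sigma>" "\<tau> \<subseteq> \<sigma>" "face_at \<tau> (m - md \<tau>) \<in> \<Sigma>Z" for \<sigma> \<tau> m
  proof (cases "(\<forall>u\<in>\<sigma>. psi u \<le> rvec m \<bullet> u) \<and> \<sigma> \<inter> zero_locus m \<in> \<Sigma>Z")
    case True
    hence ge: "\<forall>u\<in>\<tau>. psi u \<le> rvec m \<bullet> u" using h(3) by blast
    have tZ: "\<tau> \<inter> zero_locus m \<in> \<Sigma>Z" using h(4) face_at_zero_locus[OF h(2) ge] by simp
    have "ext_power p (perp_lattice (\<sigma> \<inter> zero_locus m)) \<subseteq> ext_power p (perp_lattice (\<tau> \<inter> zero_locus m))"
      using h(3) by (intro ext_power_mono perp_lattice_antimono) blast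
    thus ?thesis unfolding fiber_eq[OF h(1)] fiber_eq[OF h(2)] using True ge tZ by simp
  next
    case False
    hence "fiber \<Sigma>Z p \<sigma> m = {0}" unfolding fiber_eq[OF h(1)] by auto
    moreover have "0 \<in> fiber \<Sigma>Z p \<tau> m"
      by (rule fun_vs.subspace_0[OF subspace_fiber])
    ultimately show ?thesis by simp
  qed
  show "face_at \<tau> (m - md \<tau>) \<in> \<Sigma>Z"
    if h: "\<sigma> \<in> \<Sigma>" "\<tau> \<in> \<Sigma>" "\<kappa> \<in> \<Sigma>" "\<tau> \<subseteq> \<sigma>" "\<kappa> \<subseteq> \<tau>" "face_at \<kappa> (m - md \<kappa>) \<in> \<Sigma>Z" "w \<in> fiber \<Sigma>Z p \<sigma> m" "w \<noteq> 0" for \<sigma> \<tau> \<kappa> m w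
  proof -
    have ge: "\<forall>u\<in>\<sigma>. psi u \<le> rvec m \<bullet> u" using h(7,8) unfolding fiber_eq[OF h(1)] by (auto split: if_splits)
    have ge1: "\<forall>u\<in>\<tau>. psi u \<le> rvec m \<bullet> u" and ge2: "\<forall>u\<in>\<kappa>. psi u \<le> rvec m \<bullet> u" using ge h(4,5) by blast+
    note t = face_at_zero_locus[OF h(2) ge1] and k = face_at_zero_locus[OF h(3) ge2]
    have "\<kappa> \<inter> zero_locus m \<in> \<Sigma>Z" using h(6) k by simp
    moreover have "\<kappa> \<inter> zero_locus m \<subseteq> \<tau> \<inter> zero_locus m" using h(5) by blast
    ultimately show ?thesis unfolding t(1) using up t(2) by blast
  qed
qed

text \<open>It turns out to be the coefficient of the exponential of \<open>s(m)\<close> in the equivariant Euler characteristic.\<close>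

definition weight_coeff where "weight_coeff \<Sigma>Z p m = (\<Sum>\<sigma>\<in>\<Sigma>. (-1) ^ orbit_dim \<sigma> * int (fun_vs.dim (fiber \<Sigma>Z p \<sigma> m)))"

lemma weight_euler:
  assumes "\<And>\<sigma> \<tau>. \<tau> \<in> \<Sigma>Z \<Longrightarrow> \<sigma> \<in> \<Sigma> \<Longrightarrow> \<tau> \<subseteq> \<sigma> \<Longrightarrow> \<sigma> \<in> \<Sigma>Z" "\<Sigma>Z \<subseteq> \<Sigma>"
  shows "(\<Sum>i<card \<Sigma>. (-1) ^ i * int (weight_dim \<Sigma> (twisted_forms a \<Sigma>Z p) (twisted_restrict a \<Sigma>Z) i m)) = weight_coeff \<Sigma>Z p (- m)"
proof -
  interpret cech_system \<Sigma> "fiber \<Sigma>Z p" "\<lambda>\<tau> m. face_at \<tau> (m - md \<tau>) \<in> \<Sigma>Z" "twisted_forms a \<Sigma>Z p" "twisted_restrict a \<Sigma>Z"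
    by (rule cech_system_fiber) (use assms in blast)+
  have "(\<Sum>T | T \<subseteq> \<Sigma> \<and> T \<noteq> {}. (-1) ^ (card T + 1) * int (fun_vs.dim (fiber \<Sigma>Z p (\<Inter>T) (- m)))) = weight_coeff \<Sigma>Z p (- m)"
    unfolding weight_coeff_def by (rule nerve_sum[OF cf])
  thus ?thesis by (rule HOL.trans[OF euler_characteristic])
qed

section \<open>Counting the cones with a given zero face\<close>

definition nonneg_cones where "nonneg_cones m = {\<sigma>\<in>\<Sigma>. \<forall>u\<in>\<sigma>. psi u \<le> rvec m \<bullet> u}"

definition fibre_sum :: "int ^ 'n \<Rightarrow> (real ^ 'n) set \<Rightarrow> int" where
  "fibre_sum m \<tau> = (\<Sum>\<sigma>\<in>{\<sigma>\<in>nonneg_cones m. \<sigma> \<inter> zero_locus m = \<tau>}. (-1) ^ orbit_dim \<sigma>)"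

lemma weight_coeff_fibre_sum:
  assumes "\<Sigma>Z \<subseteq> \<Sigma>"
  shows "weight_coeff \<Sigma>Z p m = (\<Sum>\<tau>\<in>{\<tau>\<in>\<Sigma>. \<tau> \<subseteq> zero_locus m}. (if \<tau> \<in> \<Sigma>Z then int (orbit_dim \<tau> choose p) else 0) * fibre_sum m \<tau>)"
proof -
  note fin = fan_finite[OF is_fan]
  have fN: "finite (nonneg_cones m)" using fin by (simp add: nonneg_cones_def)
  have dim0: "fun_vs.dim {0 :: (int ^ 'n) list \<Rightarrow> complex} = 0"
    by (rule fun_vs.dim_unique[of "{}"]) (auto simp: fun_vs.span_empty fun_vs.independent_empty)
  let ?c = "\<lambda>\<tau>. if \<tau> \<in> \<Sigma>Z then int (orbit_dim \<tau> choose p) else 0"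
  have d: "int (fun_vs.dim (fiber \<Sigma>Z p \<sigma> m)) = (if \<sigma> \<in> nonneg_cones m then ?c (\<sigma> \<inter> zero_locus m) else 0)" if \<sigma>: "\<sigma> \<in> \<Sigma>" for \<sigma>
    unfolding fiber_eq[OF \<sigma>] using \<sigma> assms dim_ext_power(1)[OF fan_cone(1)[OF is_fan]] dim0
    by (auto simp: nonneg_cones_def)
  have "weight_coeff \<Sigma>Z p m = (\<Sum>\<sigma>\<in>nonneg_cones m. (-1) ^ orbit_dim \<sigma> * ?c (\<sigma> \<inter> zero_locus m))"
    unfolding weight_coeff_def using fin by (intro sum.mono_neutral_cong_right) (auto simp: d nonneg_cones_def)
  also have "\<dots> = (\<Sum>\<tau>\<in>{\<tau>\<in>\<Sigma>. \<tau> \<subseteq> zero_locus m}. \<Sum>\<sigma>\<in>{\<sigma>\<in>nonneg_cones m. \<sigma> \<inter> zero_locus m = \<tau>}. (-1) ^ orbit_dim \<sigma> * ?c (\<sigma> \<inter> zero_locus m))"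
    by (rule sum.group[symmetric, OF fN]) (use fin face_at_zero_locus in \<open>auto simp: nonneg_cones_def\<close>)
  also have "\<dots> = (\<Sum>\<tau>\<in>{\<tau>\<in>\<Sigma>. \<tau> \<subseteq> zero_locus m}. ?c \<tau> * fibre_sum m \<tau>)"
    unfolding fibre_sum_def sum_distrib_left by (intro sum.cong refl) auto
  finally show ?thesis .
qed

text \<open>As \<tau> lies in the zero locus, \<tau> \<subseteq> \<sigma> \<inter>
  \<open>zero_locus m\<close> just means \<tau> \<subseteq> \<sigma>; the upper sums therefore
  forget the intersection.\<close>

lemma fibre_sum_upper:
  assumes "\<tau> \<in> \<Sigma>" "\<tau> \<subseteq> zero_locus m"
  shows "(\<Sum>\<tau>'\<in>{\<tau>'\<in>{\<tau>\<in>\<Sigma>. \<tau> \<subseteq> zero_locus m}. \<tau> \<subseteq> \<tau>'}. fibre_sum m \<tau>') = (\<Sum>\<sigma>\<in>{\<sigma>\<in>nonneg_cones m. \<tau> \<subseteq> \<sigma>}. (-1) ^ orbit_dim \<sigma>)"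
proof -
  note fin = fan_finite[OF is_fan]
  let ?S = "{\<sigma>\<in>nonneg_cones m. \<tau> \<subseteq> \<sigma>}" and ?T = "{\<tau>'\<in>{\<tau>\<in>\<Sigma>. \<tau> \<subseteq> zero_locus m}. \<tau> \<subseteq> \<tau>'}"
  have fS: "finite ?S" and fT: "finite ?T" using fin by (auto simp: nonneg_cones_def)
  have im: "(\<lambda>\<sigma>. \<sigma> \<inter> zero_locus m) ` ?S \<subseteq> ?T" using face_at_zero_locus(2) assms(2) by (auto simp: nonneg_cones_def)
  have "(\<Sum>\<tau>'\<in>?T. fibre_sum m \<tau>') = (\<Sum>\<tau>'\<in>?T. \<Sum>\<sigma>\<in>{\<sigma>\<in>?S. \<sigma> \<inter> zero_locus m = \<tau>'}. (-1) ^ orbit_dim \<sigma>)"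
    unfolding fibre_sum_def
  proof (rule sum.cong[OF refl])
    fix \<tau>' assume t: "\<tau>' \<in> ?T"
    have "{\<sigma>\<in>nonneg_cones m. \<sigma> \<inter> zero_locus m = \<tau>'} = {\<sigma>\<in>?S. \<sigma> \<inter> zero_locus m = \<tau>'}" using t by auto
    thus "(\<Sum>\<sigma>\<in>{\<sigma>\<in>nonneg_cones m. \<sigma> \<inter> zero_locus m = \<tau>'}. (-1) ^ orbit_dim \<sigma>) = (\<Sum>\<sigma>\<in>{\<sigma>\<in>?S. \<sigma> \<inter> zero_locus m = \<tau>'}. (-1 :: int) ^ orbit_dim \<sigma>)" by simp
  qed
  also have "\<dots> = (\<Sum>\<sigma>\<in>?S. (-1) ^ orbit_dim \<sigma>)" by (rule sum.group[OF fS fT im])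
  finally show ?thesis .
qed

lemma face_card: "E face_of P \<Longrightarrow> E \<noteq> {} \<Longrightarrow> aff_dim E = int (nat (aff_dim E))"
  using aff_dim_nonneg[of _ E] by auto

text \<open>For m in P every cone is admissible, so all upper sums of \<open>fibre_sum m\<close>
  equal 1. The proposed values have the same upper sums, by the Euler relation for
  \<open>open_normal_cone E\<close>, whose cells are the relative interiors of the cones \<sigma>
  with \<open>cone_face \<sigma> = E\<close>.\<close>

lemma fibre_sum_inside:
  assumes E: "E face_of P" and m: "rvec m \<in> rel_interior E" and \<tau>: "\<tau> \<in> \<Sigma>" "\<tau> \<subseteq> zero_locus m"
  shows "fibre_sum m \<tau> = (if cone_face \<tau> = E then (-1) ^ (orbit_dim \<tau> + nat (aff_dim E)) else 0)"
proof -
  note fin = fan_finite[OF is_fan]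
  have mE: "rvec m \<in> E" using m rel_interior_subset by blast
  hence Ene: "E \<noteq> {}" by blast
  have hzE: "zero_locus m = normal_cone P E" using rel_interior_face_zero[OF E m] by (auto simp: zero_locus_def)
  have "rvec m \<in> P" using mE E face_of_imp_subset by blast
  hence nn: "nonneg_cones m = \<Sigma>" by (auto simp: nonneg_cones_def P_iff)
  let ?H = "{\<tau>\<in>\<Sigma>. \<tau> \<subseteq> zero_locus m}"
  let ?g = "\<lambda>\<tau>. if cone_face \<tau> = E then (-1) ^ (orbit_dim \<tau> + nat (aff_dim E)) else 0 :: int"
  have up: "\<tau> \<subseteq> zero_locus m" if "\<tau> \<in> \<Sigma>" "cone_face \<tau> = E" for \<tau>
    using subset_normal_cone_iff[OF that(1) E Ene] that(2) hzE by simp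
  show ?thesis
  proof (rule moebius_unique[of ?H "fibre_sum m" ?g])
    show "finite ?H" using fin by simp
    show "\<tau> \<in> ?H" using \<tau> by simp
    fix \<rho> assume "\<rho> \<in> ?H"
    hence \<rho>: "\<rho> \<in> \<Sigma>" "\<rho> \<subseteq> zero_locus m" by auto
    obtain x where x: "x \<in> rel_interior \<rho>" using fan_rel_interior_nonempty[OF is_fan \<rho>(1)] by blast
    have "x \<in> closure (open_normal_cone E)"
      using normal_cone_closure[OF E Ene] \<rho>(2) x rel_interior_subset unfolding hzE by blast
    note eul = fan_star_euler[OF cf \<rho>(1) open_normal_cone_props(1,2)[OF E Ene] x this]
    define e where "e = nat (aff_dim E)"
    have cs: "cell_sign (open_normal_cone E) = (-1) ^ (CARD('n) + e)"
    proof -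
      have d: "dim (const_dirs E) + e = CARD('n)" using dim_const_dirs(1)[OF E Ene] face_card[OF E Ene] unfolding e_def by linarith
      have "(-1 :: int) ^ (CARD('n) + e) = (-1) ^ (dim (const_dirs E) + 2 * e)"
        using d by (intro arg_cong[of _ _ "(^) (-1)"]) linarith
      moreover have "cell_sign (open_normal_cone E) = (-1) ^ dim (const_dirs E)"
        using open_normal_cone_props(3,4)[OF E Ene] by (simp add: cell_sign_def)
      ultimately show ?thesis by (simp add: power_add power_mult)
    qed
    have "(\<Sum>\<sigma>\<in>{\<sigma>\<in>\<Sigma>. \<rho> \<subseteq> \<sigma>}. cell_sign (rel_interior \<sigma> \<inter> open_normal_cone E)) = (\<Sum>\<sigma>\<in>{\<sigma>\<in>\<Sigma>. \<rho> \<subseteq> \<sigma>}. (-1) ^ (CARD('n) + e) * ?g \<sigma>)"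
    proof (rule sum.cong[OF refl])
      fix \<sigma> assume "\<sigma> \<in> {\<sigma>\<in>\<Sigma>. \<rho> \<subseteq> \<sigma>}"
      hence s: "\<sigma> \<in> \<Sigma>" by blast
      show "cell_sign (rel_interior \<sigma> \<inter> open_normal_cone E) = (-1) ^ (CARD('n) + e) * ?g \<sigma>"
        using open_normal_cone_meets[OF s, of E] cell_sign_cone[OF is_fan s] by (auto simp: e_def power_add mult_ac simp flip: power_mult_distrib)
    qed
    also have "\<dots> = (-1) ^ (CARD('n) + e) * (\<Sum>\<sigma>\<in>{\<sigma>\<in>\<Sigma>. \<rho> \<subseteq> \<sigma>}. ?g \<sigma>)" by (simp only: sum_distrib_left)
    finally have "(-1) ^ (CARD('n) + e) * (\<Sum>\<sigma>\<in>{\<sigma>\<in>\<Sigma>. \<rho> \<subseteq> \<sigma>}. ?g \<sigma>) = (-1) ^ (CARD('n) + e)"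
      unfolding eul cs by simp
    hence "(\<Sum>\<sigma>\<in>{\<sigma>\<in>\<Sigma>. \<rho> \<subseteq> \<sigma>}. ?g \<sigma>) = 1" by simp
    \<comment> \<open>Cones mapped to E lie in the zero locus, so restricting to \<open>?H\<close>
      loses no nonzero term.\<close>
    moreover have "(\<Sum>\<sigma>\<in>{\<sigma>\<in>\<Sigma>. \<rho> \<subseteq> \<sigma>}. ?g \<sigma>) = (\<Sum>\<sigma>\<in>{\<sigma>\<in>?H. \<rho> \<subseteq> \<sigma>}. ?g \<sigma>)"
      using fin up by (intro sum.mono_neutral_right) auto
    ultimately show "(\<Sum>\<sigma>\<in>{\<sigma>\<in>?H. \<rho> \<subseteq> \<sigma>}. fibre_sum m \<sigma>) = (\<Sum>\<sigma>\<in>{\<sigma>\<in>?H. \<rho> \<subseteq> \<sigma>}. ?g \<sigma>)"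
      using fibre_sum_upper[OF \<rho>] fan_star_codim_sum[OF cf \<rho>(1)] nn by simp
  qed
qed

text \<open>The zero locus lies in the closure of N = {h < 0}: h is a maximum of linear forms, so
  moving from a zero of h in a direction w with h(w) < 0 makes h negative at once. The Euler
  relation for N then gives the cones outside \<open>nonneg_cones m\<close> the same total as the
  whole star.\<close>

lemma fibre_sum_outside:
  assumes m: "rvec m \<notin> P" and \<tau>: "\<tau> \<in> \<Sigma>" "\<tau> \<subseteq> zero_locus m"
  shows "fibre_sum m \<tau> = 0"
proof -
  note fin = fan_finite[OF is_fan]
  let ?H = "{\<tau>\<in>\<Sigma>. \<tau> \<subseteq> zero_locus m}"
  \<comment> \<open>The cones on which \<open>h = m - \<psi>\<close> is somewhere negative cancel all the others.\<close>
  define N where "N = {u. rvec m \<bullet> u < psi u}"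
  have N_eq: "N = (\<Inter>v\<in>V. {u. (rvec m - v) \<bullet> u < 0})"
  proof (intro set_eqI iffI)
    fix u assume "u \<in> N"
    thus "u \<in> (\<Inter>v\<in>V. {u. (rvec m - v) \<bullet> u < 0})" using V_ge[of _ u] by (force simp: N_def inner_diff_left)
  next
    fix u assume u: "u \<in> (\<Inter>v\<in>V. {u. (rvec m - v) \<bullet> u < 0})"
    obtain v where "v \<in> V" "v \<bullet> u = psi u" using V_eq by blast
    thus "u \<in> N" using u by (auto simp: N_def inner_diff_left)
  qed
  have oN: "open N" unfolding N_eq using finite_V by (intro open_INT) (auto simp: open_halfspace_lt)
  have cN: "convex N" unfolding N_eq by (intro convex_INT) (auto simp: convex_halfspace_lt)
  obtain w where w: "w \<in> N" using m by (auto simp: P_iff N_def not_le)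
  have "fibre_sum m \<tau> = (\<lambda>_. 0) \<tau>"
  proof (rule moebius_unique[of ?H "fibre_sum m" "\<lambda>_. 0"])
    show "finite ?H" using fin by simp
    show "\<tau> \<in> ?H" using \<tau> by simp
    fix \<rho> assume "\<rho> \<in> ?H"
    hence \<rho>: "\<rho> \<in> \<Sigma>" "\<rho> \<subseteq> zero_locus m" by auto
    obtain x where x: "x \<in> rel_interior \<rho>" using fan_rel_interior_nonempty[OF is_fan \<rho>(1)] by blast
    have xm: "rvec m \<bullet> x = psi x" using x \<rho>(2) rel_interior_subset by (auto simp: zero_locus_def)
    have near: "x + t *\<^sub>R w \<in> N" if t: "t > 0" for t
      unfolding N_eq
    proof (intro INT_I CollectI)
      fix v assume v: "v \<in> V"
      have "(rvec m - v) \<bullet> w < 0" using w v unfolding N_eq by blast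
      hence "t * ((rvec m - v) \<bullet> w) < 0" using t by (simp add: mult_pos_neg)
      moreover have "(rvec m - v) \<bullet> x \<le> 0" using V_ge[OF v, of x] xm by (simp add: inner_diff_left)
      ultimately show "(rvec m - v) \<bullet> (x + t *\<^sub>R w) < 0" by (simp add: inner_add_right)
    qed
    have "x \<in> closure N" by (rule closure_ray[OF near])
    note eul = fan_star_euler[OF cf \<rho>(1) cN relatively_open_open[OF oN] x this]
    have cs: "cell_sign N = (-1) ^ CARD('n)"
      using cell_sign_Int_open[OF relatively_open_open[OF open_UNIV] oN] w cell_sign_UNIV[where 'n = 'n] by auto
    have cell: "cell_sign (rel_interior \<sigma> \<inter> N) = (if \<sigma> \<in> nonneg_cones m then 0 else (-1) ^ CARD('n) * (-1) ^ orbit_dim \<sigma>)"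
      if \<sigma>: "\<sigma> \<in> \<Sigma>" for \<sigma>
    proof (cases "\<sigma> \<in> nonneg_cones m")
      case True
      have "rel_interior \<sigma> \<inter> N = {}" using True rel_interior_subset by (force simp: nonneg_cones_def N_def)
      thus ?thesis using True by simp
    next
      case False
      then obtain u where u: "u \<in> \<sigma>" "u \<in> N" using \<sigma> by (auto simp: nonneg_cones_def N_def not_le)
      \<comment> \<open>N is open and meets \<sigma>, hence meets its dense relative
        interior.\<close>
      have "closure (rel_interior \<sigma>) = closure \<sigma>" by (rule convex_closure_rel_interior[OF fan_cone(5)[OF is_fan \<sigma>]])
      hence "u \<in> closure (rel_interior \<sigma>)" using u(1) closure_subset by blast
      hence "rel_interior \<sigma> \<inter> N \<noteq> {}" using oN u(2) by (metis disjoint_iff Int_commute open_Int_closure_eq_empty)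
      thus ?thesis using cell_sign_Int_open[OF relatively_open_rel_interior oN] cell_sign_cone[OF is_fan \<sigma>] False by (simp add: power_add)
    qed
    let ?U = "{\<sigma>\<in>\<Sigma>. \<rho> \<subseteq> \<sigma>}"
    have "(\<Sum>\<sigma>\<in>?U. cell_sign (rel_interior \<sigma> \<inter> N)) = (\<Sum>\<sigma>\<in>?U. (-1) ^ CARD('n) * (if \<sigma> \<in> nonneg_cones m then 0 else (-1) ^ orbit_dim \<sigma>))"
      by (intro sum.cong refl) (auto simp: cell)
    also have "\<dots> = (-1) ^ CARD('n) * (\<Sum>\<sigma>\<in>?U. if \<sigma> \<in> nonneg_cones m then 0 else (-1) ^ orbit_dim \<sigma>)" by (simp only: sum_distrib_left)
    finally have "(-1) ^ CARD('n) * (\<Sum>\<sigma>\<in>?U. if \<sigma> \<in> nonneg_cones m then 0 else (-1) ^ orbit_dim \<sigma>) = ((-1) ^ CARD('n) :: int)"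
      unfolding eul cs by simp
    hence one: "(\<Sum>\<sigma>\<in>?U. if \<sigma> \<in> nonneg_cones m then 0 else (-1) ^ orbit_dim \<sigma>) = (1::int)" by simp
    have "(\<Sum>\<sigma>\<in>?U. (-1) ^ orbit_dim \<sigma>) = (\<Sum>\<sigma>\<in>?U. (if \<sigma> \<in> nonneg_cones m then (-1) ^ orbit_dim \<sigma> else 0) + (if \<sigma> \<in> nonneg_cones m then 0 else (-1 :: int) ^ orbit_dim \<sigma>))"
      by (intro sum.cong) auto
    hence "(\<Sum>\<sigma>\<in>?U. if \<sigma> \<in> nonneg_cones m then (-1) ^ orbit_dim \<sigma> else 0) = (0::int)"
      using one fan_star_codim_sum[OF cf \<rho>(1)] by (simp add: sum.distrib)
    moreover have "(\<Sum>\<sigma>\<in>?U. if \<sigma> \<in> nonneg_cones m then (-1) ^ orbit_dim \<sigma> else 0) = (\<Sum>\<sigma>\<in>{\<sigma>\<in>nonneg_cones m. \<rho> \<subseteq> \<sigma>}. (-1 :: int) ^ orbit_dim \<sigma>)"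
      using fin by (intro sum.mono_neutral_cong_right) (auto simp: nonneg_cones_def)
    ultimately show "(\<Sum>\<sigma>\<in>{\<sigma>\<in>?H. \<rho> \<subseteq> \<sigma>}. fibre_sum m \<sigma>) = (\<Sum>\<sigma>\<in>{\<sigma>\<in>?H. \<rho> \<subseteq> \<sigma>}. 0)"
      using fibre_sum_upper[OF \<rho>] by simp
  qed
  thus ?thesis by simp
qed

theorem weight_coeff_inside:
  assumes "\<Sigma>Z \<subseteq> \<Sigma>" "E face_of P" "rvec m \<in> rel_interior E"
  shows "weight_coeff \<Sigma>Z p m = (\<Sum>\<tau>\<in>{\<tau>\<in>\<Sigma>Z. cone_face \<tau> = E}. (-1) ^ (orbit_dim \<tau> + nat (aff_dim E)) * int (orbit_dim \<tau> choose p))"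
proof -
  have mE: "rvec m \<in> E" using assms(3) rel_interior_subset by blast
  hence Ene: "E \<noteq> {}" by blast
  have hzE: "zero_locus m = normal_cone P E" using rel_interior_face_zero[OF assms(2,3)] by (auto simp: zero_locus_def)
  have up: "\<tau> \<subseteq> zero_locus m" if "\<tau> \<in> \<Sigma>" "cone_face \<tau> = E" for \<tau>
    using subset_normal_cone_iff[OF that(1) assms(2) Ene] that(2) hzE by simp
  show ?thesis
    unfolding weight_coeff_fibre_sum[OF assms(1)] using fan_finite[OF is_fan] assms(1) up fibre_sum_inside[OF assms(2,3)]
    by (intro sum.mono_neutral_cong_right) (auto simp: mult.commute)
qed

theorem weight_coeff_outside:
  assumes "\<Sigma>Z \<subseteq> \<Sigma>" "rvec m \<notin> P" shows "weight_coeff \<Sigma>Z p m = 0"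
  unfolding weight_coeff_fibre_sum[OF assms(1)] using fibre_sum_outside[OF assms(2)] by (intro sum.neutral) auto

text \<open>The orbit label of the image is the normal cone of \<open>cone_face \<sigma>\<close>,
  and normal cones determine their faces. Surjectivity onto the orbit is the extension of a
  character from a sublattice of \<sigma>^\<bottom> \<inter> M.\<close>

lemma orbit_image_iff:
  assumes \<sigma>: "\<sigma> \<in> \<Sigma>" and E: "E face_of P" "E \<noteq> {}"
  shows "toric_morphism (normal_fan P) ` orbit \<sigma> = orbit (normal_cone P E) \<longleftrightarrow> cone_face \<sigma> = E"
proof -
  have one: "(\<rho>, \<lambda>m. if m \<in> perp_lattice \<rho> then 1 else 0) \<in> orbit \<rho>" for \<rho> :: "(real ^ 'n) set"
    by (auto simp: orbit_def perp_lattice_closed)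
  have tm: "toric_morphism (normal_fan P) x = (normal_cone P (cone_face \<sigma>), \<lambda>m. if m \<in> perp_lattice (normal_cone P (cone_face \<sigma>)) then snd x m else 0)"
    if "x \<in> orbit \<sigma>" for x
  proof -
    have "fst x = \<sigma>" using that by (auto simp: orbit_def)
    thus ?thesis unfolding toric_morphism_def Let_def using smallest_normal_cone[OF \<sigma>] by simp
  qed
  show ?thesis
  proof
    assume im: "toric_morphism (normal_fan P) ` orbit \<sigma> = orbit (normal_cone P E)"
    have "toric_morphism (normal_fan P) (\<sigma>, \<lambda>m. if m \<in> perp_lattice \<sigma> then 1 else 0) \<in> orbit (normal_cone P E)"
      using im one by blast
    hence "normal_cone P (cone_face \<sigma>) = normal_cone P E" unfolding tm[OF one] by (auto simp: orbit_def)
    thus "cone_face \<sigma> = E" using normal_cone_inj[OF cone_face_face[OF \<sigma>] E] by blast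
  next
    assume c: "cone_face \<sigma> = E"
    let ?\<rho> = "normal_cone P E"
    have sub: "\<sigma> \<subseteq> ?\<rho>" using subset_normal_cone_iff[OF \<sigma> E] c by simp
    have ps: "perp_lattice ?\<rho> \<subseteq> perp_lattice \<sigma>" by (rule perp_lattice_antimono[OF sub])
    note cl = perp_lattice_closed
    show "toric_morphism (normal_fan P) ` orbit \<sigma> = orbit ?\<rho>"
    proof
      show "toric_morphism (normal_fan P) ` orbit \<sigma> \<subseteq> orbit ?\<rho>"
      proof
        fix y assume "y \<in> toric_morphism (normal_fan P) ` orbit \<sigma>"
        then obtain x where x: "x \<in> orbit \<sigma>" "y = toric_morphism (normal_fan P) x" by blast
        have y: "y = (?\<rho>, \<lambda>m. if m \<in> perp_lattice ?\<rho> then snd x m else 0)" using x tm c by simp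
        have "snd x 0 = 1" "\<And>m m'. m \<in> perp_lattice \<sigma> \<Longrightarrow> m' \<in> perp_lattice \<sigma> \<Longrightarrow> snd x (m + m') = snd x m * snd x m'"
          using x(1) by (auto simp: orbit_def)
        thus "y \<in> orbit ?\<rho>" unfolding y using ps by (auto simp: orbit_def cl subset_iff)
      qed
      show "orbit ?\<rho> \<subseteq> toric_morphism (normal_fan P) ` orbit \<sigma>"
      proof
        fix y assume "y \<in> orbit ?\<rho>"
        then obtain \<gamma> where y: "y = (?\<rho>, \<gamma>)" "\<gamma> 0 = 1" "\<forall>m\<in>perp_lattice ?\<rho>. \<forall>m'\<in>perp_lattice ?\<rho>. \<gamma> (m + m') = \<gamma> m * \<gamma> m'"
          "\<forall>m. m \<notin> perp_lattice ?\<rho> \<longrightarrow> \<gamma> m = 0" by (auto simp: orbit_def)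
        have "partial_hom (perp_lattice ?\<rho>) \<gamma>" using y by (simp add: partial_hom_def cl)
        then obtain \<gamma>' where g: "partial_hom UNIV \<gamma>'" "\<forall>m\<in>perp_lattice ?\<rho>. \<gamma>' m = \<gamma> m"
          using partial_hom_extend_total by blast
        let ?x = "(\<sigma>, \<lambda>m. if m \<in> perp_lattice \<sigma> then \<gamma>' m else 0)"
        have x: "?x \<in> orbit \<sigma>" using partial_homD(4,5)[OF g(1)] by (auto simp: orbit_def cl)
        have "toric_morphism (normal_fan P) ?x = y"
          unfolding tm[OF x] c y(1) using ps g(2) y(4) by (auto simp: fun_eq_iff subset_iff)
        thus "y \<in> toric_morphism (normal_fan P) ` orbit \<sigma>" using x by blast
      qed
    qed
  qed
qed

text \<open>Makes the truncated subtraction in l = dim O_\<sigma> - dim E harmless.\<close>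

lemma orbit_dim_ge:
  assumes "\<sigma> \<in> \<Sigma>" "E face_of P" "E \<noteq> {}" "cone_face \<sigma> = E"
  shows "nat (aff_dim E) \<le> orbit_dim \<sigma>"
proof -
  have "\<sigma> \<subseteq> normal_cone P E" using subset_normal_cone_iff[OF assms(1-3)] assms(4) by simp
  hence "perp (normal_cone P E) \<subseteq> perp \<sigma>" by (auto simp: perp_def)
  hence "orbit_dim (normal_cone P E) \<le> orbit_dim \<sigma>" unfolding orbit_dim_def by (rule dim_subset)
  thus ?thesis using dim_const_dirs(2)[OF assms(2,3)] by simp
qed

end

subsection \<open>The Hirzebruch polynomial\<close>

lemma finite_lattice_points:
  fixes B :: "(real ^ 'n::finite) set"
  assumes "bounded B" shows "finite {m. rvec m \<in> B}"
proof -
  obtain b where b: "\<And>x. x \<in> B \<Longrightarrow> norm x \<le> b" using assms unfolding bounded_iff by blast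
  let ?I = "{- \<lceil>b\<rceil>..\<lceil>b\<rceil>}"
  have "{m. rvec m \<in> B} \<subseteq> vec_lambda ` (PiE (UNIV :: 'n set) (\<lambda>_. ?I))"
  proof
    fix m :: "int ^ 'n" assume "m \<in> {m. rvec m \<in> B}"
    hence "norm (rvec m) \<le> b" using b by blast
    hence "\<bar>real_of_int (m $ i)\<bar> \<le> b" for i using component_le_norm_cart[of "rvec m" i] by (simp add: rvec_def)
    hence "m $ i \<in> ?I" for i by (simp add: abs_le_iff) (metis ceiling_mono ceiling_of_int ceiling_minus floor_le_ceiling le_of_int_ceiling neg_le_iff_le of_int_le_iff of_int_minus order_trans minus_le_iff)
    hence "(\<lambda>i. m $ i) \<in> PiE UNIV (\<lambda>_. ?I)" by auto
    moreover have "m = vec_lambda (\<lambda>i. m $ i)" by simp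
    ultimately show "m \<in> vec_lambda ` (PiE UNIV (\<lambda>_. ?I))" by blast
  qed
  moreover have "finite (vec_lambda ` (PiE (UNIV :: 'n set) (\<lambda>_. ?I)))" by (intro finite_imageI finite_PiE) auto
  ultimately show ?thesis by (rule finite_subset)
qed

lemma exp_c_class_uminus: "exp_class (c_class (- m)) = exp_class (s_class m)"
proof -
  have "c_class (- m) = s_class m"
    by (simp add: s_class_def c_class_def fun_eq_iff pairing_def sum_negf fps_const_neg[symmetric] del: fps_const_neg)
  thus ?thesis by simp
qed

lemma coeff_binomial: "coeff ([:1, 1:] ^ k :: 'a::comm_ring_1 poly) p = of_nat (k choose p)"
proof (cases "p \<le> k")
  case True
  thus ?thesis by (simp add: coeff_linear_poly_power)
next
  case False
  have "degree ([:1, 1:] ^ k :: 'a poly) \<le> degree ([:1, 1:] :: 'a poly) * k" by (rule degree_power_le)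
  hence "degree ([:1, 1:] ^ k :: 'a poly) < p" using False by (simp add: degree_pCons_eq_if split: if_splits)
  thus ?thesis using False by (simp add: coeff_eq_0 binomial_eq_0)
qed

context gg_divisor
begin

text \<open>Sorts the orbits over that of E by relative dimension l; the sign (-1)^l becomes
  (-1)^(dim O_\<sigma> + dim E).\<close>

lemma fibre_poly:
  assumes E: "E face_of P" "E \<noteq> {}"
  shows "Sum_any (\<lambda>l. (-1) ^ l * of_nat (fibre_mult \<Sigma> a Z E l) * [:1, 1:] ^ (l + nat (aff_dim E))) =
    (\<Sum>\<sigma>\<in>{\<sigma>\<in>cones_in \<Sigma> Z. cone_face \<sigma> = E}. (-1) ^ (orbit_dim \<sigma> + nat (aff_dim E)) * [:1, 1 :: 'a::comm_ring_1:] ^ orbit_dim \<sigma>)"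
proof -
  let ?B = "{\<sigma>\<in>cones_in \<Sigma> Z. cone_face \<sigma> = E}"
  define e where "e = nat (aff_dim E)"
  have fB: "finite ?B" using fan_finite[OF is_fan] by (simp add: cones_in_def)
  have ge: "e \<le> orbit_dim \<sigma>" if "\<sigma> \<in> ?B" for \<sigma>
    using orbit_dim_ge[OF _ E] that by (auto simp: e_def cones_in_def)
  have fm: "fibre_mult \<Sigma> a Z E l = card {\<sigma>\<in>?B. orbit_dim \<sigma> - e = l}" for l
  proof -
    have "{\<sigma>\<in>\<Sigma>. orbit \<sigma> \<subseteq> Z \<and> toric_morphism (normal_fan P) ` orbit \<sigma> = orbit (normal_cone P E) \<and>
        int l = int (orbit_dim \<sigma>) - int (orbit_dim (normal_cone P E))} = {\<sigma>\<in>?B. orbit_dim \<sigma> - e = l}"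
      using orbit_image_iff[OF _ E] dim_const_dirs(2)[OF E] ge by (auto simp: cones_in_def e_def)
    thus ?thesis unfolding fibre_mult_def Let_def by simp
  qed
  let ?L = "(\<lambda>\<sigma>. orbit_dim \<sigma> - e) ` ?B"
  let ?t = "\<lambda>l. (-1) ^ l * of_nat (fibre_mult \<Sigma> a Z E l) * [:1, 1 :: 'a:] ^ (l + e)"
  \<comment> \<open>Only an inclusion: over a general coefficient ring a term with nonzero
    multiplicity may still vanish.\<close>
  have sup: "{l. ?t l \<noteq> 0} \<subseteq> ?L"
  proof
    fix l assume "l \<in> {l. ?t l \<noteq> 0}"
    hence nz: "?t l \<noteq> 0" by blast
    have "fibre_mult \<Sigma> a Z E l \<noteq> 0"
    proof
      assume "fibre_mult \<Sigma> a Z E l = 0"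
      hence "?t l = 0" by (simp only: of_nat_0 mult_zero_left mult_zero_right)
      thus False using nz by contradiction
    qed
    hence "{\<sigma>\<in>?B. orbit_dim \<sigma> - e = l} \<noteq> {}" unfolding fm by (metis card.empty)
    thus "l \<in> ?L" by blast
  qed
  have "Sum_any ?t = (\<Sum>l\<in>?L. ?t l)" using fB sup by (intro Sum_any.expand_superset) auto
  also have "\<dots> = (\<Sum>l\<in>?L. \<Sum>\<sigma>\<in>{\<sigma>\<in>?B. orbit_dim \<sigma> - e = l}. (-1) ^ (orbit_dim \<sigma> + e) * [:1, 1 :: 'a:] ^ orbit_dim \<sigma>)"
  proof (rule sum.cong[OF refl])
    fix l
    have "(\<Sum>\<sigma>\<in>{\<sigma>\<in>?B. orbit_dim \<sigma> - e = l}. (-1) ^ (orbit_dim \<sigma> + e) * [:1, 1 :: 'a:] ^ orbit_dim \<sigma>) =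
        (\<Sum>\<sigma>\<in>{\<sigma>\<in>?B. orbit_dim \<sigma> - e = l}. (-1) ^ l * [:1, 1 :: 'a:] ^ (l + e))"
    proof (rule sum.cong[OF refl])
      fix \<sigma> assume s: "\<sigma> \<in> {\<sigma>\<in>?B. orbit_dim \<sigma> - e = l}"
      hence "orbit_dim \<sigma> = l + e" using ge[of \<sigma>] by auto
      thus "(-1) ^ (orbit_dim \<sigma> + e) * [:1, 1 :: 'a:] ^ orbit_dim \<sigma> = (-1) ^ l * [:1, 1 :: 'a:] ^ (l + e)"
        by (simp add: power_add mult.assoc flip: power_mult_distrib)
    qed
    thus "?t l = (\<Sum>\<sigma>\<in>{\<sigma>\<in>?B. orbit_dim \<sigma> - e = l}. (-1) ^ (orbit_dim \<sigma> + e) * [:1, 1 :: 'a:] ^ orbit_dim \<sigma>)"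
      unfolding fm by (simp add: mult_ac)
  qed
  also have "\<dots> = (\<Sum>\<sigma>\<in>?B. (-1) ^ (orbit_dim \<sigma> + e) * [:1, 1 :: 'a:] ^ orbit_dim \<sigma>)"
    by (rule sum.group) (use fB in auto)
  finally show ?thesis unfolding e_def .
qed

lemma coeff_fibre_poly:
  assumes E: "E face_of P" and m: "rvec m \<in> rel_interior E"
  shows "coeff (Sum_any (\<lambda>l. (-1) ^ l * of_nat (fibre_mult \<Sigma> a Z E l) * [:1, 1 :: 'a::comm_ring_1:] ^ (l + nat (aff_dim E)))) p
    = of_int (weight_coeff (cones_in \<Sigma> Z) p m)"
proof -
  have "E \<noteq> {}" using m rel_interior_subset by blast
  have cf: "coeff ((-1) ^ k * q) p = (-1) ^ k * coeff (q :: 'a poly) p" for k q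
    by (cases "even k") auto
  show ?thesis
    unfolding fibre_poly[OF E \<open>E \<noteq> {}\<close>] weight_coeff_inside[OF _ E m, of "cones_in \<Sigma> Z", simplified cones_in_def, OF Collect_restrict, folded cones_in_def]
    by (simp add: coeff_sum cf coeff_binomial)
qed

text \<open>Shows that stopping the Hirzebruch polynomial at dim Z drops nothing, so coefficients
  can be compared in every degree.\<close>

lemma weight_coeff_large:
  assumes "dim_of \<Sigma> Z < p" shows "weight_coeff (cones_in \<Sigma> Z) p m = 0"
proof -
  have fin: "finite (cones_in \<Sigma> Z)" using fan_finite[OF is_fan] by (simp add: cones_in_def)
  have "orbit_dim \<tau> < p" if "\<tau> \<in> cones_in \<Sigma> Z" for \<tau>
  proof -
    have "orbit_dim \<tau> \<le> dim_of \<Sigma> Z"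
      unfolding dim_of_def using fin that by (intro cSup_upper bdd_above_finite) auto
    thus ?thesis using assms by simp
  qed
  thus ?thesis unfolding weight_coeff_fibre_sum[of "cones_in \<Sigma> Z", OF cones_in_def[THEN equalityD1, THEN subset_trans, OF Collect_restrict]]
    by (intro sum.neutral) auto
qed

theorem hirzebruch_formula:
  assumes z: "zariski_closed \<Sigma> Z"
  shows "hirzebruch_poly \<Sigma> a Z =
    (\<Sum>E | E face_of P \<and> E \<noteq> {}.
       Sum_any (\<lambda>l. (-1) ^ l * of_nat (fibre_mult \<Sigma> a Z E l) * [:1, 1:] ^ (l + nat (aff_dim E))) *
       (\<Sum>m | rvec m \<in> rel_interior E. [:exp_class (s_class m):]))"
proof (rule poly_eqI)
  fix p
  let ?Z = "cones_in \<Sigma> Z" and ?M = "{m. rvec m \<in> P}" and ?F = "{E. E face_of P \<and> E \<noteq> {}}"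
  have ZS: "?Z \<subseteq> \<Sigma>" by (auto simp: cones_in_def)
  have up: "\<sigma> \<in> ?Z" if "\<tau> \<in> ?Z" "\<sigma> \<in> \<Sigma>" "\<tau> \<subseteq> \<sigma>" for \<sigma> \<tau> using cones_in_upward[OF is_fan z that] .
  have fM: "finite ?M" using finite_lattice_points[OF polytope_imp_bounded[OF polytope_P]] .
  have fF: "finite ?F" using finite_polytope_faces[OF polytope_P] by simp
  have fME: "finite {m. rvec m \<in> rel_interior E}" if "E \<in> ?F" for E
    by (rule finite_subset[OF _ fM]) (use that face_of_imp_subset rel_interior_subset in blast)
  have M: "?M = (\<Union>E\<in>?F. {m. rvec m \<in> rel_interior E})"
  proof (intro set_eqI iffI)
    fix m assume "m \<in> ?M"
    then obtain E where "E face_of P" "rvec m \<in> rel_interior E"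
      using polyhedron_rel_interior_face[OF polytope_imp_polyhedron[OF polytope_P]] by blast
    thus "m \<in> (\<Union>E\<in>?F. {m. rvec m \<in> rel_interior E})" by fastforce
  next
    fix m assume "m \<in> (\<Union>E\<in>?F. {m. rvec m \<in> rel_interior E})"
    thus "m \<in> ?M" using face_of_imp_subset rel_interior_subset by blast
  qed
  \<comment> \<open>Two faces of P with a common relative interior point contain each other.\<close>
  have disj: "E = E'" if "E \<in> ?F" "E' \<in> ?F" "rvec m \<in> rel_interior E" "rvec m \<in> rel_interior E'" for E E' m
  proof -
    have "G \<subseteq> G'" if "G \<in> ?F" "G' \<in> ?F" "rvec m \<in> rel_interior G" "rvec m \<in> rel_interior G'" for G G'
      using that subset_of_face_of[of G' P G] face_of_imp_subset rel_interior_subset by blast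
    thus ?thesis using that by blast
  qed
  define H :: "nat \<Rightarrow> 'n eq_class" where "H p = eq_euler_char \<Sigma> (twisted_forms a ?Z p) (twisted_restrict a ?Z)" for p
  have H: "H p = (\<Sum>m\<in>?M. of_int (weight_coeff ?Z p m) * exp_class (s_class m))" for p
  proof -
    \<comment> \<open>Weight m of the cohomology comes from the sections of index -m; substituting
      -m for m turns c(m) into s(m).\<close>
    have "H p = Sum_any (\<lambda>m. of_int (weight_coeff ?Z p (- m)) * exp_class (c_class m))"
      unfolding H_def eq_euler_char_def using weight_euler[OF up ZS] by simp
    also have "\<dots> = (\<Sum>m\<in>uminus ` ?M. of_int (weight_coeff ?Z p (- m)) * exp_class (c_class m))"
    proof (rule Sum_any.expand_superset)
      show "finite (uminus ` ?M)" using fM by simp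
      show "{m. of_int (weight_coeff ?Z p (- m)) * exp_class (c_class m) \<noteq> 0} \<subseteq> uminus ` ?M"
      proof
        fix m assume m: "m \<in> {m. of_int (weight_coeff ?Z p (- m)) * exp_class (c_class m) \<noteq> 0}"
        have "weight_coeff ?Z p (- m) \<noteq> 0"
        proof
          assume "weight_coeff ?Z p (- m) = 0"
          hence "of_int (weight_coeff ?Z p (- m)) * exp_class (c_class m) = 0" by (simp only: of_int_0 mult_zero_left)
          thus False using m by blast
        qed
        hence "- m \<in> ?M" using weight_coeff_outside[OF ZS, of "- m" p] by blast
        thus "m \<in> uminus ` ?M" by (metis image_eqI minus_minus)
      qed
    qed
    also have "\<dots> = (\<Sum>m\<in>?M. of_int (weight_coeff ?Z p m) * exp_class (s_class m))"
      by (subst sum.reindex) (simp_all add: exp_c_class_uminus)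
    finally show ?thesis .
  qed
  have "coeff (hirzebruch_poly \<Sigma> a Z) p = (\<Sum>q\<le>dim_of \<Sigma> Z. if q = p then H q else 0)"
    unfolding hirzebruch_poly_def H_def[symmetric] by (simp add: coeff_sum)
  also have "\<dots> = (if p \<le> dim_of \<Sigma> Z then H p else 0)" by simp
  also have "\<dots> = H p"
  proof (cases "p \<le> dim_of \<Sigma> Z")
    case False
    hence "dim_of \<Sigma> Z < p" by simp
    hence "H p = 0" unfolding H by (intro sum.neutral ballI) (simp only: weight_coeff_large of_int_0 mult_zero_left)
    thus ?thesis by simp
  qed simp
  also have "\<dots> = (\<Sum>E\<in>?F. \<Sum>m | rvec m \<in> rel_interior E. of_int (weight_coeff ?Z p m) * exp_class (s_class m))"
    unfolding H M by (rule sum.UNION_disjoint[OF fF]) (use fME disj in blast)+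
  also have "\<dots> = coeff (\<Sum>E | E face_of P \<and> E \<noteq> {}.
       Sum_any (\<lambda>l. (-1) ^ l * of_nat (fibre_mult \<Sigma> a Z E l) * [:1, 1:] ^ (l + nat (aff_dim E))) *
       (\<Sum>m | rvec m \<in> rel_interior E. [:exp_class (s_class m):])) p"
    unfolding coeff_sum
  proof (rule sum.cong[OF refl])
    fix E assume E: "E \<in> ?F"
    define Q :: "'n eq_class poly" where "Q = Sum_any (\<lambda>l. (-1) ^ l * of_nat (fibre_mult \<Sigma> a Z E l) * [:1, 1:] ^ (l + nat (aff_dim E)))"
    have "coeff (Q * (\<Sum>m | rvec m \<in> rel_interior E. [:exp_class (s_class m):])) p = (\<Sum>m | rvec m \<in> rel_interior E. coeff Q p * exp_class (s_class m))"
      unfolding sum_distrib_left coeff_sum by (intro sum.cong refl) (simp add: mult.commute[of Q] mult.commute)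
    also have "\<dots> = (\<Sum>m | rvec m \<in> rel_interior E. of_int (weight_coeff ?Z p m) * exp_class (s_class m))"
    proof (rule sum.cong[OF refl])
      fix m assume "m \<in> {m. rvec m \<in> rel_interior E}"
      hence "coeff Q p = of_int (weight_coeff ?Z p m)" unfolding Q_def using coeff_fibre_poly[of E m Z p] E by blast
      thus "coeff Q p * exp_class (s_class m) = of_int (weight_coeff ?Z p m) * exp_class (s_class m)" by (simp only:)
    qed
    finally show "(\<Sum>m | rvec m \<in> rel_interior E. of_int (weight_coeff ?Z p m) * exp_class (s_class m)) =
      coeff (Sum_any (\<lambda>l. (-1) ^ l * of_nat (fibre_mult \<Sigma> a Z E l) * [:1, 1:] ^ (l + nat (aff_dim E))) *
       (\<Sum>m | rvec m \<in> rel_interior E. [:exp_class (s_class m):])) p"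
      unfolding Q_def by simp
  qed
  finally show "coeff (hirzebruch_poly \<Sigma> a Z) p = coeff (\<Sum>E | E face_of P \<and> E \<noteq> {}.
       Sum_any (\<lambda>l. (-1) ^ l * of_nat (fibre_mult \<Sigma> a Z E l) * [:1, 1:] ^ (l + nat (aff_dim E))) *
       (\<Sum>m | rvec m \<in> rel_interior E. [:exp_class (s_class m):])) p" .
qed

end

theorem corollary3p16:
  fixes \<Sigma> :: "(real ^ 'n::finite) set set"
    and a :: "(real ^ 'n) set \<Rightarrow> int"
    and Z :: "'n point set"
  assumes "complete_fan \<Sigma>"
    and "cartier \<Sigma> a"
    and "globally_generated \<Sigma> a"
    and "zariski_closed \<Sigma> Z"
    and "torus_invariant Z"
  shows "hirzebruch_poly \<Sigma> a Z =
    (\<Sum>E | E face_of divisor_polytope \<Sigma> a \<and> E \<noteq> {}.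
       Sum_any (\<lambda>l. (-1) ^ l * of_nat (fibre_mult \<Sigma> a Z E l) *
                     [:1, 1:] ^ (l + nat (aff_dim E))) *
       (\<Sum>m | rvec m \<in> rel_interior E. [:exp_class (s_class m):]))"
proof -
  interpret gg_divisor \<Sigma> a by unfold_locales (use assms in auto)
  show ?thesis by (rule hirzebruch_formula[OF assms(4)])
qed

end
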